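(* Let $(\mathcal G,\Lambda)$ be a finite connected network with $N$ edges, with exterior vertices split into a nonempty set $\mathcal V_{\mathrm d}$ of damped vertices and a nonempty set $\mathcal V_{\mathrm u}$ of undamped vertices. Let $d=\#\mathcal V_{\mathrm d}$, let $\mathfrak D$ be a subset of $(\mathbb R_+)^d$, and let $\mathcal D=L^\infty(\mathbb R,\mathfrak D)$. The following statements are equivalent. (i) $\Sigma_\omega(\mathcal G,\Lambda,\mathcal D)$ is exponentially stable in $\mathsf X_p^\omega$ for some $p\in[1,+\infty]$. (ii) $\Sigma_\omega(\mathcal G,L,\mathcal D)$ is exponentially stable in $\mathsf X_p^\omega$ for every $L\in V_+(\Lambda)$ and every $p\in[1,+\infty]$.
   Context: Notation: $\mathbb R_+=[0,+\infty)$, $\mathbb R_+^\ast=(0,+\infty)$; $e_1,e_2,\dots$ is the canonical basis. For $\Lambda\in(\mathbb R_+^\ast)^N$, $Z(\Lambda)=\{\mathbf n\in\mathbb Z^N:\Lambda\cdot\mathbf n=0\}$ and $V_+(\Lambda)=\{L\in(\mathbb R_+^\ast)^N: Z(\Lambda)\subset Z(L)\}$. Graphs and networks. $\mathcal G=(\mathcal V,\mathcal E)$ is a finite connected graph, with $\mathcal E$ a set of unordered pairs $\{q,p\}$ of distinct vertices, endowed with an orientation $\alpha,\omega:\mathcal E\to\mathcal V$ such that $e=\{\alpha(e),\omega(e)\}$ for all $e\in\mathcal E$. We identify $\mathcal E$ with $\{1,\dots,N\}$. $\mathcal E_q$ is the set of edges having $q$ as an endpoint and $n_q=\#\mathcal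 E_q$. A vertex $q$ is exterior if $n_q\le1$ and interior otherwise; $\mathcal V_{\mathrm{ext}},\mathcal V_{\mathrm{int}}$ are the corresponding sets. It is assumed that $\mathcal V_{\mathrm{ext}}$ has at least two elements, and that $\mathcal V_{\mathrm{ext}}$ is the disjoint union of two nonempty sets $\mathcal V_{\mathrm d}$ (damped vertices) and $\mathcal V_{\mathrm u}$ (undamped vertices). A network $(\mathcal G,L)$ is such a graph with a vector $L=(L_1,\dots,L_N)\in(\mathbb R_+^\ast)^N$ of edge lengths. For a function $u_j$ on $[0,L_j]$ write $u_j(\alpha(j))=u_j(0)$, $u_j(\omega(j))=u_j(L_j)$, and for the normal derivatives $\frac{du_j}{dn_j}(\alpha(j))=-u_j'(0)$, $\frac{du_j}{dn_j}(\omega(j))=u_j'(L_j)$. The wave system. For $\eta=(\eta_q)_{q\in\mathcal V_{\mathrm d}}$ measurable with nonnegative components, $\Sigma_\omega(\mathcal G,L,\eta)$ is, for $t\ge0$, $\partial_t^2u_j=\partial_x^2u_j$ on $[0,L_j]$ for $j\in\{1,\dots,N\}$; $u_j(t,q)=u_k(t,q)$ for $q\in\mathcal V$, $j,k\in\mathcal E_q$; $\sum_{j\in\mathcal E_q}\frac{\partial u_j}{\partial n_j}(t,q)=0$ for $q\in\mathcal V_{\mathrm{int}}$; $\frac{\partial u_j}{\partial t}(t,q)=-\eta_q(t)\frac{\partial u_j}{\partial n_j}(t,q)$ for $q\in\mathcal V_{\mathrm d}$, $j\in\mathcal E_q$; $u_j(t,q)=0$ for $q\in\mathcal V_{\mathrm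 u}$, $j\in\mathcal E_q$. State space. $W^{1,p}_0(\mathcal G,L)$ is the set of $(u_1,\dots,u_N)\in\prod_jW^{1,p}([0,L_j],\mathbb C)$ with $u_j(q)=u_k(q)$ for all $q\in\mathcal V$, $j,k\in\mathcal E_q$, and $u_j(q)=0$ for all $q\in\mathcal V_{\mathrm u}$, $j\in\mathcal E_q$; $L^p(\mathcal G,L)=\prod_jL^p([0,L_j],\mathbb C)$. $\mathsf X_p^\omega=W_0^{1,p}(\mathcal G,L)\times L^p(\mathcal G,L)$ with norm $\|(u,v)\|_p=\big(\sum_j\|u_j'\|_{L^p}^p+\sum_j\|v_j\|_{L^p}^p\big)^{1/p}$ for $p<\infty$ and $\max_j\max(\|u_j'\|_{L^\infty},\|v_j\|_{L^\infty})$ for $p=\infty$. Solutions. Put $L^\tau_{2j-1}=L^\tau_{2j}=L_j$ and $\mathsf X_p^\tau=\prod_{i=1}^{2N}L^p([0,L_i^\tau],\mathbb C)$. The d'Alembert operator $T:\mathsf X_p^\omega\to\mathsf X_p^\tau$ is $T(u,v)=f$ with $f_{2j-1}(x)=u_j'(L_j-x)+v_j(L_j-x)$, $f_{2j}(x)=u_j'(x)-v_j(x)$. For $q\in\mathcal V$, $\Pi^q_{\mathrm{in}}$ (resp. $\Pi^q_{\mathrm{out}}$) is the $n_q\times2N$ matrix whose rows, indexed by $j\in\mathcal E_q$ in increasing order, are $e_{2j}^{\mathrm T}$ if $\omega(j)=q$ and $e_{2j-1}^{\mathrm T}$ if $\alpha(j)=q$ (resp. $e_{2j}^{\mathrm T}$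 if $\alpha(j)=q$ and $e_{2j-1}^{\mathrm T}$ if $\omega(j)=q$). With $J_n$ the $n\times n$ all-ones matrix and $D=\mathrm{diag}((-1)^j)_{j=1}^{2N}$, let $M^q(t)=(\Pi^q_{\mathrm{out}})^{\mathrm T}(\mathrm{Id}-\frac2{n_q}J_{n_q})\Pi^q_{\mathrm{in}}$ if $q\in\mathcal V_{\mathrm{int}}$, $(\Pi^q_{\mathrm{out}})^{\mathrm T}\Pi^q_{\mathrm{in}}$ if $q\in\mathcal V_{\mathrm u}$, $\frac{1-\eta_q(t)}{1+\eta_q(t)}(\Pi^q_{\mathrm{out}})^{\mathrm T}\Pi^q_{\mathrm{in}}$ if $q\in\mathcal V_{\mathrm d}$, and $M(t)=(m_{ik}(t))=-D\big(\sum_{q\in\mathcal V}M^q(t)\big)D$. The solution of the transport system $\partial_tf_i+\partial_xf_i=0$ on $[0,L_i^\tau]$, $f_i(t,0)=\sum_{k=1}^{2N}m_{ik}(t)f_k(t,L_k^\tau)$ with initial condition $f^0\in\mathsf X_p^\tau$ is understood along characteristics: $f_i(t,x)=g_i(t-x)$ where $g_i(s)=f^0_i(-s)$ for a.e. $s\in[-L_i^\tau,0)$ and $g_i(t)=\sum_km_{ik}(t)g_k(t-L_k^\tau)$ for a.e. $t\ge0$. A function $U:\mathbb R_+\to\mathsf X_p^\omega$ is the solution of $\Sigma_\omega(\mathcal G,L,\eta)$ with initial condition $U_0\in\mathsf X_p^\omega$ if $TU$ is the solution of this transport system with initial condition $TU_0$. Stability. $L^\infty(\mathbb R,\mathfrak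 D)$ is the set of essentially bounded measurable functions from $\mathbb R$ to $\mathfrak D$; $\Sigma_\omega(\mathcal G,L,\mathcal D)$ is the family of systems $\Sigma_\omega(\mathcal G,L,\eta)$, $\eta\in\mathcal D$. It is of exponential type $\gamma\in\mathbb R$ in $\mathsf X_p^\omega$ if for every $\varepsilon>0$ there is $K>0$ such that for all $\eta\in\mathcal D$ and $U_0\in\mathsf X_p^\omega$ the solution $U$ satisfies $\|U(t)\|_p\le Ke^{(\gamma+\varepsilon)t}\|U_0\|_p$ for all $t\ge0$. It is exponentially stable in $\mathsf X_p^\omega$ if it is of exponential type $\gamma$ for some $\gamma<0$. *)

theory Defs
  imports
    "HOL-Analysis.Analysis"
    "HOL-Probability.Essential_Supremum"
    "Graph_Theory.Digraph_Component"
begin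

section \<open>Oriented graphs\<close>

text \<open>
  The orientation is carried by a digraph with arcs \<open>1, \<dots>, N\<close>, tail \<open>\<alpha>\<close> and head \<open>\<omega>\<close>. Edge \<open>j\<close> stands
  for the unordered pair \<open>{\<alpha>(j), \<omega>(j)}\<close>; injectivity of this map excludes both parallel and
  antiparallel arcs, so that \<open>{1..N}\<close> is identified with a set of unordered pairs.
\<close>

definition inc_edges :: "('v, nat) pre_digraph \<Rightarrow> 'v \<Rightarrow> nat set" where
  "inc_edges G q = {j \<in> arcs G. tail G j = q \<or> head G j = q}"

definition exterior :: "('v, nat) pre_digraph \<Rightarrow> 'v set" where
  "exterior G = {q \<in> verts G. card (inc_edges G q) \<le> 1}"

definition interior_verts :: "('v, nat) pre_digraph \<Rightarrow> 'v set" where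
  "interior_verts G = verts G - exterior G"

definition network_graph ::
    "nat \<Rightarrow> ('v, nat) pre_digraph \<Rightarrow> 'v set \<Rightarrow> 'v set \<Rightarrow> bool" where
  "network_graph N G Vd Vu \<longleftrightarrow>
     digraph G \<and> arcs G = {1..N} \<and>
     inj_on (\<lambda>j. {tail G j, head G j}) (arcs G) \<and>
     Digraph_Component.connected G \<and>
     card (exterior G) \<ge> 2 \<and>
     exterior G = Vd \<union> Vu \<and> Vd \<inter> Vu = {} \<and> Vd \<noteq> {} \<and> Vu \<noteq> {}"

section \<open>Length vectors\<close>

text \<open>Vectors of length \<open>N\<close> are extensional functions on \<open>{1..N}\<close>.\<close>

definition Z_lat :: "nat \<Rightarrow> (nat \<Rightarrow> real) \<Rightarrow> (nat \<Rightarrow> int) set" where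
  "Z_lat N \<Lambda> = {n \<in> {1..N} \<rightarrow>\<^sub>E UNIV. (\<Sum>j=1..N. \<Lambda> j * of_int (n j)) = 0}"

definition V_plus :: "nat \<Rightarrow> (nat \<Rightarrow> real) \<Rightarrow> (nat \<Rightarrow> real) set" where
  "V_plus N \<Lambda> = {L \<in> {1..N} \<rightarrow>\<^sub>E {0<..}. Z_lat N \<Lambda> \<subseteq> Z_lat N L}"

section \<open>Lebesgue and Sobolev spaces\<close>

text \<open>
  Elements of \<open>L\<^sup>p\<close> are represented by functions; equality in \<open>L\<^sup>p\<close> is equality almost everywhere.
  The library's \<^const>\<open>esssup\<close> equals \<open>top\<close> on non-measurable functions.
\<close>

definition Lp_space :: "ennreal \<Rightarrow> 'a measure \<Rightarrow> ('a \<Rightarrow> complex) set" where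
  "Lp_space p M = {f \<in> borel_measurable M.
     if p = \<infinity> then esssup M (\<lambda>x. ennreal (norm (f x))) < \<infinity>
     else integrable M (\<lambda>x. norm (f x) powr enn2real p)}"

definition Lp_norm :: "ennreal \<Rightarrow> 'a measure \<Rightarrow> ('a \<Rightarrow> complex) \<Rightarrow> real" where
  "Lp_norm p M f =
     (if p = \<infinity> then enn2real (esssup M (\<lambda>x. ennreal (norm (f x))))
      else (\<integral>x. norm (f x) powr enn2real p \<partial>M) powr (1 / enn2real p))"

abbreviation leb_seg :: "real \<Rightarrow> real measure" where
  "leb_seg l \<equiv> lebesgue_on {0..l}"

text \<open>Weak derivatives on \<open>(0, l)\<close>, tested against \<open>C\<^sup>1\<close> functions with compact support in \<open>(0, l)\<close>.\<close>

definition has_weak_deriv :: "real \<Rightarrow> (real \<Rightarrow> complex) \<Rightarrow> (real \<Rightarrow> complex) \<Rightarrow> bool" where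
  "has_weak_deriv l u w \<longleftrightarrow>
     w \<in> Lp_space 1 (leb_seg l) \<and>
     (\<forall>\<phi> :: real \<Rightarrow> real. \<phi> C1_differentiable_on UNIV \<and> closure {x. \<phi> x \<noteq> 0} \<subseteq> {0<..<l} \<longrightarrow>
        (\<integral>x. u x * of_real (deriv \<phi> x) \<partial>leb_seg l) = - (\<integral>x. w x * of_real (\<phi> x) \<partial>leb_seg l))"

text \<open>The choice is unique up to equality almost everywhere on \<open>[0, l]\<close>.\<close>

definition weak_deriv :: "real \<Rightarrow> (real \<Rightarrow> complex) \<Rightarrow> real \<Rightarrow> complex" where
  "weak_deriv l u = (SOME w. has_weak_deriv l u w)"

text \<open>
  Every class in \<open>W\<^sup>1\<^sup>,\<^sup>p([0, l])\<close> has a unique continuous representative on \<open>[0, l]\<close>; this representative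
  is the one used here, so that the values at the endpoints are meaningful.
\<close>

definition W1p :: "ennreal \<Rightarrow> real \<Rightarrow> (real \<Rightarrow> complex) set" where
  "W1p p l = {u. continuous_on {0..l} u \<and> u \<in> Lp_space p (leb_seg l) \<and>
                 (\<exists>w \<in> Lp_space p (leb_seg l). has_weak_deriv l u w)}"

section \<open>State space\<close>

type_synonym edge_fun = "nat \<Rightarrow> real \<Rightarrow> complex"
type_synonym wave_state = "edge_fun \<times> edge_fun"

definition vert_val :: "('v, nat) pre_digraph \<Rightarrow> (nat \<Rightarrow> real) \<Rightarrow> edge_fun \<Rightarrow> nat \<Rightarrow> 'v \<Rightarrow> complex" where
  "vert_val G L u j q = (if q = tail G j then u j 0 else u j (L j))"

definition W01p :: "('v, nat) pre_digraph \<Rightarrow> (nat \<Rightarrow> real) \<Rightarrow> 'v set \<Rightarrow> ennreal \<Rightarrow> edge_fun set" where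
  "W01p G L Vu p = {u.
     (\<forall>j\<in>arcs G. u j \<in> W1p p (L j)) \<and>
     (\<forall>q\<in>verts G. \<forall>j\<in>inc_edges G q. \<forall>k\<in>inc_edges G q. vert_val G L u j q = vert_val G L u k q) \<and>
     (\<forall>q\<in>Vu. \<forall>j\<in>inc_edges G q. vert_val G L u j q = 0)}"

definition Lp_net :: "('v, nat) pre_digraph \<Rightarrow> (nat \<Rightarrow> real) \<Rightarrow> ennreal \<Rightarrow> edge_fun set" where
  "Lp_net G L p = {v. \<forall>j\<in>arcs G. v j \<in> Lp_space p (leb_seg (L j))}"

definition X_wave :: "('v, nat) pre_digraph \<Rightarrow> (nat \<Rightarrow> real) \<Rightarrow> 'v set \<Rightarrow> ennreal \<Rightarrow> wave_state set" where
  "X_wave G L Vu p = W01p G L Vu p \<times> Lp_net G L p"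

definition X_norm :: "('v, nat) pre_digraph \<Rightarrow> (nat \<Rightarrow> real) \<Rightarrow> ennreal \<Rightarrow> wave_state \<Rightarrow> real" where
  "X_norm G L p = (\<lambda>(u, v).
     if p = \<infinity> then
       (MAX j\<in>arcs G. max (Lp_norm p (leb_seg (L j)) (weak_deriv (L j) (u j)))
                          (Lp_norm p (leb_seg (L j)) (v j)))
     else
       ((\<Sum>j\<in>arcs G. Lp_norm p (leb_seg (L j)) (weak_deriv (L j) (u j)) powr enn2real p) +
        (\<Sum>j\<in>arcs G. Lp_norm p (leb_seg (L j)) (v j) powr enn2real p)) powr (1 / enn2real p))"

section \<open>Transport system and solutions\<close>

text \<open>The transport index \<open>i\<close> belongs to edge \<open>(i + 1) div 2\<close>, i.e. both \<open>2j - 1\<close> and \<open>2j\<close> to edge \<open>j\<close>.\<close>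

definition L_tr :: "(nat \<Rightarrow> real) \<Rightarrow> nat \<Rightarrow> real" where
  "L_tr L i = L ((i + 1) div 2)"

definition dAlembert :: "(nat \<Rightarrow> real) \<Rightarrow> wave_state \<Rightarrow> edge_fun" where
  "dAlembert L = (\<lambda>(u, v) i x.
     let j = (i + 1) div 2 in
     if odd i then weak_deriv (L j) (u j) (L j - x) + v j (L j - x)
     else weak_deriv (L j) (u j) x - v j x)"

text \<open>
  Matrices are entry functions. The rows of \<open>\<Pi>\<^sub>i\<^sub>n\<close> and \<open>\<Pi>\<^sub>o\<^sub>u\<^sub>t\<close> are indexed directly by the edges incident
  to \<open>q\<close>, the columns by \<open>1, \<dots>, 2N\<close>; hence \<open>\<Pi>\<^sub>o\<^sub>u\<^sub>t\<^sup>T A \<Pi>\<^sub>i\<^sub>n\<close> does not depend on an ordering of these edges.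
\<close>

definition Pi_in :: "('v, nat) pre_digraph \<Rightarrow> 'v \<Rightarrow> nat \<Rightarrow> nat \<Rightarrow> real" where
  "Pi_in G q j i = of_bool (i = (if head G j = q then 2 * j else 2 * j - 1))"

definition Pi_out :: "('v, nat) pre_digraph \<Rightarrow> 'v \<Rightarrow> nat \<Rightarrow> nat \<Rightarrow> real" where
  "Pi_out G q j i = of_bool (i = (if tail G j = q then 2 * j else 2 * j - 1))"

definition sandwich ::
    "('v, nat) pre_digraph \<Rightarrow> 'v \<Rightarrow> (nat \<Rightarrow> nat \<Rightarrow> real) \<Rightarrow> nat \<Rightarrow> nat \<Rightarrow> real" where
  "sandwich G q A i k =
     (\<Sum>j\<in>inc_edges G q. \<Sum>l\<in>inc_edges G q. Pi_out G q j i * A j l * Pi_in G q l k)"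

definition M_vert ::
    "('v, nat) pre_digraph \<Rightarrow> 'v set \<Rightarrow> ('v \<Rightarrow> real) \<Rightarrow> 'v \<Rightarrow> nat \<Rightarrow> nat \<Rightarrow> real" where
  "M_vert G Vu h q i k =
     (if q \<in> interior_verts G then
        sandwich G q (\<lambda>j l. of_bool (j = l) - 2 / real (card (inc_edges G q))) i k
      else if q \<in> Vu then
        sandwich G q (\<lambda>j l. of_bool (j = l)) i k
      else
        (1 - h q) / (1 + h q) * sandwich G q (\<lambda>j l. of_bool (j = l)) i k)"

text \<open>The argument \<open>h\<close> is the value \<open>\<eta>(t)\<close>; the outer factors are the diagonal matrix \<open>diag((-1)\<^sup>i)\<close>.\<close>

definition M_tr :: "('v, nat) pre_digraph \<Rightarrow> 'v set \<Rightarrow> ('v \<Rightarrow> real) \<Rightarrow> nat \<Rightarrow> nat \<Rightarrow> real" where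
  "M_tr G Vu h i k = - ((-1) ^ i * (\<Sum>q\<in>verts G. M_vert G Vu h q i k) * (-1) ^ k)"

definition transport_solution ::
    "nat \<Rightarrow> (nat \<Rightarrow> real) \<Rightarrow> (real \<Rightarrow> nat \<Rightarrow> nat \<Rightarrow> real) \<Rightarrow> edge_fun \<Rightarrow> (real \<Rightarrow> edge_fun) \<Rightarrow> bool" where
  "transport_solution n \<tau> m f0 f \<longleftrightarrow>
     (\<exists>g :: nat \<Rightarrow> real \<Rightarrow> complex. \<forall>i\<in>{1..n}.
        (AE s in lebesgue. s \<in> {- \<tau> i..<0} \<longrightarrow> g i s = f0 i (- s)) \<and>
        (AE t in lebesgue. 0 \<le> t \<longrightarrow> g i t = (\<Sum>k=1..n. of_real (m t i k) * g k (t - \<tau> k))) \<and>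
        (\<forall>t\<ge>0. AE x in leb_seg (\<tau> i). f t i x = g i (t - x)))"

definition wave_solution ::
    "('v, nat) pre_digraph \<Rightarrow> 'v set \<Rightarrow> (nat \<Rightarrow> real) \<Rightarrow> (real \<Rightarrow> 'v \<Rightarrow> real) \<Rightarrow> ennreal \<Rightarrow>
     wave_state \<Rightarrow> (real \<Rightarrow> wave_state) \<Rightarrow> bool" where
  "wave_solution G Vu L \<eta> p U0 U \<longleftrightarrow>
     (\<forall>t\<ge>0. U t \<in> X_wave G L Vu p) \<and>
     transport_solution (2 * card (arcs G)) (L_tr L) (\<lambda>t. M_tr G Vu (\<eta> t))
       (dAlembert L U0) (\<lambda>t. dAlembert L (U t))"

section \<open>Stability\<close>

text \<open>Vectors of length \<open>d = #V\<^sub>d\<close> are extensional functions on \<open>V\<^sub>d\<close>.\<close>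

definition Linfty :: "'v set \<Rightarrow> ('v \<Rightarrow> real) set \<Rightarrow> (real \<Rightarrow> 'v \<Rightarrow> real) set" where
  "Linfty Vd \<DD> = {\<eta>. (\<forall>t. \<eta> t \<in> \<DD>) \<and> \<eta> \<in> measurable lebesgue (Pi\<^sub>M Vd (\<lambda>_. borel)) \<and>
                      (\<exists>C. AE t in lebesgue. \<forall>q\<in>Vd. \<bar>\<eta> t q\<bar> \<le> C)}"

definition exp_type ::
    "('v, nat) pre_digraph \<Rightarrow> 'v set \<Rightarrow> (nat \<Rightarrow> real) \<Rightarrow> (real \<Rightarrow> 'v \<Rightarrow> real) set \<Rightarrow> ennreal \<Rightarrow> real \<Rightarrow> bool" where
  "exp_type G Vu L \<D> p \<gamma> \<longleftrightarrow>
     (\<forall>\<epsilon>>0. \<exists>K>0. \<forall>\<eta>\<in>\<D>. \<forall>U0\<in>X_wave G L Vu p. \<forall>U. wave_solution G Vu L \<eta> p U0 U \<longrightarrow>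
        (\<forall>t\<ge>0. X_norm G L p (U t) \<le> K * exp ((\<gamma> + \<epsilon>) * t) * X_norm G L p U0))"

definition exp_stable ::
    "('v, nat) pre_digraph \<Rightarrow> 'v set \<Rightarrow> (nat \<Rightarrow> real) \<Rightarrow> (real \<Rightarrow> 'v \<Rightarrow> real) set \<Rightarrow> ennreal \<Rightarrow> bool" where
  "exp_stable G Vu L \<D> p \<longleftrightarrow> (\<exists>\<gamma><0. exp_type G Vu L \<D> p \<gamma>)"

end

theory Submission
  imports Defs "HOL-Real_Asymp.Real_Asymp"
begin

text \<open>
  Unrolling \<open>g\<^sub>i(t) = \<Sum>\<^sub>k m\<^sub>i\<^sub>k(t) g\<^sub>k(t - \<tau>\<^sub>k)\<close> writes \<open>g\<^sub>i(t)\<close> as a sum over words of transport indices: a word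
  contributes the product of the matrix entries met when going back along the corresponding delays,
  times an initial datum at time \<open>t\<close> minus the length of the word. Words of equal length and equal last
  letter see the same datum, so only the sums of their weights matter.

  Stability for \<open>\<Lambda>\<close> in a single \<open>X\<^sub>p\<close> makes these sums decay exponentially in the length, uniformly in
  the values of \<open>\<eta>\<close> along the grid of lengths: measurable \<open>\<eta>\<close> can take any prescribed values near
  finitely many points, and a narrow initial bump isolates one sum. A bump of zero mean is the image
  of a wave state under the d'Alembert operator, so no graph structure beyond the vertex conditions
  enters. If \<open>Z(\<Lambda>) \<subseteq> Z(L)\<close>, the \<open>\<Lambda>\<close>-length of a word determines its \<open>L\<close>-length, hence every sum for \<open>L\<close>
  splits into polynomially many sums for \<open>\<Lambda>\<close> and decays as well. Finally, at each time only
  polynomially many lengths contribute, so the decay gives stability for \<open>L\<close> in every \<open>X\<^sub>p\<close>.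
\<close>

section \<open>Words of delays\<close>

text \<open>Two features keep \<open>p\<close> out of the estimates. In the lower bound, the initial
  bump and the piece of the solution that it produces live on intervals of one common width
  \<open>r\<close>, so both norms scale like r^(1/p) and the width cancels, however small it must be
  to isolate one length. In the upper bound, the solution is a finite sum of translates of the data,
  and a translation followed by a restriction increases no L^p norm.

  The damping depends on time only and is sampled at \<open>t\<close> minus the lengths of prefixes
  of a word, so passing from \<Lambda> to \<open>L\<close> moves the sampling times. Since the
  \<Lambda>-length of a word determines its \<open>L\<close>-length, every damping signal for
  \<open>L\<close> is, along words, also a signal for \<Lambda>. The transferred signal has no
  regularity; therefore decay for \<Lambda> is proved for arbitrary assignments of values to times,
  of which each weight sees only finitely many.\<close>

definition wlen :: "(nat \<Rightarrow> real) \<Rightarrow> nat list \<Rightarrow> real" where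
  "wlen \<tau> w = sum_list (map \<tau> w)"

text \<open>A word is read backwards in time: its head is the delay taken first, from time
  \<open>t\<close>. The entry \<open>m t i k\<close> is sampled before the delay of \<open>k\<close>
  is subtracted, so the full length of the word is never a sampling time.\<close>

fun wt :: "(nat \<Rightarrow> real) \<Rightarrow> (real \<Rightarrow> nat \<Rightarrow> nat \<Rightarrow> real) \<Rightarrow> real \<Rightarrow> nat \<Rightarrow> nat list \<Rightarrow> real" where
  "wt \<tau> m t i [] = 1"
| "wt \<tau> m t i (k # w) = m t i k * wt \<tau> m (t - \<tau> k) k w"

lemma wlen_simps [simp]:
  "wlen \<tau> [] = 0" "wlen \<tau> (k # w) = \<tau> k + wlen \<tau> w" "wlen \<tau> (v @ w) = wlen \<tau> v + wlen \<tau> w"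
  by (simp_all add: wlen_def)

text \<open>Lengths are linear in the letter counts. This links them to integer relations between
  delays and keeps the number of distinct lengths polynomial.\<close>

lemma wlen_eq_sum_count:
  assumes "finite I"
  shows "set w \<subseteq> I \<Longrightarrow> wlen \<sigma> w = (\<Sum>i\<in>I. real (count_list w i) * \<sigma> i)"
proof (induction w)
  case (Cons k w)
  have "(\<Sum>i\<in>I. real (count_list (k # w) i) * \<sigma> i) =
      (\<Sum>i\<in>I. real (count_list w i) * \<sigma> i + (if i = k then \<sigma> k else 0))"
    by (rule sum.cong) (auto simp: algebra_simps)
  also have "\<dots> = wlen \<sigma> w + \<sigma> k"
    using Cons assms by (simp add: sum.distrib sum.delta)
  finally show ?case by simp
qed simp

text \<open>Only lengths of proper prefixes are sampled, hence the condition that \<open>v\<close>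
  is nonempty. The delays may change together with the matrices: this serves both to replace the
  damping near a grid of times and to pass from one length vector to another.\<close>

lemma wt_cong:
  assumes "\<And>u. set u \<subseteq> set w \<Longrightarrow> (\<exists>v. v \<noteq> [] \<and> w = u @ v) \<Longrightarrow> m' (t' - wlen \<tau>' u) = m (t - wlen \<tau> u)"
  shows "wt \<tau>' m' t' i w = wt \<tau> m t i w"
  using assms
proof (induction w arbitrary: t t' i)
  case (Cons k w)
  have "m' t' = m t" using Cons.prems[of "[]"] by simp
  moreover have "wt \<tau>' m' (t' - \<tau>' k) k w = wt \<tau> m (t - \<tau> k) k w"
  proof (rule Cons.IH)
    fix u assume "set u \<subseteq> set w" "\<exists>v. v \<noteq> [] \<and> w = u @ v"
    then show "m' (t' - \<tau>' k - wlen \<tau>' u) = m (t - \<tau> k - wlen \<tau> u)"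
      using Cons.prems[of "k # u"] by (auto simp: algebra_simps)
  qed
  ultimately show ?case by simp
qed simp

section \<open>Classes of words and the unrolled solution\<close>

definition word_class :: "nat set \<Rightarrow> (nat \<Rightarrow> real) \<Rightarrow> nat \<Rightarrow> real \<Rightarrow> nat list set" where
  "word_class I \<tau> k s = {w. w \<noteq> [] \<and> set w \<subseteq> I \<and> last w = k \<and> wlen \<tau> w = s}"

definition class_wt ::
    "nat set \<Rightarrow> (nat \<Rightarrow> real) \<Rightarrow> (real \<Rightarrow> nat \<Rightarrow> nat \<Rightarrow> real) \<Rightarrow> real \<Rightarrow> nat \<Rightarrow> nat \<Rightarrow> real \<Rightarrow> real" where
  "class_wt I \<tau> m t i k s = (\<Sum>w\<in>word_class I \<tau> k s. wt \<tau> m t i w)"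

text \<open>The two inequalities say that the last delay leads from a time \<ge> 0 into the initial
  interval of its own component. For positive delays all shorter prefixes then end at times \<ge> 0
  as well.\<close>

definition exit_words :: "nat set \<Rightarrow> (nat \<Rightarrow> real) \<Rightarrow> real \<Rightarrow> nat list set" where
  "exit_words I \<tau> t =
     {w. w \<noteq> [] \<and> set w \<subseteq> I \<and> - \<tau> (last w) \<le> t - wlen \<tau> w \<and> t - wlen \<tau> w < 0}"

definition word_sum ::
    "nat set \<Rightarrow> (nat \<Rightarrow> real) \<Rightarrow> (real \<Rightarrow> nat \<Rightarrow> nat \<Rightarrow> real) \<Rightarrow> (nat \<Rightarrow> real \<Rightarrow> complex) \<Rightarrow>
     nat \<Rightarrow> real \<Rightarrow> complex" where
  "word_sum I \<tau> m \<phi> i t =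
     (\<Sum>w\<in>exit_words I \<tau> t. of_real (wt \<tau> m t i w) * \<phi> (last w) (t - wlen \<tau> w))"

definition grid :: "nat set \<Rightarrow> (nat \<Rightarrow> real) \<Rightarrow> real \<Rightarrow> real set" where
  "grid I \<tau> B = wlen \<tau> ` {w. set w \<subseteq> I \<and> wlen \<tau> w \<le> B}"

text \<open>The lower bound \<open>d\<close> turns a bound on the length of a word into a bound on
  its number of letters, and it allows induction over time slices of width \<open>d\<close>: on one
  slice the recursion reads only earlier slices.\<close>

locale delays =
  fixes I :: "nat set" and \<tau> :: "nat \<Rightarrow> real" and d :: real
  assumes fin_I: "finite I" and d_pos: "0 < d" and d_le: "\<And>i. i \<in> I \<Longrightarrow> d \<le> \<tau> i"
begin

lemma tau_pos: "i \<in> I \<Longrightarrow> 0 < \<tau> i"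
  using d_pos d_le by fastforce

lemma length_le_wlen: "set w \<subseteq> I \<Longrightarrow> d * length w \<le> wlen \<tau> w"
proof (induction w)
  case (Cons k w)
  then have "d * length w \<le> wlen \<tau> w" "d \<le> \<tau> k" using d_le by auto
  then show ?case by (simp add: algebra_simps)
qed simp

lemma wlen_nonneg: "set w \<subseteq> I \<Longrightarrow> 0 \<le> wlen \<tau> w"
  using length_le_wlen[of w] d_pos by (smt (verit) mult_nonneg_nonneg of_nat_0_le_iff)

lemma wlen_ge_last: "w \<noteq> [] \<Longrightarrow> set w \<subseteq> I \<Longrightarrow> \<tau> (last w) \<le> wlen \<tau> w"
proof -
  assume w: "w \<noteq> []" "set w \<subseteq> I"
  have "wlen \<tau> w = wlen \<tau> (butlast w) + \<tau> (last w)"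
    by (metis append_butlast_last_id w(1) wlen_simps(1,2,3) add.right_neutral)
  moreover have "0 \<le> wlen \<tau> (butlast w)"
    using w(2) by (intro wlen_nonneg) (meson in_set_butlastD subset_iff)
  ultimately show ?thesis by simp
qed

lemma length_le_of_wlen_le:
  assumes "set w \<subseteq> I" "wlen \<tau> w \<le> B"
  shows "length w \<le> nat \<lfloor>B / d\<rfloor>"
proof -
  have "d * length w \<le> B" using length_le_wlen assms by fastforce
  then have "real (length w) \<le> B / d" using d_pos by (simp add: field_simps)
  then have "int (length w) \<le> \<lfloor>B / d\<rfloor>" by (simp add: le_floor_iff)
  then show ?thesis by simp
qed

lemma finite_words: "finite {w. set w \<subseteq> I \<and> wlen \<tau> w \<le> B}"
  by (rule finite_subset[OF _ finite_lists_length_le[OF fin_I, of "nat \<lfloor>B / d\<rfloor>"]])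
     (use length_le_of_wlen_le in auto)

lemma finite_grid: "finite (grid I \<tau> B)"
  unfolding grid_def using finite_words by simp

lemma finite_word_class: "finite (word_class I \<tau> k s)"
  by (rule finite_subset[OF _ finite_words[of s]]) (auto simp: word_class_def)

lemma exit_words_wlen:
  assumes "w \<in> exit_words I \<tau> t" "\<And>i. i \<in> I \<Longrightarrow> \<tau> i \<le> b"
  shows "wlen \<tau> w \<le> t + b"
proof -
  have "last w \<in> I" using assms(1) by (auto simp: exit_words_def)
  then show ?thesis using assms(1) assms(2)[of "last w"] by (auto simp: exit_words_def)
qed

lemma finite_exit_words: "finite (exit_words I \<tau> t)"
proof (rule finite_subset[OF _ finite_words[of "t + Max (\<tau> ` I)"]])
  show "exit_words I \<tau> t \<subseteq> {w. set w \<subseteq> I \<and> wlen \<tau> w \<le> t + Max (\<tau> ` I)}"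
  proof
    fix w assume "w \<in> exit_words I \<tau> t"
    then show "w \<in> {w. set w \<subseteq> I \<and> wlen \<tau> w \<le> t + Max (\<tau> ` I)}"
      using exit_words_wlen[of w t "Max (\<tau> ` I)"] fin_I by (auto simp: exit_words_def)
  qed
qed

lemma exit_words_neg: "t < 0 \<Longrightarrow> exit_words I \<tau> t = {}"
  using wlen_ge_last by (force simp: exit_words_def)

text \<open>The word stops at once if its first delay already leads below zero. This case needs the
  explicit \<open>{[]}\<close>, because \<open>exit_words\<close> contains no empty word and is
  empty at negative times.\<close>

lemma exit_words_step:
  assumes "0 \<le> t"
  shows "exit_words I \<tau> t =
    (\<Union>k\<in>I. (#) k ` (if t - \<tau> k < 0 then {[]} else exit_words I \<tau> (t - \<tau> k)))" (is "_ = ?R")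
proof (intro set_eqI iffI)
  fix w assume w: "w \<in> exit_words I \<tau> t"
  then obtain k w' where kw: "w = k # w'" by (auto simp: exit_words_def neq_Nil_conv)
  with w have k: "k \<in> I" by (auto simp: exit_words_def)
  have "w' \<in> (if t - \<tau> k < 0 then {[]} else exit_words I \<tau> (t - \<tau> k))"
  proof (cases "w' = []")
    case True then show ?thesis using w kw by (auto simp: exit_words_def)
  next
    case False
    then have "w' \<in> exit_words I \<tau> (t - \<tau> k)" using w kw by (auto simp: exit_words_def algebra_simps)
    then show ?thesis using exit_words_neg[of "t - \<tau> k"] by auto
  qed
  then show "w \<in> ?R" using k kw by blast
next
  fix w assume "w \<in> ?R"
  then obtain k w' where *: "k \<in> I" "w = k # w'"
    "w' \<in> (if t - \<tau> k < 0 then {[]} else exit_words I \<tau> (t - \<tau> k))" by blast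
  then show "w \<in> exit_words I \<tau> t"
    using assms by (auto simp: exit_words_def algebra_simps split: if_splits)
qed

lemma word_sum_step:
  assumes "0 \<le> t"
  shows "word_sum I \<tau> m \<phi> i t =
    (\<Sum>k\<in>I. of_real (m t i k) *
       (if t - \<tau> k < 0 then \<phi> k (t - \<tau> k) else word_sum I \<tau> m \<phi> k (t - \<tau> k)))"
proof -
  let ?X = "\<lambda>k. if t - \<tau> k < 0 then {[]} else exit_words I \<tau> (t - \<tau> k)"
  let ?f = "\<lambda>w. of_real (wt \<tau> m t i w) * \<phi> (last w) (t - wlen \<tau> w)"
  have "word_sum I \<tau> m \<phi> i t = sum ?f (\<Union>k\<in>I. (#) k ` ?X k)"
    unfolding word_sum_def exit_words_step[OF assms] ..
  also have "\<dots> = (\<Sum>k\<in>I. sum ?f ((#) k ` ?X k))"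
    by (rule sum.UNION_disjoint) (use fin_I finite_exit_words in \<open>auto split: if_splits\<close>)
  also have "\<dots> = (\<Sum>k\<in>I. of_real (m t i k) *
       (if t - \<tau> k < 0 then \<phi> k (t - \<tau> k) else word_sum I \<tau> m \<phi> k (t - \<tau> k)))"
  proof (rule sum.cong[OF refl])
    fix k assume "k \<in> I"
    have "sum ?f ((#) k ` ?X k) = (\<Sum>w\<in>?X k. ?f (k # w))"
      by (subst sum.reindex) auto
    also have "\<dots> = of_real (m t i k) *
       (if t - \<tau> k < 0 then \<phi> k (t - \<tau> k) else word_sum I \<tau> m \<phi> k (t - \<tau> k))"
    proof (cases "t - \<tau> k < 0")
      case False
      have "(\<Sum>w\<in>exit_words I \<tau> (t - \<tau> k). ?f (k # w)) =
        (\<Sum>w\<in>exit_words I \<tau> (t - \<tau> k). of_real (m t i k) *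
          (of_real (wt \<tau> m (t - \<tau> k) k w) * \<phi> (last w) (t - \<tau> k - wlen \<tau> w)))"
        by (rule sum.cong) (auto simp: exit_words_def algebra_simps)
      then show ?thesis using False by (simp add: word_sum_def sum_distrib_left)
    qed simp
    finally show "sum ?f ((#) k ` ?X k) = \<dots>" .
  qed
  finally show ?thesis .
qed

text \<open>The set \<open>X\<close> is there because a given solution satisfies the recursion only
  almost everywhere: in the application it is the orbit of one good time under all delays. The
  induction runs over slices of width \<open>d\<close>.\<close>

lemma word_sum_unique:
  assumes closed: "\<And>x k. x \<in> X \<Longrightarrow> k \<in> I \<Longrightarrow> x - \<tau> k \<in> X"
    and rec: "\<And>x i. x \<in> X \<Longrightarrow> 0 \<le> x \<Longrightarrow> i \<in> I \<Longrightarrow>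
                g i x = (\<Sum>k\<in>I. of_real (m x i k) * g k (x - \<tau> k))"
    and x: "x \<in> X" "0 \<le> x" "i \<in> I"
  shows "g i x = word_sum I \<tau> m g i x"
proof -
  have "\<forall>x i. x \<in> X \<and> 0 \<le> x \<and> x < real n * d \<and> i \<in> I \<longrightarrow> g i x = word_sum I \<tau> m g i x" for n
  proof (induction n)
    case (Suc n)
    show ?case
    proof clarify
      fix x i assume x: "x \<in> X" "0 \<le> x" "x < real (Suc n) * d" "i \<in> I"
      have "g i x = (\<Sum>k\<in>I. of_real (m x i k) * g k (x - \<tau> k))" using rec x by blast
      also have "\<dots> = word_sum I \<tau> m g i x"
        unfolding word_sum_step[OF x(2)]
      proof (rule sum.cong[OF refl])
        fix k assume k: "k \<in> I"
        have "x - \<tau> k < real n * d" using x(3) d_le[OF k] by (simp add: algebra_simps)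
        then have "0 \<le> x - \<tau> k \<Longrightarrow> g k (x - \<tau> k) = word_sum I \<tau> m g k (x - \<tau> k)"
          using Suc.IH closed[OF x(1) k] k by blast
        then show "of_real (m x i k) * g k (x - \<tau> k) = of_real (m x i k) *
          (if x - \<tau> k < 0 then g k (x - \<tau> k) else word_sum I \<tau> m g k (x - \<tau> k))" by auto
      qed
      finally show "g i x = word_sum I \<tau> m g i x" .
    qed
  qed auto
  moreover obtain n where "x < real n * d" using d_pos reals_Archimedean3 by blast
  ultimately show ?thesis using x by blast
qed

text \<open>If the time condition holds for \<open>(k, s)\<close>, the exit words of that type are
  the whole word class, possibly empty; otherwise there are none. Hence \<open>A\<close> may contain
  lengths that no exit word has, and one \<open>A\<close> can serve a whole interval of
  times.\<close>

lemma word_sum_by_class: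
  assumes "finite A" "wlen \<tau> ` exit_words I \<tau> t \<subseteq> A"
  shows "word_sum I \<tau> m \<phi> i t = (\<Sum>k\<in>I. \<Sum>s\<in>A.
    if - \<tau> k \<le> t - s \<and> t - s < 0 then of_real (class_wt I \<tau> m t i k s) * \<phi> k (t - s) else 0)"
proof -
  let ?f = "\<lambda>w. of_real (wt \<tau> m t i w) * \<phi> (last w) (t - wlen \<tau> w)"
  let ?g = "\<lambda>w. (last w, wlen \<tau> w)"
  have "word_sum I \<tau> m \<phi> i t = (\<Sum>y\<in>I \<times> A. sum ?f {w \<in> exit_words I \<tau> t. ?g w = y})"
    unfolding word_sum_def
    by (rule sum.group[symmetric]) (use assms fin_I finite_exit_words in \<open>auto simp: exit_words_def\<close>)
  also have "\<dots> = (\<Sum>k\<in>I. \<Sum>s\<in>A. sum ?f {w \<in> exit_words I \<tau> t. ?g w = (k, s)})"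
    by (subst sum.cartesian_product) (auto intro: sum.cong)
  also have "\<dots> = (\<Sum>k\<in>I. \<Sum>s\<in>A.
    if - \<tau> k \<le> t - s \<and> t - s < 0 then of_real (class_wt I \<tau> m t i k s) * \<phi> k (t - s) else 0)"
  proof (intro sum.cong refl)
    fix k s assume "k \<in> I"
    show "sum ?f {w \<in> exit_words I \<tau> t. ?g w = (k, s)} =
      (if - \<tau> k \<le> t - s \<and> t - s < 0 then of_real (class_wt I \<tau> m t i k s) * \<phi> k (t - s) else 0)"
    proof (cases "- \<tau> k \<le> t - s \<and> t - s < 0")
      case True
      then have "{w \<in> exit_words I \<tau> t. ?g w = (k, s)} = word_class I \<tau> k s"
        by (auto simp: exit_words_def word_class_def)
      moreover have "sum ?f (word_class I \<tau> k s) =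
          (\<Sum>w\<in>word_class I \<tau> k s. of_real (wt \<tau> m t i w) * \<phi> k (t - s))"
        by (rule sum.cong) (auto simp: word_class_def)
      ultimately show ?thesis
        using True by (simp add: class_wt_def sum_distrib_right)
    next
      case False
      then have "{w \<in> exit_words I \<tau> t. ?g w = (k, s)} = {}"
        by (auto simp: exit_words_def)
      then show ?thesis using False by (metis (no_types, lifting) sum.empty)
    qed
  qed
  finally show ?thesis .
qed

text \<open>Only the number of occurrences of each letter matters, which makes the count polynomial.\<close>

lemma card_wlen_image:
  "card (wlen \<sigma> ` {w. set w \<subseteq> I \<and> wlen \<tau> w \<le> B}) \<le> Suc (nat \<lfloor>B / d\<rfloor>) ^ card I"
proof -
  let ?n = "nat \<lfloor>B / d\<rfloor>"
  let ?P = "I \<rightarrow>\<^sub>E {..?n}"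
  let ?f = "\<lambda>c::nat \<Rightarrow> nat. \<Sum>i\<in>I. real (c i) * \<sigma> i"
  have "wlen \<sigma> ` {w. set w \<subseteq> I \<and> wlen \<tau> w \<le> B} \<subseteq> ?f ` ?P"
  proof
    fix y assume "y \<in> wlen \<sigma> ` {w. set w \<subseteq> I \<and> wlen \<tau> w \<le> B}"
    then obtain w where w: "set w \<subseteq> I" "wlen \<tau> w \<le> B" "y = wlen \<sigma> w" by blast
    have "restrict (count_list w) I \<in> ?P"
      using length_le_of_wlen_le[OF w(1,2)] count_le_length[of w] by (fastforce intro: order_trans)
    moreover have "?f (restrict (count_list w) I) = y"
      using wlen_eq_sum_count[OF fin_I w(1)] w(3) by simp
    ultimately show "y \<in> ?f ` ?P" by blast
  qed
  moreover have "finite ?P" using fin_I by (intro finite_PiE) auto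
  ultimately have "card (wlen \<sigma> ` {w. set w \<subseteq> I \<and> wlen \<tau> w \<le> B}) \<le> card ?P"
    by (meson card_image_le card_mono finite_imageI le_trans)
  also have "card ?P = Suc ?n ^ card I" using fin_I by (simp add: card_PiE)
  finally show ?thesis .
qed

end

text \<open>The weights for \<open>L\<close> are weights for \<Lambda> with another assignment of
  matrices to times. An \<open>L\<close>-class is a disjoint union of \<Lambda>-classes,
  polynomially many in \<open>s\<close>, and each of them decays by hypothesis.\<close>

lemma class_wt_transfer:
  fixes Mf :: "'e \<Rightarrow> nat \<Rightarrow> nat \<Rightarrow> real" and h :: "real \<Rightarrow> 'e"
  assumes "delays I \<Lambda> d'" and L: "delays I L d"
    and determ: "\<And>u v. set u \<subseteq> I \<Longrightarrow> set v \<subseteq> I \<Longrightarrow> wlen \<Lambda> u = wlen \<Lambda> v \<Longrightarrow> wlen L u = wlen L v"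
    and c: "0 < c" "\<And>i. i \<in> I \<Longrightarrow> c * L i \<le> \<Lambda> i"
    and K: "0 \<le> K" "0 < \<gamma>"
    and bound: "\<And>h i k s. (\<And>x. h x \<in> D) \<Longrightarrow> i \<in> I \<Longrightarrow> k \<in> I \<Longrightarrow>
        \<bar>class_wt I \<Lambda> (\<lambda>x. Mf (h x)) 0 i k s\<bar> \<le> K * exp (- \<gamma> * s)"
    and h: "\<And>x. h x \<in> D" and ik: "i \<in> I" "k \<in> I"
  shows "\<bar>class_wt I L (\<lambda>x. Mf (h x)) t i k s\<bar> \<le> K * Suc (nat \<lfloor>s / d\<rfloor>) ^ card I * exp (- \<gamma> * c * s)"
proof -
  interpret \<Lambda>: delays I \<Lambda> d' by fact
  interpret L: delays I L d by fact
  \<comment> \<open>Sends the \<Lambda>-length of a word to its \<open>L\<close>-length;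
    \<open>determ\<close> makes the choice of the word immaterial.\<close>
  define \<phi> where "\<phi> x = wlen L (SOME u. set u \<subseteq> I \<and> wlen \<Lambda> u = x)" for x
  have \<phi>: "\<phi> (wlen \<Lambda> u) = wlen L u" if "set u \<subseteq> I" for u
  proof -
    have "set (SOME v. set v \<subseteq> I \<and> wlen \<Lambda> v = wlen \<Lambda> u) \<subseteq> I \<and>
        wlen \<Lambda> (SOME v. set v \<subseteq> I \<and> wlen \<Lambda> v = wlen \<Lambda> u) = wlen \<Lambda> u"
      by (rule someI[of _ u]) (use that in simp)
    then show ?thesis unfolding \<phi>_def using determ that by blast
  qed
  \<comment> \<open>Weights for \<Lambda> start at time 0 and sample at minus a \<Lambda>-length;
    there \<open>h'\<close> returns what \<open>h\<close> gives at \<open>t\<close> minus the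
    matching \<open>L\<close>-length.\<close>
  define h' where "h' x = h (t - \<phi> (- x))" for x
  have h': "h' x \<in> D" for x using h by (simp add: h'_def)
  have wt_eq: "wt L (\<lambda>x. Mf (h x)) t i w = wt \<Lambda> (\<lambda>x. Mf (h' x)) 0 i w" if "set w \<subseteq> I" for w
  proof (rule wt_cong)
    fix u assume "set u \<subseteq> set w"
    then have "set u \<subseteq> I" using that by blast
    then show "Mf (h (t - wlen L u)) = Mf (h' (0 - wlen \<Lambda> u))"
      by (simp add: h'_def \<phi>)
  qed
  let ?X = "wlen \<Lambda> ` word_class I L k s"
  have fX: "finite ?X" using L.finite_word_class by blast
  \<comment> \<open>By \<open>determ\<close>, a \<Lambda>-class that meets the
    \<open>L\<close>-class lies inside it.\<close>
  have split: "word_class I L k s = (\<Union>\<sigma>\<in>?X. word_class I \<Lambda> k \<sigma>)"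
  proof (intro set_eqI iffI)
    fix w assume "w \<in> (\<Union>\<sigma>\<in>?X. word_class I \<Lambda> k \<sigma>)"
    then obtain v where "v \<in> word_class I L k s" "w \<in> word_class I \<Lambda> k (wlen \<Lambda> v)" by blast
    then show "w \<in> word_class I L k s" using determ[of w v] by (auto simp: word_class_def)
  qed (auto simp: word_class_def)
  have "class_wt I L (\<lambda>x. Mf (h x)) t i k s = (\<Sum>w\<in>word_class I L k s. wt \<Lambda> (\<lambda>x. Mf (h' x)) 0 i w)"
    unfolding class_wt_def by (rule sum.cong) (auto simp: word_class_def intro: wt_eq)
  also have "\<dots> = (\<Sum>\<sigma>\<in>?X. class_wt I \<Lambda> (\<lambda>x. Mf (h' x)) 0 i k \<sigma>)"
    unfolding class_wt_def
    by (subst split, rule sum.UNION_disjoint[OF fX])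
       (use \<Lambda>.finite_word_class in \<open>auto simp: word_class_def\<close>)
  finally have "\<bar>class_wt I L (\<lambda>x. Mf (h x)) t i k s\<bar> \<le> (\<Sum>\<sigma>\<in>?X. \<bar>class_wt I \<Lambda> (\<lambda>x. Mf (h' x)) 0 i k \<sigma>\<bar>)"
    by simp
  also have "\<dots> \<le> (\<Sum>\<sigma>\<in>?X. K * exp (- \<gamma> * c * s))"
  proof (rule sum_mono)
    fix \<sigma> assume "\<sigma> \<in> ?X"
    then obtain w where w: "set w \<subseteq> I" "wlen L w = s" "\<sigma> = wlen \<Lambda> w" by (auto simp: word_class_def)
    have "c * wlen L w \<le> wlen \<Lambda> w" using w(1)
    proof (induction w)
      case (Cons a w) then show ?case using c(2)[of a] by (simp add: algebra_simps)
    qed simp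
    then have "exp (- \<gamma> * \<sigma>) \<le> exp (- \<gamma> * c * s)" using w K(2) by simp
    moreover have "\<bar>class_wt I \<Lambda> (\<lambda>x. Mf (h' x)) 0 i k \<sigma>\<bar> \<le> K * exp (- \<gamma> * \<sigma>)"
      by (rule bound) (use h' ik in auto)
    ultimately show "\<bar>class_wt I \<Lambda> (\<lambda>x. Mf (h' x)) 0 i k \<sigma>\<bar> \<le> K * exp (- \<gamma> * c * s)"
      using K(1) by (meson mult_left_mono order_trans)
  qed
  also have "\<dots> = real (card ?X) * (K * exp (- \<gamma> * c * s))" by simp
  also have "\<dots> \<le> real (Suc (nat \<lfloor>s / d\<rfloor>) ^ card I) * (K * exp (- \<gamma> * c * s))"
  proof (rule mult_right_mono)
    have "?X \<subseteq> wlen \<Lambda> ` {w. set w \<subseteq> I \<and> wlen L w \<le> s}" by (auto simp: word_class_def)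
    then have "card ?X \<le> card (wlen \<Lambda> ` {w. set w \<subseteq> I \<and> wlen L w \<le> s})"
      using L.finite_words by (intro card_mono) auto
    also have "\<dots> \<le> Suc (nat \<lfloor>s / d\<rfloor>) ^ card I" by (rule L.card_wlen_image)
    finally show "real (card ?X) \<le> real (Suc (nat \<lfloor>s / d\<rfloor>) ^ card I)" by (simp only: of_nat_le_iff)
  qed (use K in simp)
  finally show ?thesis by (simp add: mult.assoc mult.left_commute)
qed

section \<open>Lebesgue norms\<close>

text \<open>One factor \<open>card A\<close> comes from bounding the pointwise sum by its largest
  term, the other from (card A)^(1/p) \<le> card A. The constant is crude but the same for all
  \<open>p\<close>.\<close>

lemma Lp_dominated:
  fixes w :: "'a \<Rightarrow> complex" and \<phi> :: "'b \<Rightarrow> 'a \<Rightarrow> complex"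
  assumes p: "1 \<le> p" and w: "w \<in> borel_measurable M" and A: "finite A" and c: "0 \<le> c"
    and AE: "AE x in M. norm (w x) \<le> c * (\<Sum>a\<in>A. norm (\<phi> a x))"
    and \<phi>: "\<And>a. a \<in> A \<Longrightarrow> \<phi> a \<in> Lp_space p M" "\<And>a. a \<in> A \<Longrightarrow> Lp_norm p M (\<phi> a) \<le> B"
    and B: "0 \<le> B"
  shows "w \<in> Lp_space p M" and "Lp_norm p M w \<le> c * real (card A)^2 * B"
proof -
  have n_le: "real (card A) \<le> real (card A)^2"
    unfolding of_nat_power[symmetric] of_nat_le_iff by (simp add: power2_eq_square)
  have "w \<in> Lp_space p M \<and> Lp_norm p M w \<le> c * real (card A)^2 * B"
  proof (cases "p = \<infinity>")
    case True
    have 1: "AE x in M. norm (\<phi> a x) \<le> B" if a: "a \<in> A" for a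
    proof -
      let ?e = "esssup M (\<lambda>x. ennreal (norm (\<phi> a x)))"
      have "?e < \<infinity>" using \<phi>(1)[OF a] True by (simp add: Lp_space_def)
      then have "?e = ennreal (enn2real ?e)" by simp
      also have "\<dots> \<le> ennreal B" using \<phi>(2)[OF a] True by (simp add: Lp_norm_def ennreal_leI)
      finally have e: "?e \<le> ennreal B" .
      have "AE x in M. ennreal (norm (\<phi> a x)) \<le> ?e" by (rule esssup_AE)
      then show ?thesis
      proof (rule AE_mp, intro AE_I2 impI)
        fix x assume "ennreal (norm (\<phi> a x)) \<le> ?e"
        then have "ennreal (norm (\<phi> a x)) \<le> ennreal B" using e by order
        then show "norm (\<phi> a x) \<le> B" using B by (simp add: ennreal_le_iff)
      qed
    qed
    have "AE x in M. \<forall>a\<in>A. norm (\<phi> a x) \<le> B"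
      using A 1 by (simp add: AE_ball_countable countable_finite)
    then have "AE x in M. ennreal (norm (w x)) \<le> ennreal (c * (card A * B))"
      using AE
    proof eventually_elim
      case (elim x)
      have "(\<Sum>a\<in>A. norm (\<phi> a x)) \<le> (\<Sum>a\<in>A. B)" using elim by (intro sum_mono) auto
      then have "c * (\<Sum>a\<in>A. norm (\<phi> a x)) \<le> c * (card A * B)"
        using c by (intro mult_left_mono) simp_all
      then have "norm (w x) \<le> c * (card A * B)" using elim(2) by simp
      then show ?case by (rule ennreal_leI)
    qed
    then have e: "esssup M (\<lambda>x. ennreal (norm (w x))) \<le> ennreal (c * (card A * B))"
      using w by (intro esssup_I) auto
    then have "esssup M (\<lambda>x. ennreal (norm (w x))) < \<infinity>"
      by (metis ennreal_less_top infinity_ennreal_def order_le_less_trans)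
    moreover have "enn2real (esssup M (\<lambda>x. ennreal (norm (w x)))) \<le> c * (card A * B)"
      using e B c by (intro enn2real_leI) auto
    moreover have "c * (card A * B) \<le> c * real (card A)^2 * B"
      using mult_left_mono[OF mult_right_mono[OF n_le B] c] by (simp add: mult.assoc)
    ultimately show ?thesis using True w by (simp add: Lp_space_def Lp_norm_def)
  next
    case False
    define q where "q = enn2real p"
    have q: "1 \<le> q"
      using p False unfolding q_def
      by (metis enn2real_1 enn2real_mono infinity_ennreal_def top.not_eq_extremum)
    let ?n = "real (card A)"
    have int: "integrable M (\<lambda>x. norm (\<phi> a x) powr q)" if "a \<in> A" for a
      using \<phi>(1)[OF that] False by (simp add: Lp_space_def q_def)
    have dom: "AE x in M. norm (w x) powr q \<le> (c * ?n) powr q * (\<Sum>a\<in>A. norm (\<phi> a x) powr q)"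
      using AE
    proof eventually_elim
      case (elim x)
      show ?case
      proof (cases "A = {}")
        case True with elim show ?thesis by simp
      next
        case False
        define y where "y = Max ((\<lambda>a. norm (\<phi> a x)) ` A)"
        have y: "norm (\<phi> a x) \<le> y" if "a \<in> A" for a using A that by (simp add: y_def)
        have "y \<in> (\<lambda>a. norm (\<phi> a x)) ` A" unfolding y_def using A False by (intro Max_in) auto
        then obtain a where a: "a \<in> A" "y = norm (\<phi> a x)" by blast
        have "(\<Sum>a\<in>A. norm (\<phi> a x)) \<le> ?n * y" using y by (rule sum_bounded_above)
        then have "c * (\<Sum>a\<in>A. norm (\<phi> a x)) \<le> c * (?n * y)" using c by (rule mult_left_mono)
        then have "norm (w x) \<le> c * ?n * y" using elim by (simp add: mult.assoc)
        then have "norm (w x) powr q \<le> (c * ?n * y) powr q" using q by (intro powr_mono2) auto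
        also have "\<dots> = (c * ?n) powr q * y powr q" using c a by (intro powr_mult)
        also have "y powr q \<le> (\<Sum>a\<in>A. norm (\<phi> a x) powr q)"
          unfolding a(2) using A a(1) by (intro member_le_sum) auto
        finally show ?thesis by (simp add: mult_left_mono)
      qed
    qed
    have intR: "integrable M (\<lambda>x. (c * ?n) powr q * (\<Sum>a\<in>A. norm (\<phi> a x) powr q))"
      using int by auto
    have mw: "(\<lambda>x. norm (w x) powr q) \<in> borel_measurable M" using w by measurable
    have intw: "integrable M (\<lambda>x. norm (w x) powr q)"
      by (rule Bochner_Integration.integrable_bound[OF intR mw])
         (use dom in \<open>eventually_elim, auto intro: order_trans[OF _ abs_ge_self]\<close>)
    have na: "(\<integral>x. norm (\<phi> a x) powr q \<partial>M) \<le> B powr q" if a: "a \<in> A" for a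
    proof -
      have "(\<integral>x. norm (\<phi> a x) powr q \<partial>M) = ((\<integral>x. norm (\<phi> a x) powr q \<partial>M) powr (1 / q)) powr q"
        using q by (simp add: powr_powr)
      also have "\<dots> \<le> B powr q"
        using \<phi>(2)[OF a] False q by (intro powr_mono2) (auto simp: Lp_norm_def q_def)
      finally show ?thesis .
    qed
    have "(\<integral>x. norm (w x) powr q \<partial>M) \<le> (\<integral>x. (c * ?n) powr q * (\<Sum>a\<in>A. norm (\<phi> a x) powr q) \<partial>M)"
      by (rule integral_mono_AE[OF intw intR dom])
    also have "\<dots> = (c * ?n) powr q * (\<Sum>a\<in>A. \<integral>x. norm (\<phi> a x) powr q \<partial>M)"
      using int by simp
    also have "\<dots> \<le> (c * ?n) powr q * (?n * B powr q)"
      using na by (intro mult_left_mono sum_bounded_above) auto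
    finally have "(\<integral>x. norm (w x) powr q \<partial>M) powr (1 / q) \<le> ((c * ?n) powr q * (?n * B powr q)) powr (1 / q)"
      using q by (intro powr_mono2) auto
    also have "\<dots> = c * ?n * (?n powr (1 / q) * B)"
      using q c B by (simp add: powr_mult powr_powr)
    also have "\<dots> \<le> c * ?n * (?n * B)"
    proof (cases "card A = 0")
      case False
      then have "?n powr (1 / q) \<le> ?n powr 1" using q by (intro powr_mono) (auto simp: field_simps)
      then show ?thesis using c B by (intro mult_left_mono mult_right_mono) auto
    qed simp
    finally have "(\<integral>x. norm (w x) powr q \<partial>M) powr (1 / q) \<le> c * ?n^2 * B"
      by (simp add: power2_eq_square mult.assoc)
    then show ?thesis using False w intw by (simp add: Lp_space_def Lp_norm_def q_def)
  qed
  then show "w \<in> Lp_space p M" "Lp_norm p M w \<le> c * real (card A)^2 * B" by auto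
qed

lemma Lp_norm_nonneg: "0 \<le> Lp_norm p M f"
  by (simp add: Lp_norm_def)

section \<open>Changes of variable in Lebesgue spaces\<close>

lemma Lp_AE_cong:
  assumes "f \<in> borel_measurable M" "g \<in> borel_measurable M" "AE x in M. f x = g x"
  shows "f \<in> Lp_space p M \<longleftrightarrow> g \<in> Lp_space p M" "Lp_norm p M f = Lp_norm p M g"
proof -
  have "esssup M (\<lambda>x. ennreal (norm (f x))) = esssup M (\<lambda>x. ennreal (norm (g x)))"
    by (rule esssup_AE_cong) (use assms in auto)
  moreover have "integrable M (\<lambda>x. norm (f x) powr enn2real p) = integrable M (\<lambda>x. norm (g x) powr enn2real p)"
    by (rule integrable_cong_AE) (use assms in auto)
  moreover have "(\<integral>x. norm (f x) powr enn2real p \<partial>M) = (\<integral>x. norm (g x) powr enn2real p \<partial>M)"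
    by (rule integral_cong_AE) (use assms in auto)
  ultimately show "f \<in> Lp_space p M \<longleftrightarrow> g \<in> Lp_space p M" "Lp_norm p M f = Lp_norm p M g"
    using assms by (simp_all add: Lp_space_def Lp_norm_def)
qed

text \<open>A nondegenerate affine map scales Lebesgue measure by a constant, so preimages of null
  sets are null. The set where \<open>P\<close> fails may be nonmeasurable, hence the detour through
  a null set \<open>N\<close>.\<close>

lemma AE_lebesgue_affine:
  fixes c t :: real
  assumes "c \<noteq> 0" "AE x in lebesgue. P x"
  shows "AE x in lebesgue. P (t + c * x)"
proof -
  have m: "(\<lambda>x. t + c * x) \<in> lebesgue \<rightarrow>\<^sub>M lebesgue"
    using lebesgue_affine_measurable[where c = "\<lambda>x::real. c"] assms(1) by simp
  obtain N where N: "N \<in> null_sets lebesgue" "{x. \<not> P x} \<subseteq> N"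
    by (rule AE_E[OF assms(2)], rule that) auto
  have "AE x in density (distr lebesgue lebesgue (\<lambda>x. t + c * x)) (\<lambda>_. ennreal \<bar>c\<bar>). x \<notin> N"
    unfolding lebesgue_real_affine[OF assms(1), of t, symmetric] using N(1) by (rule AE_not_in)
  then have "AE x in distr lebesgue lebesgue (\<lambda>x. t + c * x). x \<notin> N"
    using assms(1) by (subst (asm) AE_density) auto
  then have "AE x in lebesgue. t + c * x \<notin> N"
    using N(1) m by (subst (asm) AE_distr_iff) (use sets.compl_sets[of N lebesgue] in \<open>auto simp: null_sets_def set_diff_eq\<close>)
  then show ?thesis by (rule AE_mp) (use N(2) in auto)
qed

lemma AE_leb_seg: "(AE x in leb_seg l. P x) \<longleftrightarrow> (AE x in lebesgue. x \<in> {0..l} \<longrightarrow> P x)"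
  by (subst AE_restrict_space_iff) auto

lemma AE_leb_seg_reflect:
  assumes "AE x in leb_seg l. P x"
  shows "AE x in leb_seg l. P (l - x)"
  using AE_lebesgue_affine[of "-1" "\<lambda>x. x \<in> {0..l} \<longrightarrow> P x" l] assms
  unfolding AE_leb_seg by (auto elim!: eventually_mono)

text \<open>Extension by zero makes translates and reflections meaningful on every segment, so that
  functions on edges of different lengths can be compared.\<close>

definition ext0 :: "real \<Rightarrow> (real \<Rightarrow> complex) \<Rightarrow> real \<Rightarrow> complex" where
  "ext0 l f x = (if x \<in> {0..l} then f x else 0)"

lemma ext0_measurable: "f \<in> borel_measurable (leb_seg l) \<Longrightarrow> ext0 l f \<in> borel_measurable lebesgue"
  unfolding ext0_def using borel_measurable_if_I[of f "{0..l}"] by auto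

text \<open>With |c| = 1 the substitution preserves norms on the whole line, and restriction to
  \<open>[0, l']\<close> can only decrease them.\<close>

lemma Lp_ext0_affine:
  assumes f: "f \<in> Lp_space p (leb_seg l)" and c: "\<bar>c\<bar> = 1"
    and g_def: "g = (\<lambda>x. ext0 l f (t + c * x))"
  shows "g \<in> Lp_space p (leb_seg l')" "Lp_norm p (leb_seg l') g \<le> Lp_norm p (leb_seg l) f"
proof -
  have c0: "c \<noteq> 0" using c by auto
  have fm: "f \<in> borel_measurable (leb_seg l)" using f by (simp add: Lp_space_def)
  have gm: "g \<in> borel_measurable lebesgue"
    unfolding g_def using borel_measurable_affine[OF ext0_measurable[OF fm] c0, of t] by simp
  then have gm': "g \<in> borel_measurable (leb_seg l')" by (rule measurable_restrict_space1)
  have "g \<in> Lp_space p (leb_seg l') \<and> Lp_norm p (leb_seg l') g \<le> Lp_norm p (leb_seg l) f"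
  proof (cases "p = \<infinity>")
    case True
    let ?e = "esssup (leb_seg l) (\<lambda>x. ennreal (norm (f x)))"
    have "AE x in leb_seg l. ennreal (norm (f x)) \<le> ?e" by (rule esssup_AE)
    then have "AE x in lebesgue. ennreal (norm (ext0 l f x)) \<le> ?e"
      unfolding AE_leb_seg by (rule AE_mp) (auto simp: ext0_def)
    then have "AE x in lebesgue. ennreal (norm (g x)) \<le> ?e"
      unfolding g_def by (rule AE_lebesgue_affine[OF c0])
    then have "AE x in leb_seg l'. ennreal (norm (g x)) \<le> ?e"
      unfolding AE_leb_seg by (rule AE_mp) auto
    then have le: "esssup (leb_seg l') (\<lambda>x. ennreal (norm (g x))) \<le> ?e"
      using gm' by (intro esssup_I) auto
    moreover have "?e < \<infinity>" using f True by (simp add: Lp_space_def)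
    ultimately have "esssup (leb_seg l') (\<lambda>x. ennreal (norm (g x))) < \<infinity>" by order
    then show ?thesis
      using True gm' le \<open>?e < \<infinity>\<close> by (simp add: Lp_space_def Lp_norm_def enn2real_mono)
  next
    case False
    define q where "q = enn2real p"
    define F where "F x = norm (ext0 l f x) powr q" for x
    have if_f: "integrable (leb_seg l) (\<lambda>x. norm (f x) powr q)"
      using f False by (simp add: Lp_space_def q_def)
    have Feq: "F = (\<lambda>x. indicat_real {0..l} x *\<^sub>R norm (f x) powr q)"
      by (auto simp: F_def ext0_def fun_eq_iff)
    have F: "integrable lebesgue F" "(\<integral>x. F x \<partial>lebesgue) = (\<integral>x. norm (f x) powr q \<partial>leb_seg l)"
      unfolding Feq using if_f
      by (auto simp: integrable_restrict_space integral_restrict_space set_integrable_def)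
    have G: "integrable lebesgue (\<lambda>x. F (t + c * x))" using F(1) c0
      by (rule lebesgue_integrable_real_affine)
    have Gi: "(\<integral>x. F (t + c * x) \<partial>lebesgue) = (\<integral>x. F x \<partial>lebesgue)"
      using lebesgue_integral_real_affine[OF c0, of F t] c by simp
    have g_eq: "norm (g x) powr q = F (t + c * x)" for x by (simp add: g_def F_def)
    have set: "set_integrable lebesgue {0..l'} (\<lambda>x. F (t + c * x))"
      unfolding set_integrable_def by (rule integrable_mult_indicator[OF _ G]) auto
    have i1: "integrable (leb_seg l') (\<lambda>x. norm (g x) powr q)"
      unfolding g_eq using set by (subst integrable_restrict_space) (auto simp: set_integrable_def)
    have "(\<integral>x. norm (g x) powr q \<partial>leb_seg l') = (\<integral>x. indicat_real {0..l'} x *\<^sub>R F (t + c * x) \<partial>lebesgue)"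
      unfolding g_eq by (subst integral_restrict_space) auto
    also have "\<dots> \<le> (\<integral>x. F (t + c * x) \<partial>lebesgue)"
      using set G by (intro integral_mono) (auto simp: set_integrable_def indicator_def F_def)
    finally have "(\<integral>x. norm (g x) powr q \<partial>leb_seg l') \<le> (\<integral>x. norm (f x) powr q \<partial>leb_seg l)"
      using Gi F(2) by simp
    then have "(\<integral>x. norm (g x) powr q \<partial>leb_seg l') powr (1 / q) \<le> (\<integral>x. norm (f x) powr q \<partial>leb_seg l) powr (1 / q)"
      by (intro powr_mono2) (auto simp: q_def)
    then show ?thesis using False gm' i1 by (simp add: Lp_space_def Lp_norm_def q_def)
  qed
  then show "g \<in> Lp_space p (leb_seg l')" "Lp_norm p (leb_seg l') g \<le> Lp_norm p (leb_seg l) f" by auto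
qed

lemma Lp_const: "(\<lambda>_. c) \<in> Lp_space p (leb_seg l)"
proof -
  have "esssup (leb_seg l) (\<lambda>x. ennreal (norm c)) \<le> ennreal (norm c)"
    by (rule esssup_I) auto
  then have "esssup (leb_seg l) (\<lambda>x. ennreal (norm c)) < \<infinity>"
    by (metis ennreal_less_top infinity_ennreal_def order_le_less_trans)
  moreover have "finite_measure (leb_seg l)"
    by (rule finite_measure_lebesgue_on) (simp add: lmeasurable_interval)
  ultimately show ?thesis
    by (auto simp: Lp_space_def intro!: finite_measure.integrable_const)
qed

lemma Lp_bounded:
  assumes "1 \<le> p" "f \<in> borel_measurable (leb_seg l)" "AE x in leb_seg l. norm (f x) \<le> B"
  shows "f \<in> Lp_space p (leb_seg l)"
proof (rule Lp_dominated(1)[OF assms(1,2), of "{()}" 1 "\<lambda>_ _. of_real B" "Lp_norm p (leb_seg l) (\<lambda>_. of_real B)"])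
  show "AE x in leb_seg l. norm (f x) \<le> 1 * (\<Sum>a\<in>{()}. norm (complex_of_real B))"
    using assms(3) by (rule AE_mp) auto
qed (auto simp: Lp_const Lp_norm_nonneg)

text \<open>The norm depends on the width alone, which lets widths cancel between intervals at
  different places. Both half-open shapes occur because a reflection moves the closed end to the
  other side.\<close>

lemma Lp_norm_indicator_interval:
  assumes r: "0 < r" and a: "0 \<le> a" "a + r \<le> l" and S: "S = {a..<a+r} \<or> S = {a<..a+r}"
  shows "(\<lambda>x. of_real (indicat_real S x)) \<in> Lp_space p (leb_seg l)" (is ?A)
    and "Lp_norm p (leb_seg l) (\<lambda>x. of_real (indicat_real S x)) =
           (if p = \<infinity> then 1 else r powr (1 / enn2real p))" (is ?B)
proof -
  have Ss: "S \<in> sets lebesgue" "S \<subseteq> {0..l}" using S a r by auto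
  have S': "S \<in> sets (leb_seg l)" using Ss by (simp add: sets_restrict_space_iff)
  have em: "emeasure (leb_seg l) S = ennreal r"
    using S r Ss by (subst emeasure_restrict_space) auto
  have meas: "(\<lambda>x. complex_of_real (indicat_real S x)) \<in> borel_measurable (leb_seg l)"
    using S' by measurable
  show ?A ?B
  proof -
    have "?A \<and> ?B"
    proof (cases "p = \<infinity>")
      case True
      let ?e = "esssup (leb_seg l) (\<lambda>x. ennreal (norm (complex_of_real (indicat_real S x))))"
      have m1: "(\<lambda>x. ennreal (norm (complex_of_real (indicat_real S x)))) \<in> borel_measurable (leb_seg l)"
        using meas by measurable
      have "?e \<le> 1" by (rule esssup_I[OF m1]) (auto simp: indicator_def)
      \<comment> \<open>With an essential supremum below 1 the indicator would vanish almost
        everywhere, although \<open>S\<close> has measure \<open>r\<close> > 0.\<close>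
      moreover have "\<not> ?e < 1"
      proof
        assume e: "?e < 1"
        have "AE x in leb_seg l. ennreal (norm (complex_of_real (indicat_real S x))) \<le> ?e"
          by (rule esssup_AE)
        then have "AE x in leb_seg l. x \<notin> S"
          by (rule AE_mp) (use e in \<open>auto simp: indicator_def\<close>)
        then have "emeasure (leb_seg l) S = 0"
        proof -
          have "{x \<in> space (leb_seg l). \<not> x \<notin> S} = S" using Ss by auto
          then show ?thesis using AE_iff_measurable[OF S', of "\<lambda>x. x \<notin> S"] \<open>AE x in leb_seg l. x \<notin> S\<close> by blast
        qed
        then show False using em r by simp
      qed
      ultimately have "?e = 1" by simp
      then show ?thesis using True meas by (simp add: Lp_space_def Lp_norm_def)
    next
      case False
      have eq: "indicat_real S x powr enn2real p = indicat_real S x" for x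
        by (auto simp: indicator_def)
      have "integrable (leb_seg l) (indicat_real S)"
        using S' em Int_absorb2[OF Ss(2)] by (simp add: integrable_indicator_iff)
      moreover have "(\<integral>x. indicat_real S x \<partial>leb_seg l) = r"
        using S' em r sets.sets_into_space[OF S'] by (simp add: measure_def Int_absorb2)
      ultimately show ?thesis using False meas by (simp add: Lp_space_def Lp_norm_def eq)
    qed
    then show ?A ?B by auto
  qed
qed

section \<open>The state norm and the norms of its components\<close>

lemma X_norm_ge:
  assumes p: "1 \<le> p" and fin: "finite (arcs G)" and j: "j \<in> arcs G"
  shows "Lp_norm p (leb_seg (L j)) (weak_deriv (L j) (u j)) \<le> X_norm G L p (u, v)" (is "?a \<le> _")
    and "Lp_norm p (leb_seg (L j)) (v j) \<le> X_norm G L p (u, v)" (is "?b \<le> _")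
proof -
  have "?a \<le> X_norm G L p (u, v) \<and> ?b \<le> X_norm G L p (u, v)"
  proof (cases "p = \<infinity>")
    case True
    let ?f = "\<lambda>j. max (Lp_norm p (leb_seg (L j)) (weak_deriv (L j) (u j))) (Lp_norm p (leb_seg (L j)) (v j))"
    have "?f j \<le> Max (?f ` arcs G)" using fin j by (intro Max_ge) auto
    then show ?thesis using True by (simp add: X_norm_def)
  next
    case False
    define q where "q = enn2real p"
    have q: "1 \<le> q"
      using p False unfolding q_def
      by (metis enn2real_1 enn2real_mono infinity_ennreal_def top.not_eq_extremum)
    let ?A = "\<lambda>j. Lp_norm p (leb_seg (L j)) (weak_deriv (L j) (u j)) powr q"
    let ?B = "\<lambda>j. Lp_norm p (leb_seg (L j)) (v j) powr q"
    have X: "X_norm G L p (u, v) = (sum ?A (arcs G) + sum ?B (arcs G)) powr (1 / q)"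
      using False by (simp add: X_norm_def q_def)
    have nn: "0 \<le> sum ?A (arcs G)" "0 \<le> sum ?B (arcs G)" by (auto intro: sum_nonneg)
    have "?A j \<le> sum ?A (arcs G)" "?B j \<le> sum ?B (arcs G)" using fin j by (auto intro: member_le_sum)
    then have "?A j \<le> sum ?A (arcs G) + sum ?B (arcs G)" "?B j \<le> sum ?A (arcs G) + sum ?B (arcs G)"
      using nn by auto
    then have "?A j powr (1 / q) \<le> X_norm G L p (u, v)" "?B j powr (1 / q) \<le> X_norm G L p (u, v)"
      unfolding X using q by (auto intro!: powr_mono2)
    then show ?thesis using q by (simp add: powr_powr Lp_norm_nonneg)
  qed
  then show "?a \<le> X_norm G L p (u, v)" "?b \<le> X_norm G L p (u, v)" by auto
qed

text \<open>For finite \<open>p\<close> the estimate gives the constant (2 card)^(1/p), which is at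
  most 2 card because there is at least one edge; one constant thus serves all exponents.\<close>

lemma X_norm_le:
  assumes p: "1 \<le> p" and fin: "finite (arcs G)" "arcs G \<noteq> {}" and B: "0 \<le> B"
    and "\<And>j. j \<in> arcs G \<Longrightarrow> Lp_norm p (leb_seg (L j)) (weak_deriv (L j) (u j)) \<le> B"
    and "\<And>j. j \<in> arcs G \<Longrightarrow> Lp_norm p (leb_seg (L j)) (v j) \<le> B"
  shows "X_norm G L p (u, v) \<le> 2 * real (card (arcs G)) * B"
proof (cases "p = \<infinity>")
  case True
  let ?f = "\<lambda>j. max (Lp_norm p (leb_seg (L j)) (weak_deriv (L j) (u j))) (Lp_norm p (leb_seg (L j)) (v j))"
  have "Max (?f ` arcs G) \<le> B" using fin assms(5,6) by (intro Max.boundedI) auto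
  then have "X_norm G L p (u, v) \<le> 1 * B" using True by (simp add: X_norm_def)
  also have "\<dots> \<le> 2 * real (card (arcs G)) * B"
  proof (rule mult_right_mono[OF _ B])
    have "1 \<le> card (arcs G)" using fin by (simp add: Suc_leI card_gt_0_iff)
    then show "1 \<le> 2 * real (card (arcs G))" by linarith
  qed
  finally show ?thesis .
next
  case False
  define q where "q = enn2real p"
  have q: "1 \<le> q"
    using p False unfolding q_def
    by (metis enn2real_1 enn2real_mono infinity_ennreal_def top.not_eq_extremum)
  let ?A = "\<lambda>j. Lp_norm p (leb_seg (L j)) (weak_deriv (L j) (u j)) powr q"
  let ?B = "\<lambda>j. Lp_norm p (leb_seg (L j)) (v j) powr q"
  let ?n = "real (card (arcs G))"
  have n: "1 \<le> 2 * ?n"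
  proof -
    have "1 \<le> card (arcs G)" using fin by (simp add: Suc_leI card_gt_0_iff)
    then show "1 \<le> 2 * real (card (arcs G))" by linarith
  qed
  have X: "X_norm G L p (u, v) = (sum ?A (arcs G) + sum ?B (arcs G)) powr (1 / q)"
    using False by (simp add: X_norm_def q_def)
  have "sum ?A (arcs G) \<le> ?n * B powr q" "sum ?B (arcs G) \<le> ?n * B powr q"
    using assms(5,6) q by (auto intro!: sum_bounded_above powr_mono2 simp: Lp_norm_nonneg)
  then have "X_norm G L p (u, v) \<le> (2 * ?n * B powr q) powr (1 / q)"
    unfolding X using q by (intro powr_mono2) (auto intro!: add_nonneg_nonneg sum_nonneg)
  also have "\<dots> = (2 * ?n) powr (1 / q) * B" using q B by (simp add: powr_mult powr_powr)
  also have "\<dots> \<le> (2 * ?n) powr 1 * B"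
    using q n B by (intro mult_right_mono powr_mono) (auto simp: field_simps)
  finally show ?thesis using n by simp
qed

section \<open>Weak derivatives\<close>

text \<open>The positive and the negative part of the function are densities of finite measures on
  half-lines that agree there, hence of equal measures; a function whose positive and negative parts
  coincide is zero.\<close>

lemma AE_zero_of_integral_zero:
  fixes f :: "real \<Rightarrow> real"
  assumes f: "integrable lebesgue f"
    and z: "\<And>a. (\<integral>x. indicat_real {a<..} x * f x \<partial>lebesgue) = 0"
  shows "AE x in lebesgue. f x = 0"
proof -
  \<comment> \<open>Half-lines generate the Borel sets, so the measures are compared through a Borel
    representative and the conclusion is completed afterwards.\<close>
  obtain g where g[measurable]: "g \<in> borel_measurable lborel" and fg: "AE x in lborel. f x = g x"
    using completion_ex_borel_measurable_real[OF borel_measurable_integrable[OF f]] by blast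
  have fg': "AE x in lebesgue. f x = g x" using fg by (rule AE_completion)
  have "integrable lebesgue g"
    using f fg' g by (subst integrable_cong_AE[of _ _ f]) (auto simp: measurable_completion)
  then have g_int: "integrable lborel g" using g by (simp add: integrable_completion)
  have gz: "(\<integral>x. indicat_real {a<..} x * g x \<partial>lborel) = 0" for a
  proof -
    have "(\<integral>x. indicat_real {a<..} x * g x \<partial>lborel) = (\<integral>x. indicat_real {a<..} x * g x \<partial>lebesgue)"
      by (rule integral_completion[symmetric]) simp
    also have "\<dots> = (\<integral>x. indicat_real {a<..} x * f x \<partial>lebesgue)"
      using fg' borel_measurable_integrable[OF f] g
      by (intro integral_cong_AE borel_measurable_times) (auto simp: measurable_completion)
    finally show ?thesis using z by simp
  qed
  \<comment> \<open>\<open>ennreal\<close> sends negative reals to 0, so \<open>P\<close> and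
    \<open>Q\<close> are the measures of the positive and of the negative part.\<close>
  define P where "P = density lborel (\<lambda>x. ennreal (g x))"
  define Q where "Q = density lborel (\<lambda>x. ennreal (- g x))"
  have e: "emeasure P {a<..} < \<infinity> \<and> emeasure P {a<..} = emeasure Q {a<..}" for a
  proof -
    let ?h = "\<lambda>x. indicat_real {a<..} x * g x"
    have h: "integrable lborel ?h" using integrable_mult_indicator[OF _ g_int, of "{a<..}"] by simp
    have P: "emeasure P {a<..} = (\<integral>\<^sup>+x. ennreal (?h x) \<partial>lborel)"
      unfolding P_def by (subst emeasure_density) (auto intro!: nn_integral_cong simp: indicator_def)
    have Q: "emeasure Q {a<..} = (\<integral>\<^sup>+x. ennreal (- ?h x) \<partial>lborel)"
      unfolding Q_def by (subst emeasure_density) (auto intro!: nn_integral_cong simp: indicator_def)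
    have fin: "(\<integral>\<^sup>+x. ennreal (?h x) \<partial>lborel) < \<infinity>" "(\<integral>\<^sup>+x. ennreal (- ?h x) \<partial>lborel) < \<infinity>"
      using h by (auto simp: real_integrable_def less_top)
    have "enn2real (\<integral>\<^sup>+x. ennreal (?h x) \<partial>lborel) = enn2real (\<integral>\<^sup>+x. ennreal (- ?h x) \<partial>lborel)"
      using real_lebesgue_integral_def[OF h] gz by simp
    then have "(\<integral>\<^sup>+x. ennreal (?h x) \<partial>lborel) = (\<integral>\<^sup>+x. ennreal (- ?h x) \<partial>lborel)"
      using fin by (metis ennreal_enn2real infinity_ennreal_def)
    then show ?thesis using P Q fin by simp
  qed
  have "P = Q"
  proof (rule measure_eqI_lessThan)
    show "sets P = sets borel" "sets Q = sets borel" by (simp_all add: P_def Q_def)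
  qed (use e in blast)+
  then have "AE x in lborel. ennreal (g x) = ennreal (- g x)"
    unfolding P_def Q_def by (intro sigma_finite_measure.density_unique[OF sigma_finite_lborel]) auto
  then have "AE x in lborel. g x = 0"
  proof (rule AE_mp, intro AE_I2 impI)
    fix x assume eq: "ennreal (g x) = ennreal (- g x)"
    show "g x = 0"
    proof (cases "0 \<le> g x")
      case True
      then have "ennreal (g x) = 0" using eq by (simp add: ennreal_neg)
      then show ?thesis using True by (simp add: ennreal_eq_0_iff)
    next
      case False
      then have "ennreal (- g x) = 0" using eq by (simp add: ennreal_neg)
      then show ?thesis using False by (simp add: ennreal_eq_0_iff)
    qed
  qed
  then have "AE x in lborel. f x = 0" using fg by eventually_elim auto
  then show ?thesis by (rule AE_completion)
qed

text \<open>The squared positive part is C^1 because its derivative vanishes at the kink. As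
  \<open>c\<close> grows the function tends to the indicator of the open interval, and for c \<ge> 0
  it stays between 0 and 1.\<close>

lemma test_function_C1:
  fixes a b c :: real
  defines "\<phi> \<equiv> \<lambda>x. 1 - exp (- c * (max 0 ((x - a) * (b - x)))^2)"
  shows "\<phi> C1_differentiable_on UNIV" "a \<le> b \<Longrightarrow> closure {x. \<phi> x \<noteq> 0} \<subseteq> {a..b}"
proof -
  have sq: "((\<lambda>y::real. (max 0 y)^2) has_real_derivative 2 * max 0 y) (at y)" for y
  proof -
    have d1: "((\<lambda>y::real. (max 0 y)^2) has_real_derivative 2 * max 0 y) (at y)" if "y > 0" 
    proof (rule DERIV_cong_ev[THEN iffD1, OF refl _ refl])
      show "\<forall>\<^sub>F x in nhds y. x^2 = (max 0 x)^2"
        using eventually_nhds_in_open[of "{0<..}" y] that by (auto elim!: eventually_mono)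
      show "((\<lambda>y. y^2) has_real_derivative 2 * max 0 y) (at y)"
        using that by (auto intro!: derivative_eq_intros)
    qed
    have d2: "((\<lambda>y::real. (max 0 y)^2) has_real_derivative 2 * max 0 y) (at y)" if "y < 0" 
    proof (rule DERIV_cong_ev[THEN iffD1, OF refl _ refl])
      show "\<forall>\<^sub>F x in nhds y. 0 = (max 0 x)^2"
        using eventually_nhds_in_open[of "{..<0}" y] that by (auto elim!: eventually_mono)
      show "((\<lambda>y. 0) has_real_derivative 2 * max 0 y) (at y)"
        using that by auto
    qed
    have d3: "((\<lambda>y::real. (max 0 y)^2) has_real_derivative 0) (at 0)"
      unfolding DERIV_def
    proof (rule Lim_null_comparison)
      show "\<forall>\<^sub>F h in at 0. norm (((max 0 (0 + h))^2 - (max 0 0)^2) / h) \<le> \<bar>h::real\<bar>"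
        by (intro always_eventually allI) (auto simp: max_def power2_eq_square)
      show "((\<lambda>h::real. \<bar>h\<bar>) \<longlongrightarrow> 0) (at 0)" by (intro tendsto_rabs_zero tendsto_ident_at)
    qed
    show ?thesis using d1 d2 d3 by (cases y "0::real" rule: linorder_cases) auto
  qed
  let ?p = "\<lambda>x. (x - a) * (b - x)"
  let ?d = "\<lambda>x. exp (- c * (max 0 (?p x))^2) * (c * (2 * max 0 (?p x) * (b - x - (x - a))))"
  have p: "(?p has_real_derivative b - x - (x - a)) (at x)" for x
    by (auto intro!: derivative_eq_intros simp: algebra_simps)
  have D: "(\<phi> has_real_derivative ?d x) (at x)" for x
    unfolding \<phi>_def
    by (rule derivative_eq_intros DERIV_chain2[OF sq p] refl | simp)+
  show "\<phi> C1_differentiable_on UNIV"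
    unfolding C1_differentiable_on_def
    by (rule exI[of _ ?d])
       (use D in \<open>auto simp: has_real_derivative_iff_has_vector_derivative[symmetric] intro!: continuous_intros\<close>)
  show "closure {x. \<phi> x \<noteq> 0} \<subseteq> {a..b}" if "a \<le> b"
  proof (rule closure_minimal)
    show "{x. \<phi> x \<noteq> 0} \<subseteq> {a..b}"
    proof
      fix x assume "x \<in> {x. \<phi> x \<noteq> 0}"
      then have "0 < (x - a) * (b - x)" by (auto simp: \<phi>_def max_def less_le split: if_splits)
      then show "x \<in> {a..b}" using that by (auto simp: zero_less_mult_iff)
    qed
  qed simp
qed

text \<open>The difference integrates to zero against C^1 test functions, by dominated convergence
  against indicators of intervals, and after extension by zero against indicators of half-lines.
  Then its real and imaginary parts vanish almost everywhere.\<close>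

lemma weak_deriv_unique:
  assumes "has_weak_deriv l u w1" "has_weak_deriv l u w2"
  shows "AE x in leb_seg l. w1 x = w2 x"
proof -
  define w where "w x = w1 x - w2 x" for x
  have int12: "integrable (leb_seg l) w1" "integrable (leb_seg l) w2"
    using assms by (auto simp: has_weak_deriv_def Lp_space_def integrable_norm_iff)
  then have w: "integrable (leb_seg l) w" by (simp add: w_def[abs_def])
  have test: "(\<integral>x. w x * of_real (\<phi> x) \<partial>leb_seg l) = 0"
    if "\<phi> C1_differentiable_on UNIV" "closure {x. \<phi> x \<noteq> 0} \<subseteq> {0<..<l}" "\<And>x. \<bar>\<phi> x\<bar> \<le> 1" for \<phi>
  proof -
    have m: "\<phi> \<in> borel_measurable (leb_seg l)"
    proof -
      have "continuous_on UNIV \<phi>" using that(1) C1_differentiable_imp_continuous_on by blast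
      then have "\<phi> \<in> borel_measurable borel" by (rule borel_measurable_continuous_onI)
      then show ?thesis by (simp add: measurable_completion measurable_restrict_space1)
    qed
    have i: "integrable (leb_seg l) (\<lambda>x. v x * of_real (\<phi> x))" if "integrable (leb_seg l) v" for v :: "real \<Rightarrow> complex"
      using that
    proof (rule Bochner_Integration.integrable_bound)
      show "AE x in leb_seg l. norm (v x * of_real (\<phi> x)) \<le> norm (v x)"
        using \<open>\<And>x. \<bar>\<phi> x\<bar> \<le> 1\<close> by (auto simp: norm_mult intro!: mult_left_le)
    qed (use m borel_measurable_integrable[OF that] in measurable)
    have "(\<integral>x. w1 x * of_real (\<phi> x) \<partial>leb_seg l) = (\<integral>x. w2 x * of_real (\<phi> x) \<partial>leb_seg l)"
      using assms that by (auto simp: has_weak_deriv_def)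
    then show ?thesis using i[OF int12(1)] i[OF int12(2)] by (simp add: w_def left_diff_distrib)
  qed
  define W where "W x = indicat_real {0..l} x *\<^sub>R w x" for x
  have W: "integrable lebesgue W"
    using w unfolding W_def by (subst (asm) integrable_restrict_space) auto
  have Wt: "(\<integral>x. of_real (\<phi> x) * W x \<partial>lebesgue) = (\<integral>x. w x * of_real (\<phi> x) \<partial>leb_seg l)" for \<phi>
    unfolding W_def by (subst integral_restrict_space) (auto intro!: Bochner_Integration.integral_cong)
  have indm: "(\<lambda>x. complex_of_real (indicat_real S x)) \<in> borel_measurable lebesgue"
    if "S \<in> sets borel" for S :: "real set"
  proof -
    have "indicat_real S \<in> borel_measurable lebesgue"
      using that by (intro borel_measurable_indicator) auto
    then show ?thesis by measurable
  qed
  have zpos: "(\<integral>x. of_real (indicat_real {a<..<l} x) * W x \<partial>lebesgue) = 0" if a: "0 \<le> a" "a < l" for a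
  proof -
    \<comment> \<open>A margin that keeps the supports compact inside the open segment; the 3 in the
      denominator makes two margins shorter than \<open>l - a\<close> already for
      \<open>n = 0\<close>.\<close>
    define e where "e n = (l - a) / (real n + 3)" for n :: nat
    have e: "0 < e n" "a + e n < l - e n" for n
    proof -
      show "0 < e n" using a by (simp add: e_def)
      have "2 * (l - a) < (real n + 3) * (l - a)" using a by (intro mult_strict_right_mono) auto
      then have "2 * e n < l - a" by (simp add: e_def pos_divide_less_eq mult.commute)
      then show "a + e n < l - e n" by simp
    qed
    have e0: "e \<longlonglongrightarrow> 0" unfolding e_def by real_asymp
    define \<phi> where "\<phi> n x = 1 - exp (- real n * (max 0 ((x - (a + e n)) * ((l - e n) - x)))^2)" for n x
    have \<phi>_bd: "\<bar>\<phi> n x\<bar> \<le> 1" for n x by (simp add: \<phi>_def)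
    have C1: "\<phi> n C1_differentiable_on UNIV" for n unfolding \<phi>_def by (rule test_function_C1(1))
    have "closure {x. \<phi> n x \<noteq> 0} \<subseteq> {a + e n..l - e n}" for n
      unfolding \<phi>_def by (rule test_function_C1(2)) (use e less_imp_le in blast)
    then have "closure {x. \<phi> n x \<noteq> 0} \<subseteq> {0<..<l}" for n using e[of n] a by fastforce
    then have "(\<integral>x. of_real (\<phi> n x) * W x \<partial>lebesgue) = 0" for n
      unfolding Wt by (intro test C1 \<phi>_bd)
    moreover have "(\<lambda>n. \<integral>x. of_real (\<phi> n x) * W x \<partial>lebesgue) \<longlonglongrightarrow> (\<integral>x. of_real (indicat_real {a<..<l} x) * W x \<partial>lebesgue)"
    proof (rule integral_dominated_convergence)
      show "integrable lebesgue (\<lambda>x. norm (W x))" using W by simp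
      have Wm: "W \<in> borel_measurable lebesgue" using W by simp
      show "(\<lambda>x. of_real (indicat_real {a<..<l} x) * W x) \<in> borel_measurable lebesgue"
        by (intro borel_measurable_times Wm indm) auto
      show "(\<lambda>x. of_real (\<phi> n x) * W x) \<in> borel_measurable lebesgue" for n
      proof (intro borel_measurable_times Wm)
        have "\<phi> n \<in> borel_measurable borel" unfolding \<phi>_def by measurable
        then have "\<phi> n \<in> borel_measurable lebesgue" by (simp add: measurable_completion)
        then show "(\<lambda>x. complex_of_real (\<phi> n x)) \<in> borel_measurable lebesgue" by measurable
      qed
      show "AE x in lebesgue. norm (of_real (\<phi> n x) * W x) \<le> norm (W x)" for n
        using \<phi>_bd by (auto simp: norm_mult intro!: mult_left_le_one_le)
      show "AE x in lebesgue. (\<lambda>n. of_real (\<phi> n x) * W x) \<longlonglongrightarrow> of_real (indicat_real {a<..<l} x) * W x"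
      proof (intro AE_I2 tendsto_mult tendsto_const tendsto_of_real)
        fix x
        show "(\<lambda>n. \<phi> n x) \<longlonglongrightarrow> indicat_real {a<..<l} x"
        proof (cases "x \<in> {a<..<l}")
          case True
          let ?c = "(max 0 ((x - (a + 0)) * ((l - 0) - x)))^2"
          have "(\<lambda>n. (max 0 ((x - (a + e n)) * ((l - e n) - x)))^2) \<longlonglongrightarrow> ?c"
            by (intro tendsto_intros e0)
          moreover have "0 < ?c" using True by simp
          ultimately have "filterlim (\<lambda>n. (max 0 ((x - (a + e n)) * ((l - e n) - x)))^2 * real n) at_top sequentially"
            by (rule filterlim_tendsto_pos_mult_at_top) (rule filterlim_real_sequentially)
          then have "filterlim (\<lambda>n. - ((max 0 ((x - (a + e n)) * ((l - e n) - x)))^2 * real n)) at_bot sequentially"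
            by (simp add: filterlim_uminus_at_bot)
          then have "(\<lambda>n. exp (- ((max 0 ((x - (a + e n)) * ((l - e n) - x)))^2 * real n))) \<longlonglongrightarrow> 0"
            by (rule filterlim_compose[OF exp_at_bot])
          then have "(\<lambda>n. \<phi> n x) \<longlonglongrightarrow> 1 - 0"
            unfolding \<phi>_def by (intro tendsto_diff tendsto_const) (simp add: mult.commute)
          then show ?thesis using True by simp
        next
          case False
          have "(x - (a + e n)) * ((l - e n) - x) \<le> 0" for n
            using False e[of n] by (auto simp: mult_le_0_iff)
          then have "\<phi> n x = 0" for n by (simp add: \<phi>_def max_absorb1)
          then show ?thesis using False by simp
        qed
      qed
    qed
    ultimately show ?thesis by (simp add: LIMSEQ_const_iff)
  qed
  have z: "(\<integral>x. of_real (indicat_real {a<..} x) * W x \<partial>lebesgue) = 0" for a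
  proof (cases "max 0 a < l")
    case True
    \<comment> \<open>\<open>W\<close> vanishes outside \<open>[0, l]\<close> and endpoints are
      negligible, so the half-line may be replaced by an open interval inside the segment.\<close>
    have "AE x in lebesgue. x \<noteq> 0 \<and> x \<noteq> l"
      by (intro AE_conjI; rule AE_completion, rule AE_lborel_singleton)
    then have ae: "AE x in lebesgue. of_real (indicat_real {a<..} x) * W x = of_real (indicat_real {max 0 a<..<l} x) * W x"
      by (rule AE_mp) (auto simp: W_def indicator_def)
    have "(\<integral>x. of_real (indicat_real {a<..} x) * W x \<partial>lebesgue) = (\<integral>x. of_real (indicat_real {max 0 a<..<l} x) * W x \<partial>lebesgue)"
      by (intro integral_cong_AE[OF _ _ ae] borel_measurable_times indm borel_measurable_integrable[OF W] borel_measurable_const) auto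
    then show ?thesis using zpos[OF _ True] by simp
  next
    case False
    have "AE x in lebesgue. x \<noteq> 0 \<and> x \<noteq> l"
      by (intro AE_conjI; rule AE_completion, rule AE_lborel_singleton)
    then have ae: "AE x in lebesgue. of_real (indicat_real {a<..} x) * W x = 0"
      by (rule AE_mp) (use False in \<open>auto simp: W_def indicator_def\<close>)
    then show ?thesis by (rule integral_eq_zero_AE)
  qed
  have int_z: "integrable lebesgue (\<lambda>x. of_real (indicat_real {a<..} x) * W x)" for a
    using integrable_mult_indicator[OF _ W, of "{a<..}"] by (simp add: scaleR_conv_of_real)
  have "AE x in lebesgue. Re (W x) = 0"
  proof (rule AE_zero_of_integral_zero)
    fix a show "(\<integral>x. indicat_real {a<..} x * Re (W x) \<partial>lebesgue) = 0"
      using integral_Re[OF int_z[of a]] z[of a] by simp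
  qed (use W in auto)
  moreover have "AE x in lebesgue. Im (W x) = 0"
  proof (rule AE_zero_of_integral_zero)
    fix a show "(\<integral>x. indicat_real {a<..} x * Im (W x) \<partial>lebesgue) = 0"
      using integral_Im[OF int_z[of a]] z[of a] by simp
  qed (use W in auto)
  ultimately have "AE x in lebesgue. x \<in> {0..l} \<longrightarrow> w1 x = w2 x"
    by eventually_elim (auto simp: W_def w_def complex_eq_iff)
  then show ?thesis by (subst AE_restrict_space_iff) auto
qed

section \<open>Antiderivatives as weak derivatives\<close>

lemma leb_seg_integral_lborel:
  fixes F :: "real \<Rightarrow> complex"
  assumes "\<And>x. x \<in> {0..l} \<Longrightarrow> F x = H x" "\<And>x. x \<notin> {0..l} \<Longrightarrow> H x = 0" "H \<in> borel_measurable borel"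
  shows "(\<integral>x. F x \<partial>leb_seg l) = (\<integral>x. H x \<partial>lborel)"
proof -
  have "(\<integral>x. F x \<partial>leb_seg l) = (\<integral>x. indicat_real {0..l} x *\<^sub>R F x \<partial>lebesgue)"
    by (subst integral_restrict_space) auto
  also have "\<dots> = (\<integral>x. H x \<partial>lebesgue)"
    by (rule Bochner_Integration.integral_cong) (use assms(1,2) in \<open>auto simp: indicator_def\<close>)
  also have "\<dots> = (\<integral>x. H x \<partial>lborel)"
    by (rule integral_completion) (use assms(3) in simp)
  finally show ?thesis .
qed

lemma borel_bounded_integrable_on:
  fixes w :: "real \<Rightarrow> complex"
  assumes [measurable]: "w \<in> borel_measurable borel" and "\<And>y. y \<in> {a..b} \<Longrightarrow> norm (w y) \<le> B"
  shows "set_integrable lborel {a..b} w" "w integrable_on {a..b}"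
proof -
  have "integrable lborel (\<lambda>y. B * indicat_real {a..b} y)"
    by (intro integrable_mult_right integrable_real_indicator) (auto simp: emeasure_lborel_Icc_eq)
  then show "set_integrable lborel {a..b} w"
    unfolding set_integrable_def
  proof (rule Bochner_Integration.integrable_bound)
    have "norm (indicat_real {a..b} y *\<^sub>R w y) \<le> norm (B * indicat_real {a..b} y)" for y
      using assms(2)[of y] by (cases "y \<in> {a..b}") auto
    then show "AE y in lborel. norm (indicat_real {a..b} y *\<^sub>R w y) \<le> norm (B * indicat_real {a..b} y)"
      by (rule AE_I2)
  qed measurable
  then show "w integrable_on {a..b}" by (rule set_borel_integral_eq_integral)
qed

text \<open>Integration by parts against the test function, by exchanging the order of integration over
  the triangle \<open>0 \<le> y \<le> x \<le> l\<close>.\<close>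

lemma has_weak_deriv_antiderivative:
  fixes w :: "real \<Rightarrow> complex"
  assumes l: "0 < l" and w[measurable]: "w \<in> borel_measurable borel"
    and B: "\<And>y. y \<in> {0..l} \<Longrightarrow> norm (w y) \<le> B"
    and u: "\<And>x. x \<in> {0..l} \<Longrightarrow> u x = c + integral {0..x} w"
  shows "has_weak_deriv l u w"
  unfolding has_weak_deriv_def
proof (intro conjI allI impI)
  have B0: "0 \<le> B"
  proof -
    have "norm (w 0) \<le> B" using B l by simp
    then show ?thesis using norm_ge_zero[of "w 0"] by linarith
  qed
  have "integrable lebesgue (\<lambda>x. indicat_real {0..l} x *\<^sub>R w x)"
    using borel_bounded_integrable_on(1)[OF w B] by (simp add: set_integrable_def integrable_completion)
  then have "integrable (leb_seg l) w" by (subst integrable_restrict_space) auto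
  then show "w \<in> Lp_space 1 (leb_seg l)" by (auto simp: Lp_space_def)
  fix \<phi> :: "real \<Rightarrow> real"
  assume "\<phi> C1_differentiable_on UNIV \<and> closure {x. \<phi> x \<noteq> 0} \<subseteq> {0<..<l}"
  then have C1: "\<phi> C1_differentiable_on UNIV" and supp: "closure {x. \<phi> x \<noteq> 0} \<subseteq> {0<..<l}" by auto
  have \<phi>0: "\<phi> x = 0" if "x \<le> 0 \<or> l \<le> x" for x
    using supp closure_subset[of "{x. \<phi> x \<noteq> 0}"] that by fastforce
  have D: "(\<phi> has_real_derivative deriv \<phi> x) (at x)" and contD: "continuous_on UNIV (deriv \<phi>)" for x
  proof -
    obtain D where D: "\<And>x. (\<phi> has_vector_derivative D x) (at x)" "continuous_on UNIV D"
      using C1 by (auto simp: C1_differentiable_on_def)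
    have D': "(\<phi> has_real_derivative D x) (at x)" for x
      using D(1) by (simp add: has_real_derivative_iff_has_vector_derivative)
    then have "deriv \<phi> = D" by (auto simp: fun_eq_iff intro: DERIV_imp_deriv)
    then show "(\<phi> has_real_derivative deriv \<phi> x) (at x)" "continuous_on UNIV (deriv \<phi>)" using D' D(2) by auto
  qed
  have [measurable]: "deriv \<phi> \<in> borel_measurable borel" "\<phi> \<in> borel_measurable borel"
    using contD DERIV_continuous_on[of UNIV \<phi>] D by (auto intro!: borel_measurable_continuous_onI)
  obtain C where C: "\<And>x. x \<in> {0..l} \<Longrightarrow> \<bar>deriv \<phi> x\<bar> \<le> C"
  proof -
    have "bounded (deriv \<phi> ` {0..l})"
      by (intro compact_imp_bounded compact_continuous_image continuous_on_subset[OF contD]) auto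
    then obtain a where "\<forall>x\<in>{0..l}. \<bar>deriv \<phi> x\<bar> \<le> a" by (auto simp: bounded_iff)
    then show thesis using that by blast
  qed
  have C0: "0 \<le> C"
  proof -
    have "\<bar>deriv \<phi> 0\<bar> \<le> C" using C l by simp
    then show ?thesis by linarith
  qed
  define f :: "real \<Rightarrow> real \<Rightarrow> complex"
    where "f x y = (if 0 \<le> y \<and> y \<le> x \<and> x \<le> l then of_real (deriv \<phi> x) * w y else 0)" for x y
  have f_int: "integrable (lborel \<Otimes>\<^sub>M lborel) (case_prod f)"
  proof (rule Bochner_Integration.integrable_bound)
    let ?S = "{0..l} \<times> {0..l} :: (real \<times> real) set"
    have "emeasure (lborel \<Otimes>\<^sub>M lborel) ?S < \<infinity>"
      by (subst lborel.emeasure_pair_measure_Times) (auto simp: emeasure_lborel_Icc_eq ennreal_mult_less_top)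
    then show "integrable (lborel \<Otimes>\<^sub>M lborel) (\<lambda>z. (C * B) * indicat_real ?S z)"
      by (intro integrable_mult_right integrable_real_indicator) auto
    show "case_prod f \<in> borel_measurable (lborel \<Otimes>\<^sub>M lborel)"
      unfolding f_def by measurable
    have "norm (f x y) \<le> norm ((C * B) * indicat_real ?S (x, y))" for x y
    proof (cases "0 \<le> y \<and> y \<le> x \<and> x \<le> l")
      case True
      then have "norm (f x y) \<le> C * B"
        unfolding f_def using C[of x] B[of y] C0 by (auto simp: norm_mult intro!: mult_mono)
      then show ?thesis using True B0 C0 by (simp add: indicator_def)
    next
      case False
      then have "f x y = 0" unfolding f_def by (rule if_not_P)
      then show ?thesis by simp
    qed
    then show "AE z in lborel \<Otimes>\<^sub>M lborel. norm (case z of (x, y) \<Rightarrow> f x y) \<le> norm ((C * B) * indicat_real ?S z)"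
      by (auto intro!: AE_I2)
  qed
  have inner_y: "(\<integral>y. f x y \<partial>lborel) = of_real (deriv \<phi> x) * integral {0..x} w" if x: "x \<in> {0..l}" for x
  proof -
    have "set_integrable lborel {0..x} w"
      by (rule borel_bounded_integrable_on[where B = B]) (use w B x in auto)
    then have A: "(\<integral>y. indicat_real {0..x} y *\<^sub>R w y \<partial>lborel) = integral {0..x} w"
      using set_borel_integral_eq_integral(2) by (auto simp: set_lebesgue_integral_def)
    have f_eq: "f x y = of_real (deriv \<phi> x) * (indicat_real {0..x} y *\<^sub>R w y)" for y
      using x by (auto simp: f_def indicator_def)
    show ?thesis unfolding f_eq A[symmetric] by (rule integral_mult_right_zero)
  qed
  have outer_y: "(\<integral>y. f x y \<partial>lborel) = 0" if "x \<notin> {0..l}" for x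
  proof -
    have "f x y = 0" for y using that by (auto simp: f_def)
    then show ?thesis by simp
  qed
  have FTC: "has_bochner_integral lborel (\<lambda>x. complex_of_real (deriv \<phi> x * indicat_real {y..l} x)) (of_real (\<phi> l - \<phi> y))"
    if "y \<le> l" for y
    by (intro has_bochner_integral_of_real has_bochner_integral_FTC_Icc_real that D)
       (use contD in \<open>auto simp: continuous_on_eq_continuous_at\<close>)
  have inner_x: "(\<integral>x. f x y \<partial>lborel) = (if y \<in> {0..l} then - (w y * of_real (\<phi> y)) else 0)" for y
  proof (cases "y \<in> {0..l}")
    case True
    have "(\<integral>x. f x y \<partial>lborel) = (\<integral>x. w y * complex_of_real (deriv \<phi> x * indicat_real {y..l} x) \<partial>lborel)"
      using True by (intro Bochner_Integration.integral_cong) (auto simp: f_def indicator_def)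
    also have "\<dots> = w y * of_real (\<phi> l - \<phi> y)"
      using FTC[of y] True by (simp add: has_bochner_integral_integral_eq)
    finally show ?thesis using True \<phi>0[of l] by simp
  next
    case False
    then have "f x y = 0" for x by (auto simp: f_def)
    then show ?thesis using False by auto
  qed
  have i1: "integrable lborel (\<lambda>x. c * complex_of_real (deriv \<phi> x * indicat_real {0..l} x))"
    using FTC[of 0] l by (auto simp: has_bochner_integral_iff)
  have i2: "integrable lborel (\<lambda>x. \<integral>y. f x y \<partial>lborel)"
    using lborel_pair.integrable_fst'[OF f_int] by simp
  have "(\<integral>x. u x * of_real (deriv \<phi> x) \<partial>leb_seg l) =
      (\<integral>x. c * complex_of_real (deriv \<phi> x * indicat_real {0..l} x) + (\<integral>y. f x y \<partial>lborel) \<partial>lborel)"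
    by (rule leb_seg_integral_lborel)
       (use i1 i2 in \<open>auto simp: u inner_y outer_y algebra_simps dest!: borel_measurable_integrable\<close>)
  also have "\<dots> = c * of_real (\<phi> l - \<phi> 0) + (\<integral>x. (\<integral>y. f x y \<partial>lborel) \<partial>lborel)"
    using i1 i2 FTC[of 0] l by (simp add: has_bochner_integral_iff)
  \<comment> \<open>The integration constant \<open>c\<close> drops out because the test function
    vanishes at 0 and at \<open>l\<close>.\<close>
  also have "\<dots> = (\<integral>y. (\<integral>x. f x y \<partial>lborel) \<partial>lborel)"
    using \<phi>0 lborel_pair.Fubini_integral[OF f_int] by simp
  also have "\<dots> = - (\<integral>y. (if y \<in> {0..l} then w y * of_real (\<phi> y) else 0) \<partial>lborel)"
    unfolding inner_x by (subst Bochner_Integration.integral_minus[symmetric]) (rule Bochner_Integration.integral_cong, auto)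
  also have "(\<integral>y. (if y \<in> {0..l} then w y * of_real (\<phi> y) else 0) \<partial>lborel) = (\<integral>x. w x * of_real (\<phi> x) \<partial>leb_seg l)"
    by (rule leb_seg_integral_lborel[symmetric]) auto
  finally show "(\<integral>x. u x * of_real (deriv \<phi> x) \<partial>leb_seg l) = - (\<integral>x. w x * of_real (\<phi> x) \<partial>leb_seg l)" .
qed

section \<open>Scattering at the vertices\<close>

text \<open>Component \<open>2 * j\<close> travels from the tail of edge \<open>j\<close> to its
  head and \<open>2 * j - 1\<close> travels back, so for an edge at \<open>q\<close> this is the
  component that starts at \<open>q\<close>.\<close>

definition out_ix :: "('v, nat) pre_digraph \<Rightarrow> 'v \<Rightarrow> nat \<Rightarrow> nat" where
  "out_ix G q j = (if tail G j = q then 2 * j else 2 * j - 1)"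

definition in_ix :: "('v, nat) pre_digraph \<Rightarrow> 'v \<Rightarrow> nat \<Rightarrow> nat" where
  "in_ix G q j = (if head G j = q then 2 * j else 2 * j - 1)"

definition scatter :: "('v, nat) pre_digraph \<Rightarrow> 'v set \<Rightarrow> ('v \<Rightarrow> real) \<Rightarrow> 'v \<Rightarrow> nat \<Rightarrow> nat \<Rightarrow> real" where
  "scatter G Vu h q j l =
     (if q \<in> interior_verts G then of_bool (j = l) - 2 / real (card (inc_edges G q))
      else if q \<in> Vu then of_bool (j = l) else (1 - h q) / (1 + h q) * of_bool (j = l))"

locale network =
  fixes N :: nat and G :: "('v, nat) pre_digraph" and Vd Vu :: "'v set"
  assumes net: "network_graph N G Vd Vu"
begin

lemma arcs_G: "arcs G = {1..N}" using net by (simp add: network_graph_def)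

lemma digraph_G: "digraph G" using net by (simp add: network_graph_def)

lemma finite_verts_G: "finite (verts G)"
  using digraph_G by (simp add: digraph_def fin_digraph_def fin_digraph_axioms_def)

lemma tail_neq_head: "j \<in> {1..N} \<Longrightarrow> tail G j \<noteq> head G j"
  using digraph_G arcs_G by (metis digraph.axioms(2) loopfree_digraph.no_loops)

lemma inc_sub: "inc_edges G q \<subseteq> {1..N}" by (auto simp: inc_edges_def arcs_G)

lemma finite_inc: "finite (inc_edges G q)" using inc_sub finite_subset by blast

text \<open>Without arcs, reachability is equality, so a connected graph could not have two exterior
  vertices. Nonemptiness matters wherever a minimum or maximum over edges is taken.\<close>

lemma N_pos: "1 \<le> N"
proof (rule ccontr)
  assume "\<not> 1 \<le> N"
  then have e: "arcs G = {}" by (simp add: arcs_G)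
  have "2 \<le> card (exterior G)" using net unfolding network_graph_def by blast
  then obtain a b where ab: "a \<in> verts G" "b \<in> verts G" "a \<noteq> b"
    by (auto simp: exterior_def numeral_2_eq_2 card_le_Suc_iff)
  have "connected G" using net by (simp add: network_graph_def)
  then have "a \<rightarrow>\<^sup>*\<^bsub>mk_symmetric G\<^esub> b"
    using ab by (auto simp: connected_def strongly_connected_def)
  moreover have "parcs (mk_symmetric G) = {}" using e by (simp add: mk_symmetric_def)
  ultimately have "(a, b) \<in> rtrancl_on (verts G) {}"
    by (simp add: reachable_def)
  then have "a = b" by (induction rule: rtrancl_on_induct) auto
  then show False using ab by simp
qed

text \<open>Parity tells at which end of its edge a component starts, so a component leaves only one
  vertex. This decouples the rows of the transport matrix vertex by vertex.\<close>

lemma out_ix_eq_iff: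
  assumes "j \<in> inc_edges G q" "j' \<in> inc_edges G q'"
  shows "out_ix G q j = out_ix G q' j' \<longleftrightarrow> j = j' \<and> q = q'"
proof
  assume eq: "out_ix G q j = out_ix G q' j'"
  have pos: "1 \<le> j" "1 \<le> j'" using assms inc_sub[of q] inc_sub[of q'] by auto
  then have j: "j = j'" using eq by (auto simp: out_ix_def split: if_splits)
  have "tail G j = q \<longleftrightarrow> tail G j = q'"
    using eq pos unfolding j by (auto simp: out_ix_def split: if_splits)
  then have "q = q'" using assms unfolding j by (auto simp: inc_edges_def)
  then show "j = j' \<and> q = q'" using j by simp
qed simp

lemma M_vert_eq: "M_vert G Vu h q i k = sandwich G q (scatter G Vu h q) i k"
  by (auto simp: M_vert_def scatter_def sandwich_def sum_distrib_left intro!: sum.cong)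

text \<open>In the row of a component leaving \<open>q\<close> only the block of \<open>q\<close>
  has entries, so the row reads nothing but the components arriving at \<open>q\<close>. The signs
  come from the diagonal factors in \<open>M_tr\<close>.\<close>

lemma M_tr_out_ix:
  assumes q: "q \<in> verts G" and j: "j \<in> inc_edges G q"
  shows "(\<Sum>k=1..2*N. complex_of_real (M_tr G Vu h (out_ix G q j) k) * x k) =
    - ((-1) ^ out_ix G q j *
       (\<Sum>l\<in>inc_edges G q. of_real (scatter G Vu h q j l) * ((-1) ^ in_ix G q l * x (in_ix G q l))))"
proof -
  let ?i = "out_ix G q j"
  have sw: "sandwich G q' A ?i k = (if q' = q then \<Sum>l\<in>inc_edges G q. A j l * of_bool (k = in_ix G q l) else 0)"
    for q' A k
  proof -
    have "sandwich G q' A ?i k = (\<Sum>j'\<in>inc_edges G q'. if j' = j \<and> q' = q then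
        (\<Sum>l\<in>inc_edges G q. A j l * of_bool (k = in_ix G q l)) else 0)"
      unfolding sandwich_def
    proof (rule sum.cong[OF refl])
      fix j' assume "j' \<in> inc_edges G q'"
      then have "Pi_out G q' j' ?i = of_bool (j' = j \<and> q' = q)"
        using out_ix_eq_iff[OF j] by (auto simp: Pi_out_def out_ix_def[of G q' j', symmetric])
      then show "(\<Sum>l\<in>inc_edges G q'. Pi_out G q' j' ?i * A j' l * Pi_in G q' l k) =
          (if j' = j \<and> q' = q then (\<Sum>l\<in>inc_edges G q. A j l * of_bool (k = in_ix G q l)) else 0)"
        by (auto simp: Pi_in_def in_ix_def)
    qed
    also have "\<dots> = (if q' = q then \<Sum>l\<in>inc_edges G q. A j l * of_bool (k = in_ix G q l) else 0)"
      using j finite_inc by (auto simp: sum.delta)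
    finally show ?thesis .
  qed
  have M: "M_tr G Vu h ?i k = - ((-1) ^ ?i * (\<Sum>l\<in>inc_edges G q. scatter G Vu h q j l * of_bool (k = in_ix G q l)) * (-1) ^ k)" for k
    unfolding M_tr_def M_vert_eq sw using q finite_verts_G by (simp add: sum.delta)
  have in_I: "in_ix G q l \<in> {1..2*N}" if "l \<in> inc_edges G q" for l
    using inc_sub[of q] that by (force simp: in_ix_def)
  have "(\<Sum>k=1..2*N. complex_of_real (M_tr G Vu h ?i k) * x k) =
      (\<Sum>k=1..2*N. \<Sum>l\<in>inc_edges G q. - ((-1) ^ ?i) * (of_real (scatter G Vu h q j l) *
         (if k = in_ix G q l then (-1) ^ k * x k else 0)))"
    unfolding M by (rule sum.cong[OF refl])
      (auto simp: sum_distrib_left sum_distrib_right sum_negf[symmetric] intro!: sum.cong)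
  also have "\<dots> = (\<Sum>l\<in>inc_edges G q. \<Sum>k=1..2*N. - ((-1) ^ ?i) * (of_real (scatter G Vu h q j l) *
         (if k = in_ix G q l then (-1) ^ k * x k else 0)))"
    by (rule sum.swap)
  also have "\<dots> = (\<Sum>l\<in>inc_edges G q. - ((-1) ^ ?i) * (of_real (scatter G Vu h q j l) *
         ((-1) ^ in_ix G q l * x (in_ix G q l))))"
  proof (rule sum.cong[OF refl])
    fix l assume l: "l \<in> inc_edges G q"
    have "(\<Sum>k=1..2*N. (if k = in_ix G q l then (-1) ^ k * x k else 0)) = (-1) ^ in_ix G q l * x (in_ix G q l)"
      using in_I[OF l] by (subst sum.delta) auto
    then show "(\<Sum>k=1..2*N. - ((-1) ^ ?i) * (of_real (scatter G Vu h q j l) *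
         (if k = in_ix G q l then (-1) ^ k * x k else 0))) = - ((-1) ^ ?i) * (of_real (scatter G Vu h q j l) *
         ((-1) ^ in_ix G q l * x (in_ix G q l)))"
      by (simp only: sum_distrib_left[symmetric])
  qed
  finally show ?thesis by (simp add: sum_distrib_left sum_negf)
qed

text \<open>In wave terms, \<open>tr j\<close> is \<open>-2 \<partial>\<^sub>t u\<^sub>j(t, q)\<close>.\<close>

lemma vertex_trace:
  assumes q: "q \<in> verts G"
    and rec: "\<And>i. i \<in> {1..2*N} \<Longrightarrow> y i = (\<Sum>k=1..2*N. complex_of_real (M_tr G Vu h i k) * x k)"
  defines "tr \<equiv> \<lambda>j. (-1) ^ out_ix G q j * y (out_ix G q j) + (-1) ^ in_ix G q j * x (in_ix G q j)"
  shows "j \<in> inc_edges G q \<Longrightarrow> k \<in> inc_edges G q \<Longrightarrow> tr j = tr k"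
    and "q \<in> Vu \<Longrightarrow> j \<in> inc_edges G q \<Longrightarrow> tr j = 0"
proof -
  have out_I: "out_ix G q l \<in> {1..2*N}" if "l \<in> inc_edges G q" for l
    using inc_sub[of q] that by (force simp: out_ix_def)
  let ?X = "\<lambda>l. (-1) ^ in_ix G q l * x (in_ix G q l)"
  have y: "(-1) ^ out_ix G q j * y (out_ix G q j) =
      - (\<Sum>l\<in>inc_edges G q. of_real (scatter G Vu h q j l) * ?X l)" if "j \<in> inc_edges G q" for j
    using rec[OF out_I[OF that]] M_tr_out_ix[OF q that, of h x]
    by (simp add: mult.assoc[symmetric] power_mult_distrib[symmetric])
  have delta: "(\<Sum>l\<in>inc_edges G q. of_real (of_bool (j = l)) * ?X l) = ?X j" if "j \<in> inc_edges G q" for j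
  proof -
    have "(\<Sum>l\<in>inc_edges G q. of_real (of_bool (j = l)) * ?X l) = (\<Sum>l\<in>inc_edges G q. if j = l then ?X l else 0)"
      by (rule sum.cong) auto
    then show ?thesis using that finite_inc by (simp add: sum.delta')
  qed
  show "tr j = tr k" if "j \<in> inc_edges G q" "k \<in> inc_edges G q"
  proof (cases "q \<in> interior_verts G")
    case True
    \<comment> \<open>The identity part of the scattering matrix cancels the incoming term; what
      remains is the mean part, which is the same for all edges at \<open>q\<close>.\<close>
    have "tr j = of_real (2 / card (inc_edges G q)) * (\<Sum>l\<in>inc_edges G q. ?X l)" if "j \<in> inc_edges G q" for j
    proof -
      have "(\<Sum>l\<in>inc_edges G q. of_real (scatter G Vu h q j l) * ?X l) =
        (\<Sum>l\<in>inc_edges G q. of_real (of_bool (j = l)) * ?X l - of_real (2 / card (inc_edges G q)) * ?X l)"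
        using True by (intro sum.cong) (simp_all add: scatter_def left_diff_distrib)
      also have "\<dots> = ?X j - of_real (2 / card (inc_edges G q)) * (\<Sum>l\<in>inc_edges G q. ?X l)"
        unfolding sum_subtractf delta[OF that] sum_distrib_left ..
      finally show ?thesis unfolding tr_def y[OF that] by simp
    qed
    then show ?thesis using that by simp
  next
    case False
    \<comment> \<open>An exterior vertex has at most one edge, so there is nothing to
      compare.\<close>
    then have "card (inc_edges G q) \<le> 1" using q by (auto simp: interior_verts_def exterior_def)
    then have "j = k" using that finite_inc card_le_Suc0_iff_eq by (metis One_nat_def)
    then show ?thesis by simp
  qed
  show "tr j = 0" if "q \<in> Vu" "j \<in> inc_edges G q"
  proof -
    have "q \<notin> interior_verts G" using net that by (auto simp: network_graph_def interior_verts_def)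
    then have "(\<Sum>l\<in>inc_edges G q. of_real (scatter G Vu h q j l) * ?X l) =
        (\<Sum>l\<in>inc_edges G q. of_real (of_bool (j = l)) * ?X l)"
      using that by (intro sum.cong) (simp_all add: scatter_def)
    then show ?thesis unfolding tr_def y[OF that(2)] delta[OF that(2)] by simp
  qed
qed

end

section \<open>Solutions along characteristics\<close>

text \<open>A solution of the recursion at every time \<ge> 0, not only at almost every one. The
  case split supplies the data, since the word sum is zero at negative times when the delays are
  positive.\<close>

definition char_sol ::
    "nat set \<Rightarrow> (nat \<Rightarrow> real) \<Rightarrow> (real \<Rightarrow> nat \<Rightarrow> nat \<Rightarrow> real) \<Rightarrow> (nat \<Rightarrow> real \<Rightarrow> complex) \<Rightarrow>
     nat \<Rightarrow> real \<Rightarrow> complex" where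
  "char_sol I \<tau> m \<phi> i t = (if t < 0 then \<phi> i t else word_sum I \<tau> m \<phi> i t)"

context delays
begin

lemma char_sol_rec:
  "0 \<le> t \<Longrightarrow> char_sol I \<tau> m \<phi> i t = (\<Sum>k\<in>I. of_real (m t i k) * char_sol I \<tau> m \<phi> k (t - \<tau> k))"
  using word_sum_step[of t m \<phi> i] by (simp add: char_sol_def)

text \<open>The recursion reads values older by at least \<open>d\<close>, so measurability spreads
  slice by slice. At each time the truncations \<open>G n\<close> agree with the solution from some
  index on.\<close>

lemma char_sol_measurable:
  assumes m: "\<And>i k. (\<lambda>t. m t i k) \<in> borel_measurable borel"
    and \<phi>: "\<And>k. \<phi> k \<in> borel_measurable borel" and i: "i \<in> I"
  shows "char_sol I \<tau> m \<phi> i \<in> borel_measurable borel"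
proof -
  let ?g = "char_sol I \<tau> m \<phi>"
  define G where "G n i t = (if t < real n * d then ?g i t else 0)" for n i t
  have G: "\<forall>i\<in>I. G n i \<in> borel_measurable borel" for n
  proof (induction n)
    case 0
    have "G 0 i = (\<lambda>t. if t < 0 then \<phi> i t else 0)" for i by (auto simp: G_def char_sol_def fun_eq_iff)
    then show ?case using \<phi> by simp
  next
    case (Suc n)
    show ?case
    proof
      fix i
      have "G (Suc n) i = (\<lambda>t. if t < real (Suc n) * d then
          (if t < 0 then \<phi> i t else \<Sum>k\<in>I. of_real (m t i k) * G n k (t - \<tau> k)) else 0)"
      proof
        fix t
        have "(\<Sum>k\<in>I. complex_of_real (m t i k) * ?g k (t - \<tau> k)) = (\<Sum>k\<in>I. of_real (m t i k) * G n k (t - \<tau> k))"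
          if "t < real (Suc n) * d"
        proof (rule sum.cong[OF refl])
          fix k assume "k \<in> I"
          then have "t - \<tau> k < real n * d" using that d_le[of k] by (simp add: algebra_simps)
          then show "complex_of_real (m t i k) * ?g k (t - \<tau> k) = of_real (m t i k) * G n k (t - \<tau> k)"
            by (simp add: G_def)
        qed
        then show "G (Suc n) i t = (if t < real (Suc n) * d then
          (if t < 0 then \<phi> i t else \<Sum>k\<in>I. of_real (m t i k) * G n k (t - \<tau> k)) else 0)"
          using char_sol_rec[of t m \<phi> i] by (auto simp: G_def char_sol_def)
      qed
      moreover have "(\<lambda>t. G n k (t - \<tau> k)) \<in> borel_measurable borel" if "k \<in> I" for k
        using Suc.IH that by (intro measurable_compose[OF _ bspec[OF Suc.IH that]]) simp
      ultimately show "G (Suc n) i \<in> borel_measurable borel"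
        using \<phi> m by (auto intro!: measurable_If borel_measurable_sum borel_measurable_times
            measurable_compose[OF m borel_measurable_of_real])
    qed
  qed
  show ?thesis
  proof (rule borel_measurable_LIMSEQ_metric)
    show "G n i \<in> borel_measurable borel" for n using G i by blast
    fix t
    obtain n0 where n0: "t < real n0 * d" using d_pos reals_Archimedean3 by blast
    have "\<forall>\<^sub>F n in sequentially. G n i t = ?g i t"
    proof (rule eventually_sequentiallyI[of n0])
      fix n assume "n0 \<le> n"
      then have "real n0 * d \<le> real n * d" using d_pos by simp
      then show "G n i t = ?g i t" using n0 by (simp add: G_def)
    qed
    then show "(\<lambda>n. G n i t) \<longlonglongrightarrow> ?g i t" by (rule tendsto_eventually)
  qed
qed

text \<open>Each further slice of width \<open>d\<close> replaces a bound \<open>B\<close> by the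
  larger of 1 and \<open>card I * (C * B)\<close>, and finitely many slices reach
  \<open>T\<close>.\<close>

lemma char_sol_bounded:
  assumes C: "0 \<le> C" and m: "\<And>t i k. i \<in> I \<Longrightarrow> k \<in> I \<Longrightarrow> \<bar>m t i k\<bar> \<le> C" and \<phi>: "\<And>k t. norm (\<phi> k t) \<le> 1"
  shows "\<exists>B. \<forall>i\<in>I. \<forall>t\<le>T. norm (char_sol I \<tau> m \<phi> i t) \<le> B"
proof -
  let ?g = "char_sol I \<tau> m \<phi>"
  have bd: "\<exists>B\<ge>1. \<forall>i\<in>I. \<forall>t<real n * d. norm (?g i t) \<le> B" for n
  proof (induction n)
    case 0
    show ?case using \<phi> by (intro exI[of _ 1]) (auto simp: char_sol_def)
  next
    case (Suc n)
    then obtain B where B: "1 \<le> B" "\<And>i t. i \<in> I \<Longrightarrow> t < real n * d \<Longrightarrow> norm (?g i t) \<le> B" by blast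
    show ?case
    proof (intro exI[of _ "max 1 (card I * (C * B))"] conjI ballI allI impI)
      fix i t assume i: "i \<in> I" and t: "t < real (Suc n) * d"
      show "norm (?g i t) \<le> max 1 (card I * (C * B))"
      proof (cases "t < 0")
        case True then show ?thesis using \<phi>[of i t] by (simp add: char_sol_def)
      next
        case False
        have "norm (?g i t) \<le> (\<Sum>k\<in>I. norm (of_real (m t i k) * ?g k (t - \<tau> k)))"
          using False char_sol_rec[of t m \<phi> i] by (simp add: norm_sum)
        also have "\<dots> \<le> (\<Sum>k\<in>I. C * B)"
        proof (rule sum_mono)
          fix k assume k: "k \<in> I"
          then have "t - \<tau> k < real n * d" using t d_le[of k] by (simp add: algebra_simps)
          then have "norm (?g k (t - \<tau> k)) \<le> B" using B(2) k by blast
          then show "norm (of_real (m t i k) * ?g k (t - \<tau> k)) \<le> C * B"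
            using m[OF i k, of t] C by (auto simp: norm_mult intro!: mult_mono)
        qed
        finally show ?thesis by simp
      qed
    qed simp
  qed
  obtain n where "T < real n * d" using d_pos reals_Archimedean3 by blast
  with bd[of n] show ?thesis by (meson order_le_less_trans)
qed

end

section \<open>Wave states recovered from solutions along characteristics\<close>

lemma borel_measurable_leb_seg: "f \<in> borel_measurable borel \<Longrightarrow> f \<in> borel_measurable (leb_seg l)"
  by (simp add: measurable_completion measurable_restrict_space1)

lemma weak_deriv_AE:
  assumes "has_weak_deriv l u w"
  shows "AE x in leb_seg l. weak_deriv l u x = w x"
  using weak_deriv_unique[OF someI[of "has_weak_deriv l u" w] assms] assms unfolding weak_deriv_def by blast

lemma L_tr_simps:
  "1 \<le> j \<Longrightarrow> L_tr L (2 * j) = L j" "1 \<le> j \<Longrightarrow> L_tr L (2 * j - 1) = L j"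
  by (simp_all add: L_tr_def)

lemma index_cases:
  assumes "i \<in> {1..2*N::nat}"
  obtains j where "j \<in> {1..N}" "i = 2 * j" "even i" "(i + 1) div 2 = j"
  | j where "j \<in> {1..N}" "i = 2 * j - 1" "odd i" "(i + 1) div 2 = j"
proof (cases "even i")
  case True
  then obtain j where "i = 2 * j" by blast
  then show thesis using assms True by (intro that(1)[of j]) auto
next
  case False
  then obtain j where "i = 2 * j + 1" by (auto elim: oddE)
  then show thesis using assms False by (intro that(2)[of "j + 1"]) auto
qed

lemma delays_L_tr:
  assumes "\<And>j. j \<in> {1..N} \<Longrightarrow> 0 < L j" "1 \<le> N"
  shows "delays {1..2*N} (L_tr L) (Min (L ` {1..N}))"
proof
  have ne: "L ` {1..N} \<noteq> {}" using assms(2) by auto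
  show "0 < Min (L ` {1..N})" using assms(1) ne by (subst Min_gr_iff) auto
  fix i assume "i \<in> {1..2*N}"
  then have "(i + 1) div 2 \<in> {1..N}" by (rule index_cases) auto
  then show "Min (L ` {1..N}) \<le> L_tr L i" unfolding L_tr_def by (intro Min_le) auto
qed simp

lemma integral_reflect_shift:
  fixes f :: "real \<Rightarrow> complex"
  shows "integral {t - x..t} f = integral {0..x} (\<lambda>y. f (t - y))"
proof -
  have "integral {t - x..t} f = integral {- x..0} (f \<circ> (+) t)"
    using integral_shift_Icc_real[of "-x" 0 f t] by simp
  also have "\<dots> = integral {0..x} (\<lambda>y. f (t - y))"
    using Henstock_Kurzweil_Integration.integral_reflect_real[of x 0 "\<lambda>y. f (t - y)"] by (simp add: comp_def)
  finally show ?thesis .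
qed

context network
begin

text \<open>The d'Alembert formulas are inverted: derivative and velocity are half the sum and half
  the difference of the two components on an edge, and \<open>u\<close> is built from primitives of
  the components. The zero mean in \<open>\<phi>_int\<close> makes all initial vertex values vanish;
  the vertex conditions at later times follow by integrating the vertex traces in time.\<close>

lemma wave_solution_exists:
  assumes p: "1 \<le> p" and L: "\<And>j. j \<in> {1..N} \<Longrightarrow> 0 < L j"
    and m_meas: "\<And>i k. (\<lambda>t. M_tr G Vu (\<eta> t) i k) \<in> borel_measurable borel"
    and C: "0 \<le> C" and m_bd: "\<And>t i k. i \<in> {1..2*N} \<Longrightarrow> k \<in> {1..2*N} \<Longrightarrow> \<bar>M_tr G Vu (\<eta> t) i k\<bar> \<le> C"
    and \<phi>_meas: "\<And>k. \<phi> k \<in> borel_measurable borel" and \<phi>_bd: "\<And>k t. norm (\<phi> k t) \<le> 1"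
    and \<phi>_int: "\<And>i. i \<in> {1..2*N} \<Longrightarrow> integral {- L_tr L i..0} (\<phi> i) = 0"
  defines "g \<equiv> char_sol {1..2*N} (L_tr L) (\<lambda>t. M_tr G Vu (\<eta> t)) \<phi>"
  shows "\<exists>U. wave_solution G Vu L \<eta> p (U 0) U \<and>
    (\<forall>t\<ge>0. \<forall>j\<in>{1..N}. AE x in leb_seg (L j).
       weak_deriv (L j) (fst (U t) j) x = (g (2*j-1) (t - L j + x) + g (2*j) (t - x)) / 2 \<and>
       snd (U t) j x = (g (2*j-1) (t - L j + x) - g (2*j) (t - x)) / 2)"
proof -
  let ?I = "{1..2*N}" and ?\<tau> = "L_tr L"
  interpret D: delays ?I ?\<tau> "Min (L ` {1..N})" using delays_L_tr[OF L N_pos] by simp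
  have rec: "g i t = (\<Sum>k=1..2*N. of_real (M_tr G Vu (\<eta> t) i k) * g k (t - ?\<tau> k))" if "0 \<le> t" for i t
    unfolding g_def by (rule D.char_sol_rec[OF that])
  have gm[measurable]: "g i \<in> borel_measurable borel" if "i \<in> ?I" for i
    unfolding g_def by (rule D.char_sol_measurable[OF m_meas \<phi>_meas that])
  have gb: "\<exists>B. \<forall>i\<in>?I. \<forall>t\<le>T. norm (g i t) \<le> B" for T
    unfolding g_def by (rule D.char_sol_bounded[OF C m_bd \<phi>_bd])
  have g_int: "g i integrable_on {a..b}" if "i \<in> ?I" for i a b
  proof -
    obtain B where "\<forall>i\<in>?I. \<forall>t\<le>b. norm (g i t) \<le> B" using gb by blast
    then show ?thesis using that by (intro borel_bounded_integrable_on(2)[OF gm]) auto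
  qed
  \<comment> \<open>Normalised to vanish at \<open>- ?\<tau> i\<close>, where the data of component
    \<open>i\<close> begin; by the zero mean it vanishes at 0 as well.\<close>
  define GG where "GG i s = integral {- ?\<tau> i..s} (g i)" for i s
  have GG_diff: "GG i b = GG i a + integral {a..b} (g i)" if "i \<in> ?I" "- ?\<tau> i \<le> a" "a \<le> b" for i a b
    unfolding GG_def using Henstock_Kurzweil_Integration.integral_combine[OF that(2,3) g_int[OF that(1)]] by simp
  have GG0: "GG i 0 = 0" if "i \<in> ?I" for i
  proof -
    have "integral {- ?\<tau> i..0} (g i) = integral {- ?\<tau> i..0} (\<phi> i)"
      by (rule integral_spike[of "{0}"]) (auto simp: g_def char_sol_def)
    then show ?thesis using \<phi>_int[OF that] by (simp add: GG_def)
  qed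
  have GG_t: "GG i t = integral {0..t} (g i)" if "i \<in> ?I" "0 \<le> t" for i t
    using GG_diff[OF that(1), of 0 t] GG0[OF that(1)] D.tau_pos[OF that(1)] that(2) by simp
  have GG_sh: "GG i (t - ?\<tau> i) = integral {0..t} (\<lambda>s. g i (s - ?\<tau> i))" for i t
    using integral_shift_Icc_real[of 0 t "g i" "- ?\<tau> i"] by (simp add: GG_def comp_def)
  have j_I: "2 * j \<in> ?I" "2 * j - 1 \<in> ?I" "1 \<le> j" if "j \<in> {1..N}" for j using that by auto
  \<comment> \<open>The difference of primitives has the sum of components as derivative, because
    the argument \<open>t - x\<close> decreases in \<open>x\<close>.\<close>
  define u where "u t j x = (GG (2*j-1) (t - L j + x) - GG (2*j) (t - x)) / 2" for t j x
  define v where "v t j x = (g (2*j-1) (t - L j + x) - g (2*j) (t - x)) / 2" for t j x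
  define w where "w t j x = (g (2*j-1) (t - L j + x) + g (2*j) (t - x)) / 2" for t j x
  have meas_shift: "(\<lambda>x. g i (a + x)) \<in> borel_measurable borel" "(\<lambda>x. g i (a - x)) \<in> borel_measurable borel"
    if "i \<in> ?I" for i a
    by (intro measurable_compose[OF _ gm[OF that]]; simp)+
  have wm: "w t j \<in> borel_measurable borel" and vm: "v t j \<in> borel_measurable borel" if "j \<in> {1..N}" for t j
    unfolding w_def v_def using meas_shift[OF j_I(1)[OF that]] meas_shift[OF j_I(2)[OF that]] by measurable
  have wvb: "\<exists>B. \<forall>x\<in>{0..L j}. norm (w t j x) \<le> B \<and> norm (v t j x) \<le> B" if j: "j \<in> {1..N}" for t j
  proof -
    obtain B where B: "\<forall>i\<in>?I. \<forall>s\<le>t. norm (g i s) \<le> B" using gb by blast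
    show ?thesis
    proof (intro exI[of _ B] ballI)
      fix x assume x: "x \<in> {0..L j}"
      have "norm (g (2*j-1) (t - L j + x)) \<le> B" "norm (g (2*j) (t - x)) \<le> B"
        using B j_I[OF j] x by auto
      then show "norm (w t j x) \<le> B \<and> norm (v t j x) \<le> B"
        unfolding w_def v_def norm_divide
        using norm_triangle_ineq[of "g (2*j-1) (t - L j + x)" "g (2*j) (t - x)"]
          norm_triangle_ineq4[of "g (2*j-1) (t - L j + x)" "g (2*j) (t - x)"] by auto
    qed
  qed
  have u_eq: "u t j x = u t j 0 + integral {0..x} (w t j)" if j: "j \<in> {1..N}" and x: "x \<in> {0..L j}" and t: "0 \<le> t" for t j x
  proof -
    note jI = j_I[OF j]
    have \<tau>: "?\<tau> (2*j) = L j" "?\<tau> (2*j-1) = L j" using L_tr_simps jI(3) by auto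
    have 1: "GG (2*j-1) (t - L j + x) = GG (2*j-1) (t - L j) + integral {0..x} (\<lambda>y. g (2*j-1) (t - L j + y))"
      using GG_diff[OF jI(2), of "t - L j" "t - L j + x"] x t \<tau>
        integral_shift_Icc_real[of 0 x "g (2*j-1)" "t - L j"] by (simp add: comp_def add.commute)
    have 2: "GG (2*j) t = GG (2*j) (t - x) + integral {0..x} (\<lambda>y. g (2*j) (t - y))"
      using GG_diff[OF jI(1), of "t - x" t] x t \<tau> by (simp add: integral_reflect_shift)
    obtain B where B: "\<forall>i\<in>?I. \<forall>s\<le>t. norm (g i s) \<le> B" using gb by blast
    have i1: "(\<lambda>y. g (2*j-1) (t - L j + y)) integrable_on {0..x}"
      by (rule borel_bounded_integrable_on(2)[OF meas_shift(1)[OF jI(2)], where B = B]) (use B jI x in auto)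
    have i2: "(\<lambda>y. g (2*j) (t - y)) integrable_on {0..x}"
      by (rule borel_bounded_integrable_on(2)[OF meas_shift(2)[OF jI(1)], where B = B]) (use B jI x in auto)
    have "integral {0..x} (w t j) = (integral {0..x} (\<lambda>y. g (2*j-1) (t - L j + y)) + integral {0..x} (\<lambda>y. g (2*j) (t - y))) / 2"
      unfolding w_def using i1 i2 by (simp add: Henstock_Kurzweil_Integration.integral_add)
    then show ?thesis unfolding u_def using 1 2 by (simp add: field_simps)
  qed
  have weak: "has_weak_deriv (L j) (u t j) (w t j)" if j: "j \<in> {1..N}" and t: "0 \<le> t" for t j
  proof -
    obtain B where B: "\<forall>x\<in>{0..L j}. norm (w t j x) \<le> B \<and> norm (v t j x) \<le> B" using wvb[OF j] by blast
    show ?thesis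
      by (rule has_weak_deriv_antiderivative[OF L[OF j] wm[OF j] _ u_eq[OF j _ t], where B = B])
         (use B in blast)+
  qed
  have LpI: "f \<in> Lp_space p (leb_seg l)" if "f \<in> borel_measurable (leb_seg l)" "\<And>x. x \<in> {0..l} \<Longrightarrow> norm (f x) \<le> B" for f l B
    by (rule Lp_bounded[OF p that(1), of B]) (use that(2) in \<open>auto intro!: AE_I2\<close>)
  have W1: "u t j \<in> W1p p (L j)" and vLp: "v t j \<in> Lp_space p (leb_seg (L j))" if j: "j \<in> {1..N}" and t: "0 \<le> t" for t j
  proof -
    obtain B where B: "\<forall>x\<in>{0..L j}. norm (w t j x) \<le> B \<and> norm (v t j x) \<le> B" using wvb[OF j] by blast
    show "v t j \<in> Lp_space p (leb_seg (L j))"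
      by (rule LpI[where B = B]) (use B borel_measurable_leb_seg[OF vm[OF j]] in auto)
    have wLp: "w t j \<in> Lp_space p (leb_seg (L j))"
      by (rule LpI[where B = B]) (use B borel_measurable_leb_seg[OF wm[OF j]] in auto)
    have "w t j integrable_on {0..L j}"
      by (rule borel_bounded_integrable_on(2)[OF wm[OF j], where B = B]) (use B in auto)
    then have "continuous_on {0..L j} (\<lambda>x. u t j 0 + integral {0..x} (w t j))"
      by (intro continuous_intros indefinite_integral_continuous_1)
    then have cont: "continuous_on {0..L j} (u t j)"
      by (rule continuous_on_eq) (rule u_eq[OF j _ t, symmetric])
    have "bounded (u t j ` {0..L j})"
      by (intro compact_imp_bounded compact_continuous_image cont) auto
    then obtain B' where B': "\<forall>x\<in>{0..L j}. norm (u t j x) \<le> B'" by (auto simp: bounded_iff)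
    have "u t j \<in> Lp_space p (leb_seg (L j))"
      by (rule LpI[where B = B'])
         (use cont B' in \<open>auto intro!: continuous_imp_measurable_on_sets_lebesgue\<close>)
    then show "u t j \<in> W1p p (L j)" unfolding W1p_def using cont wLp weak[OF j t] by blast
  qed
  \<comment> \<open>Integrated from time 0, where the vertex values are zero, this recovers the
    value at \<open>q\<close> up to the factor -1/2. That value inherits what the scattering matrix
    says about \<open>tr\<close>: equality over the edges at a vertex, and zero at undamped
    ones.\<close>
  define tr where "tr q j s = (-1) ^ out_ix G q j * g (out_ix G q j) s +
      (-1) ^ in_ix G q j * g (in_ix G q j) (s - ?\<tau> (in_ix G q j))" for q j s
  have vert: "vert_val G L (u t) j q = - integral {0..t} (tr q j) / 2" if j: "j \<in> inc_edges G q" and t: "0 \<le> t" for t j q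
  proof -
    have jN: "j \<in> {1..N}" using j inc_sub by blast
    note jI = j_I[OF jN]
    have \<tau>: "?\<tau> (2*j) = L j" "?\<tau> (2*j-1) = L j" using L_tr_simps jI(3) by auto
    have ish: "(\<lambda>s. g i (s - a)) integrable_on {0..t}" if "i \<in> ?I" for i a
      using integrable_on_shift_Icc_real[of "g i" "-a" 0 t] g_int[OF that] by (simp add: comp_def)
    have odd: "(-1::complex) ^ (2*j-1) = -1" using jI(3) by simp
    show ?thesis
    proof (cases "q = tail G j")
      case True
      then have "head G j \<noteq> q" using tail_neq_head[OF jN] by auto
      then have tr_eq: "tr q j = (\<lambda>s. g (2*j) s - g (2*j-1) (s - L j))"
        using True odd \<tau> by (auto simp: tr_def out_ix_def in_ix_def fun_eq_iff)
      have "integral {0..t} (tr q j) = GG (2*j) t - GG (2*j-1) (t - L j)"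
        unfolding tr_eq using Henstock_Kurzweil_Integration.integral_diff[OF g_int[OF jI(1), of 0 t] ish[OF jI(2), of "L j"]] GG_t[OF jI(1) t] GG_sh[of "2*j-1" t] \<tau> by simp
      then show ?thesis using True by (simp add: vert_val_def u_def)
    next
      case False
      then have "head G j = q" using j by (auto simp: inc_edges_def)
      then have tr_eq: "tr q j = (\<lambda>s. g (2*j) (s - L j) - g (2*j-1) s)"
        using False odd \<tau> by (auto simp: tr_def out_ix_def in_ix_def fun_eq_iff)
      have "integral {0..t} (tr q j) = GG (2*j) (t - L j) - GG (2*j-1) t"
        unfolding tr_eq using Henstock_Kurzweil_Integration.integral_diff[OF ish[OF jI(1), of "L j" ] g_int[OF jI(2), of 0 t]] GG_t[OF jI(2) t] GG_sh[of "2*j" t] \<tau> by simp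
      then show ?thesis using False by (simp add: vert_val_def u_def)
    qed
  qed
  have tr_eq: "tr q j s = tr q k s" if "q \<in> verts G" "j \<in> inc_edges G q" "k \<in> inc_edges G q" "0 \<le> s" for q j k s
    unfolding tr_def
    by (rule vertex_trace(1)[where y = "\<lambda>i. g i s" and x = "\<lambda>k. g k (s - ?\<tau> k)" and h = "\<eta> s"])
       (use that rec in auto)
  have tr_0: "tr q j s = 0" if "q \<in> verts G" "q \<in> Vu" "j \<in> inc_edges G q" "0 \<le> s" for q j s
    unfolding tr_def
    by (rule vertex_trace(2)[where y = "\<lambda>i. g i s" and x = "\<lambda>k. g k (s - ?\<tau> k)" and h = "\<eta> s"])
       (use that rec in auto)
  have Vu_verts: "Vu \<subseteq> verts G" using net unfolding network_graph_def exterior_def by blast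
  define U where "U t = (u t, v t)" for t
  have U_X: "U t \<in> X_wave G L Vu p" if t: "0 \<le> t" for t
  proof -
    have "vert_val G L (u t) j q = vert_val G L (u t) k q"
      if "q \<in> verts G" "j \<in> inc_edges G q" "k \<in> inc_edges G q" for q j k
    proof -
      have "integral {0..t} (tr q j) = integral {0..t} (tr q k)"
        by (rule Henstock_Kurzweil_Integration.integral_cong, rule tr_eq[OF that]) simp
      then show ?thesis by (simp add: vert[OF that(2) t] vert[OF that(3) t])
    qed
    moreover have "vert_val G L (u t) j q = 0" if "q \<in> Vu" "j \<in> inc_edges G q" for q j
    proof -
      have "integral {0..t} (tr q j) = integral {0..t} (\<lambda>_. 0)"
        by (rule Henstock_Kurzweil_Integration.integral_cong, rule tr_0[OF subsetD[OF Vu_verts that(1)] that]) simp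
      then show ?thesis by (simp add: vert[OF that(2) t])
    qed
    ultimately show ?thesis
      using W1[OF _ t] vLp[OF _ t] unfolding U_def X_wave_def W01p_def Lp_net_def arcs_G by blast
  qed
  have WD: "AE x in leb_seg (L j). weak_deriv (L j) (u t j) x = w t j x" if "j \<in> {1..N}" "0 \<le> t" for t j
    by (rule weak_deriv_AE[OF weak[OF that]])
  have DA: "AE x in leb_seg (?\<tau> i). dAlembert L (U t) i x = g i (t - x)" if i: "i \<in> ?I" and t: "0 \<le> t" for t i
    using i
  proof (cases rule: index_cases)
    case (1 j)
    then have \<tau>i: "?\<tau> i = L j" by (simp add: L_tr_def)
    show ?thesis unfolding \<tau>i
      using WD[OF 1(1) t]
    proof eventually_elim
      case (elim x)
      then show ?case using 1 by (auto simp: dAlembert_def U_def Let_def w_def v_def field_simps)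
    qed
  next
    case (2 j)
    then have \<tau>i: "?\<tau> i = L j" by (simp add: L_tr_def)
    show ?thesis unfolding \<tau>i
      using AE_leb_seg_reflect[OF WD[OF 2(1) t]]
    proof eventually_elim
      case (elim x)
      have "t - L j + (L j - x) = t - x" by simp
      then show ?case using 2 elim by (simp add: dAlembert_def U_def Let_def w_def v_def field_simps)
    qed
  qed
  have "wave_solution G Vu L \<eta> p (U 0) U"
    unfolding wave_solution_def transport_solution_def
  proof (intro conjI exI[of _ g] ballI allI impI U_X)
    fix i assume "i \<in> {1..2 * card (arcs G)}"
    then have i: "i \<in> ?I" by (simp add: arcs_G)
    \<comment> \<open>The initial condition is the identity at time 0, reflected through the
      origin.\<close>
    have "AE x in lebesgue. x \<in> {0..?\<tau> i} \<longrightarrow> dAlembert L (U 0) i x = g i (0 - x)"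
      using DA[OF i, of 0] by (simp add: AE_leb_seg)
    from AE_lebesgue_affine[OF _ this, of "-1" 0]
    show "AE s in lebesgue. s \<in> {- ?\<tau> i..<0} \<longrightarrow> g i s = dAlembert L (U 0) i (- s)"
      by (auto elim!: eventually_mono)
    show "AE t in lebesgue. 0 \<le> t \<longrightarrow> g i t =
        (\<Sum>k=1..2 * card (arcs G). of_real (M_tr G Vu (\<eta> t) i k) * g k (t - ?\<tau> k))"
      using rec by (intro AE_I2) (simp add: arcs_G)
    show "AE x in leb_seg (?\<tau> i). dAlembert L (U t) i x = g i (t - x)" if "0 \<le> t" for t
      by (rule DA[OF i that])
  qed
  moreover have "AE x in leb_seg (L j).
       weak_deriv (L j) (fst (U t) j) x = (g (2*j-1) (t - L j + x) + g (2*j) (t - x)) / 2 \<and>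
       snd (U t) j x = (g (2*j-1) (t - L j + x) - g (2*j) (t - x)) / 2" if "0 \<le> t" "j \<in> {1..N}" for t j
    using WD[OF that(2,1)] by (simp add: U_def w_def v_def)
  ultimately show ?thesis by blast
qed

end

section \<open>Decay of the word sums\<close>

lemma finite_separation:
  fixes A :: "real set"
  assumes "finite A"
  shows "\<exists>r>0. \<forall>a\<in>A. \<forall>b\<in>A. a \<noteq> b \<longrightarrow> r \<le> \<bar>a - b\<bar>"
proof -
  let ?S = "(\<lambda>(a, b). \<bar>a - b\<bar>) ` {z \<in> A \<times> A. fst z \<noteq> snd z}"
  have fin: "finite (insert 1 ?S)" using assms by auto
  show ?thesis
  proof (intro exI[of _ "Min (insert 1 ?S)"] conjI ballI impI)
    show "0 < Min (insert 1 ?S)" using fin by (subst Min_gr_iff) auto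
    fix a b assume "a \<in> A" "b \<in> A" "a \<noteq> b"
    then have "\<bar>a - b\<bar> \<in> ?S" by force
    then show "Min (insert 1 ?S) \<le> \<bar>a - b\<bar>" using fin by (intro Min_le) auto
  qed
qed

text \<open>Windows of width \<open>r\<close> that start at separated points are disjoint, so one
  step function can carry a prescribed label on each. Composing an arbitrary function of the labels
  with it gives a measurable signal with finitely many values.\<close>

lemma step_selector:
  fixes A :: "real set"
  assumes A: "finite A" and sep: "\<And>a b. a \<in> A \<Longrightarrow> b \<in> A \<Longrightarrow> a \<noteq> b \<Longrightarrow> r \<le> \<bar>a - b\<bar>"
  shows "\<exists>\<psi> :: real \<Rightarrow> real. \<psi> \<in> borel \<rightarrow>\<^sub>M count_space UNIV \<and> finite (range \<psi>) \<and>
    (\<forall>a\<in>A. \<forall>y. 0 \<le> y \<and> y < r \<longrightarrow> \<psi> (c - a + y) = a)"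
  using A sep
proof (induction A rule: finite_induct)
  case empty
  show ?case by (intro exI[of _ "\<lambda>_. 0"]) auto
next
  case (insert a F)
  then obtain \<psi> :: "real \<Rightarrow> real" where \<psi>: "\<psi> \<in> borel \<rightarrow>\<^sub>M count_space UNIV" "finite (range \<psi>)"
    "\<And>b y. b \<in> F \<Longrightarrow> 0 \<le> y \<Longrightarrow> y < r \<Longrightarrow> \<psi> (c - b + y) = b" by (meson insertCI)
  define \<psi>' where "\<psi>' x = (if c - a \<le> x \<and> x < c - a + r then a else \<psi> x)" for x
  have "\<psi>' \<in> borel \<rightarrow>\<^sub>M count_space UNIV"
    unfolding \<psi>'_def using \<psi>(1) by measurable
  moreover have "range \<psi>' \<subseteq> insert a (range \<psi>)" by (auto simp: \<psi>'_def)
  then have "finite (range \<psi>')" using \<psi>(2) finite_subset by blast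
  moreover have "\<psi>' (c - b + y) = b" if b: "b \<in> insert a F" and y: "0 \<le> y" "y < r" for b y
  proof (cases "b = a")
    case True then show ?thesis using y by (simp add: \<psi>'_def)
  next
    case False
    then have "r \<le> \<bar>a - b\<bar>" using insert.prems[of a b] b by auto
    then have "\<not> (c - a \<le> c - b + y \<and> c - b + y < c - a + r)" using y by linarith
    then show ?thesis using \<psi>(3)[of b y] b False y by (auto simp: \<psi>'_def)
  qed
  ultimately show ?case by blast
qed

lemma weak_deriv_in_Lp:
  assumes "u \<in> W1p p l"
  shows "weak_deriv l u \<in> Lp_space p (leb_seg l)"
proof -
  obtain w where w: "w \<in> Lp_space p (leb_seg l)" "has_weak_deriv l u w"
    using assms by (auto simp: W1p_def)
  have "has_weak_deriv l u (weak_deriv l u)" unfolding weak_deriv_def by (rule someI[of _ w]) (rule w(2))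
  then have "weak_deriv l u \<in> borel_measurable (leb_seg l)" by (simp add: has_weak_deriv_def Lp_space_def)
  moreover have "w \<in> borel_measurable (leb_seg l)" using w(1) by (simp add: Lp_space_def)
  ultimately show ?thesis using Lp_AE_cong(1) w(1) weak_deriv_AE[OF w(2)] by blast
qed

lemma integral_balanced_bump:
  assumes "0 < r" "a \<le> c" "c + r \<le> b"
  shows "integral {a..b} (\<lambda>x::real. complex_of_real (indicat_real {c..<c + r/2} x - indicat_real {c + r/2..<c + r} x)) = 0"
    (is "integral _ ?f = 0")
proof -
  have f: "integrable lborel ?f" "(\<integral>x. ?f x \<partial>lborel) = 0"
    using assms(1) by (auto simp: measure_def emeasure_lborel_Ico)
  have supp: "indicat_real {a..b} x *\<^sub>R ?f x = ?f x" for x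
    using assms by (auto simp: indicator_def)
  have "set_integrable lborel {a..b} ?f" unfolding set_integrable_def supp by (rule f(1))
  from set_borel_integral_eq_integral(2)[OF this] show ?thesis
    unfolding set_lebesgue_integral_def supp f(2) by simp
qed

context network
begin

text \<open>For a bump of width \<open>r\<close>, component \<open>i\<close> of the solution has
  modulus |\<theta>| on a window of the same width, where \<theta> is the class weight in question.
  Stability then compares |\<theta>| r^(1/p) with the decay factor times r^(1/p), up to constants
  independent of \<open>h\<close>, \<open>i\<close>, \<open>k\<close> and \<open>s\<close>.\<close>

lemma class_wt_decay:
  assumes p: "1 \<le> p" and \<Lambda>: "\<And>j. j \<in> {1..N} \<Longrightarrow> 0 < \<Lambda> j" and DD: "\<DD> \<subseteq> Vd \<rightarrow>\<^sub>E {0..}"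
    and stab: "exp_stable G Vu \<Lambda> (Linfty Vd \<DD>) p"
  shows "\<exists>K\<ge>0. \<exists>\<gamma>>0. \<forall>h i k s. (\<forall>x. h x \<in> \<DD>) \<and> i \<in> {1..2*N} \<and> k \<in> {1..2*N} \<longrightarrow>
    \<bar>class_wt {1..2*N} (L_tr \<Lambda>) (\<lambda>x. M_tr G Vu (h x)) 0 i k s\<bar> \<le> K * exp (- \<gamma> * s)"
proof -
  let ?I = "{1..2*N}" and ?\<tau> = "L_tr \<Lambda>"
  interpret D: delays ?I ?\<tau> "Min (\<Lambda> ` {1..N})" using delays_L_tr[OF \<Lambda> N_pos] by simp
  obtain \<gamma>0 where \<gamma>0: "\<gamma>0 < 0" "exp_type G Vu \<Lambda> (Linfty Vd \<DD>) p \<gamma>0"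
    using stab by (auto simp: exp_stable_def)
  \<comment> \<open>Half of the rate is given away as the \<epsilon> of \<open>exp_type\<close>,
    which leaves the negative rate -\<gamma>.\<close>
  define \<gamma> where "\<gamma> = - \<gamma>0 / 2"
  have \<gamma>: "0 < \<gamma>" "\<gamma>0 + \<gamma> = - \<gamma>" using \<gamma>0 by (auto simp: \<gamma>_def)
  obtain K0 where K0: "0 < K0" "\<And>\<eta> U0 U t. \<eta> \<in> Linfty Vd \<DD> \<Longrightarrow> U0 \<in> X_wave G \<Lambda> Vu p \<Longrightarrow>
      wave_solution G Vu \<Lambda> \<eta> p U0 U \<Longrightarrow> 0 \<le> t \<Longrightarrow>
      X_norm G \<Lambda> p (U t) \<le> K0 * exp (- \<gamma> * t) * X_norm G \<Lambda> p U0"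
    using \<gamma>0(2) \<gamma> unfolding exp_type_def by (metis (no_types, lifting))
  define b where "b = Max (?\<tau> ` ?I)"
  have b: "?\<tau> i \<le> b" if "i \<in> ?I" for i unfolding b_def using that by (intro Max_ge) auto
  have fin_arcs: "finite (arcs G)" "arcs G \<noteq> {}" "card (arcs G) = N" using N_pos by (auto simp: arcs_G)
  have Vd_fin: "finite Vd"
  proof -
    have "Vd \<subseteq> verts G" using net unfolding network_graph_def exterior_def by blast
    then show ?thesis using finite_verts_G finite_subset by blast
  qed
  \<comment> \<open>The 8 is 4 from reading component \<open>i\<close> off the state times 2 from
    the norm of the initial bump, which also gives \<open>N\<close>. The exponential pays for
    observing at a time that may precede \<open>s\<close> by up to \<open>b\<close>.\<close>
  define K where "K = 8 * real N * K0 * exp (\<gamma> * b)"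
  have main: "\<bar>class_wt ?I ?\<tau> (\<lambda>x. M_tr G Vu (h x)) 0 i k s\<bar> \<le> K * exp (- \<gamma> * s)"
    if h: "\<And>x. h x \<in> \<DD>" and i: "i \<in> ?I" and k: "k \<in> ?I" for h i k s
  proof (cases "class_wt ?I ?\<tau> (\<lambda>x. M_tr G Vu (h x)) 0 i k s = 0")
    case True
    then show ?thesis using K0 by (simp add: K_def)
  next
    case False
    define \<theta> where "\<theta> = class_wt ?I ?\<tau> (\<lambda>x. M_tr G Vu (h x)) 0 i k s"
    have \<theta>: "\<theta> \<noteq> 0" using False by (simp add: \<theta>_def)
    have "word_class ?I ?\<tau> k s \<noteq> {}" using False by (auto simp: class_wt_def)
    then obtain w0 where w0: "w0 \<noteq> []" "set w0 \<subseteq> ?I" "last w0 = k" "wlen ?\<tau> w0 = s"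
      by (auto simp: word_class_def)
    have s_ge: "?\<tau> k \<le> s" using D.wlen_ge_last[OF w0(1,2)] w0(3,4) by simp
    have \<tau>k: "0 < ?\<tau> k" using D.tau_pos[OF k] .
    \<comment> \<open>At this time words of length \<open>s\<close> ending in \<open>k\<close> read
      the datum at the midpoint of its interval.\<close>
    define ts where "ts = s - ?\<tau> k / 2"
    have ts: "0 < ts" "ts < s" "s - b \<le> ts" using s_ge \<tau>k b[OF k] by (auto simp: ts_def)
    \<comment> \<open>Contains all prefix lengths of words of length \<open>s\<close> and all
      lengths of exit words at times up to \<open>ts + r\<close>; the 1 makes room for r \<le>
      1.\<close>
    define A where "A = grid ?I ?\<tau> (s + b + 1)"
    have finA: "finite A" unfolding A_def by (rule D.finite_grid)
    have b_pos: "0 < b" using b[OF k] \<tau>k by simp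
    have sA: "s \<in> A" unfolding A_def grid_def using w0 b_pos by (intro image_eqI[of _ _ w0]) auto
    obtain r0 where r0: "0 < r0" "\<And>a b. a \<in> A \<Longrightarrow> b \<in> A \<Longrightarrow> a \<noteq> b \<Longrightarrow> r0 \<le> \<bar>a - b\<bar>"
      using finite_separation[OF finA] by blast
    \<comment> \<open>The four entries ensure disjoint windows on the grid, times covered by
      \<open>A\<close>, a bump that ends by time 0, and an observation window that fits into the
      edge of \<open>i\<close>.\<close>
    define r where "r = Min {r0, 1, ?\<tau> k / 2, ?\<tau> i}"
    have r: "0 < r" "r \<le> r0" "r \<le> 1" "r \<le> ?\<tau> k / 2" "r \<le> ?\<tau> i"
      using r0(1) \<tau>k D.tau_pos[OF i] by (auto simp: r_def)
    have sep: "r \<le> \<bar>a - a'\<bar>" if "a \<in> A" "a' \<in> A" "a \<noteq> a'" for a a'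
      using r0(2)[OF that] r(2) by simp
    obtain \<psi> :: "real \<Rightarrow> real" where \<psi>: "\<psi> \<in> borel \<rightarrow>\<^sub>M count_space UNIV" "finite (range \<psi>)"
      "\<And>a y. a \<in> A \<Longrightarrow> 0 \<le> y \<Longrightarrow> y < r \<Longrightarrow> \<psi> (ts - a + y) = a"
      using step_selector[OF finA sep, of ts] by blast
    \<comment> \<open>Just after \<open>ts - a\<close> this equals \<open>h (- a)\<close>, which is
      what the class weight at time 0 samples after a prefix of length \<open>a\<close>.\<close>
    define \<eta> where "\<eta> x = h (- \<psi> x)" for x
    have \<eta>_val: "\<eta> (ts + y - a) = h (- a)" if "a \<in> A" "0 \<le> y" "y < r" for a y
      using \<psi>(3)[OF that] by (simp add: \<eta>_def algebra_simps)
    have \<eta>: "\<eta> \<in> Linfty Vd \<DD>"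
    proof -
      have "(\<lambda>a. h (- a)) \<in> count_space UNIV \<rightarrow>\<^sub>M Pi\<^sub>M Vd (\<lambda>_. borel)"
        using h DD by (auto simp: space_PiM PiE_iff extensional_def)
      then have "\<eta> \<in> borel \<rightarrow>\<^sub>M Pi\<^sub>M Vd (\<lambda>_. borel)"
        unfolding \<eta>_def by (rule measurable_compose[OF \<psi>(1)])
      then have m: "\<eta> \<in> lebesgue \<rightarrow>\<^sub>M Pi\<^sub>M Vd (\<lambda>_. borel)" by (simp add: measurable_completion)
      have "\<bar>\<eta> t q\<bar> \<le> (\<Sum>a\<in>range \<psi>. \<Sum>q\<in>Vd. \<bar>h (- a) q\<bar>)" if "q \<in> Vd" for t q
      proof -
        have "\<bar>\<eta> t q\<bar> \<le> (\<Sum>q\<in>Vd. \<bar>h (- \<psi> t) q\<bar>)"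
          unfolding \<eta>_def using that Vd_fin by (intro member_le_sum) auto
        also have "\<dots> \<le> (\<Sum>a\<in>range \<psi>. \<Sum>q\<in>Vd. \<bar>h (- a) q\<bar>)"
          by (rule member_le_sum[of "\<psi> t" "range \<psi>" "\<lambda>a. \<Sum>q\<in>Vd. \<bar>h (- a) q\<bar>"]) (use \<psi>(2) in \<open>auto intro: sum_nonneg\<close>)
        finally show ?thesis .
      qed
      then show ?thesis unfolding Linfty_def using m h by (auto simp: \<eta>_def intro!: exI[of _ "\<Sum>a\<in>range \<psi>. \<Sum>q\<in>Vd. \<bar>h (- a) q\<bar>"])
    qed
    have m_meas: "(\<lambda>t. M_tr G Vu (\<eta> t) i k) \<in> borel_measurable borel" for i k
      unfolding \<eta>_def by (rule measurable_compose[OF \<psi>(1)]) simp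
    define C where "C = (\<Sum>a\<in>range \<psi>. \<Sum>i\<in>?I. \<Sum>k\<in>?I. \<bar>M_tr G Vu (h (- a)) i k\<bar>)"
    have C0: "0 \<le> C" unfolding C_def by (intro sum_nonneg) auto
    have m_bd: "\<bar>M_tr G Vu (\<eta> t) i k\<bar> \<le> C" if "i \<in> ?I" "k \<in> ?I" for t i k
    proof -
      have "\<bar>M_tr G Vu (\<eta> t) i k\<bar> \<le> (\<Sum>k\<in>?I. \<bar>M_tr G Vu (h (- \<psi> t)) i k\<bar>)"
        unfolding \<eta>_def by (rule member_le_sum[OF that(2)]) auto
      also have "\<dots> \<le> (\<Sum>i\<in>?I. \<Sum>k\<in>?I. \<bar>M_tr G Vu (h (- \<psi> t)) i k\<bar>)"
        by (rule member_le_sum[OF that(1), of "\<lambda>i. \<Sum>k\<in>?I. \<bar>M_tr G Vu (h (- \<psi> t)) i k\<bar>"]) (auto intro: sum_nonneg)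
      also have "\<dots> \<le> C" unfolding C_def
        by (rule member_le_sum[of "\<psi> t" "range \<psi>" "\<lambda>a. \<Sum>i\<in>?I. \<Sum>k\<in>?I. \<bar>M_tr G Vu (h (- a)) i k\<bar>"])
           (use \<psi>(2) in \<open>auto intro!: sum_nonneg\<close>)
      finally show ?thesis .
    qed
    define c0 where "c0 = - ?\<tau> k / 2"
    \<comment> \<open>Opposite signs on the two halves give zero mean, while the modulus is 1 on the
      whole window, so the norm is that of an indicator.\<close>
    define \<phi> where "\<phi> k' x = (if k' = k then complex_of_real (indicat_real {c0..<c0 + r/2} x - indicat_real {c0 + r/2..<c0 + r} x) else 0)" for k' x
    have \<phi>_meas: "\<phi> k' \<in> borel_measurable borel" for k'
      unfolding \<phi>_def by (cases "k' = k") simp_all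
    have \<phi>_norm: "norm (\<phi> k' x) = (if k' = k then indicat_real {c0..<c0 + r} x else 0)" for k' x
      using r(1) by (auto simp: \<phi>_def indicator_def)
    have \<phi>_bd: "norm (\<phi> k' x) \<le> 1" for k' x by (simp add: \<phi>_norm indicator_def)
    have \<phi>_int: "integral {- ?\<tau> k'..0} (\<phi> k') = 0" if "k' \<in> ?I" for k'
    proof (cases "k' = k")
      case True
      have "- ?\<tau> k \<le> c0" "c0 + r \<le> 0" using r \<tau>k by (auto simp: c0_def)
      then show ?thesis using integral_balanced_bump[OF r(1)] True by (simp add: \<phi>_def[abs_def])
    qed (simp add: \<phi>_def[abs_def])
    let ?m = "\<lambda>t. M_tr G Vu (\<eta> t)"
    define g where "g = char_sol ?I ?\<tau> ?m \<phi>"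
    obtain U where U: "wave_solution G Vu \<Lambda> \<eta> p (U 0) U"
      "\<And>t j. 0 \<le> t \<Longrightarrow> j \<in> {1..N} \<Longrightarrow> AE x in leb_seg (\<Lambda> j).
       weak_deriv (\<Lambda> j) (fst (U t) j) x = (g (2*j-1) (t - \<Lambda> j + x) + g (2*j) (t - x)) / 2 \<and>
       snd (U t) j x = (g (2*j-1) (t - \<Lambda> j + x) - g (2*j) (t - x)) / 2"
      using wave_solution_exists[where \<phi> = \<phi> and \<eta> = \<eta> and L = \<Lambda>, OF p \<Lambda> m_meas C0 m_bd \<phi>_meas \<phi>_bd \<phi>_int]
      unfolding g_def by blast
    have UX: "U t \<in> X_wave G \<Lambda> Vu p" if "0 \<le> t" for t using U(1) that by (simp add: wave_solution_def)
    \<comment> \<open>Lengths in \<open>A\<close> other than \<open>s\<close> shift the bump by at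
      least \<open>r\<close> and miss the window, and other last letters see zero data. A single
      class weight survives.\<close>
    have g_val: "norm (g i (ts + y)) = \<bar>\<theta>\<bar>" if y: "0 \<le> y" "y < r" for y
    proof -
      have cw: "class_wt ?I ?\<tau> ?m (ts + y) i k s = \<theta>"
        unfolding class_wt_def \<theta>_def
      proof (rule sum.cong[OF refl], rule wt_cong)
        fix w u assume w: "w \<in> word_class ?I ?\<tau> k s" and u: "set u \<subseteq> set w" "\<exists>v. v \<noteq> [] \<and> w = u @ v"
        then obtain v where v: "w = u @ v" by blast
        have "set u \<subseteq> ?I" "set v \<subseteq> ?I" "wlen ?\<tau> u + wlen ?\<tau> v = s" using w v by (auto simp: word_class_def)
        then have "wlen ?\<tau> u \<in> A" using D.wlen_nonneg[of v] b_pos by (auto simp: A_def grid_def)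
        then show "M_tr G Vu (\<eta> (ts + y - wlen ?\<tau> u)) = M_tr G Vu (h (0 - wlen ?\<tau> u))"
          using \<eta>_val[OF _ y] by simp
      qed
      have "g i (ts + y) = word_sum ?I ?\<tau> ?m \<phi> i (ts + y)"
        using ts y by (simp add: g_def char_sol_def)
      also have "\<dots> = (\<Sum>k'\<in>?I. \<Sum>s'\<in>A. if - ?\<tau> k' \<le> ts + y - s' \<and> ts + y - s' < 0 then
          of_real (class_wt ?I ?\<tau> ?m (ts + y) i k' s') * \<phi> k' (ts + y - s') else 0)"
      proof (rule D.word_sum_by_class[OF finA])
        show "wlen ?\<tau> ` exit_words ?I ?\<tau> (ts + y) \<subseteq> A"
        proof
          fix x assume "x \<in> wlen ?\<tau> ` exit_words ?I ?\<tau> (ts + y)"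
          then obtain w where w: "w \<in> exit_words ?I ?\<tau> (ts + y)" "x = wlen ?\<tau> w" by blast
          have "wlen ?\<tau> w \<le> ts + y + b" by (rule D.exit_words_wlen[OF w(1) b])
          also have "\<dots> \<le> s + b + 1" using ts y r by simp
          finally show "x \<in> A" using w by (auto simp: A_def grid_def exit_words_def)
        qed
      qed
      also have "\<dots> = (\<Sum>k'\<in>?I. \<Sum>s'\<in>A. if k' = k then (if s' = s then of_real \<theta> * \<phi> k (c0 + y) else 0) else 0)"
      proof (intro sum.cong refl)
        fix k' s' assume s': "s' \<in> A"
        show "(if - ?\<tau> k' \<le> ts + y - s' \<and> ts + y - s' < 0 then
            of_real (class_wt ?I ?\<tau> ?m (ts + y) i k' s') * \<phi> k' (ts + y - s') else 0) =
          (if k' = k then (if s' = s then of_real \<theta> * \<phi> k (c0 + y) else 0) else 0)"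
        proof (cases "k' = k \<and> s' = s")
          case True
          then have eq: "k' = k" "s' = s" by auto
          have e: "ts + y - s = c0 + y" by (simp add: ts_def c0_def)
          have "- ?\<tau> k \<le> c0 + y" "c0 + y < 0" using y r \<tau>k by (auto simp: c0_def)
          then show ?thesis unfolding eq e cw by simp
        next
          case F: False
          have "\<phi> k' (ts + y - s') = 0"
          proof (cases "k' = k")
            case True
            then have "r \<le> \<bar>s - s'\<bar>" using sep[OF sA s'] F by auto
            then have "ts + y - s' \<notin> {c0..<c0 + r}" using y by (auto simp: ts_def c0_def)
            then have "norm (\<phi> k' (ts + y - s')) = 0" unfolding \<phi>_norm by simp
            then show ?thesis by simp
          qed (simp add: \<phi>_def)
          then show ?thesis using F by auto
        qed
      qed
      also have "\<dots> = (\<Sum>k'\<in>?I. if k' = k then (\<Sum>s'\<in>A. if s' = s then of_real \<theta> * \<phi> k (c0 + y) else 0) else 0)"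
        by (rule sum.cong) auto
      also have "\<dots> = of_real \<theta> * \<phi> k (c0 + y)"
        using k sA finA by (simp add: sum.delta)
      finally show ?thesis using y by (simp add: norm_mult \<phi>_norm)
    qed
    define nrm where "nrm = (if p = \<infinity> then 1 else r powr (1 / enn2real p))"
    have nrm: "0 < nrm" using r(1) by (simp add: nrm_def)
    \<comment> \<open>When the window ends, its content fills the first stretch of width
      \<open>r\<close> of component \<open>i\<close>.\<close>
    define T where "T = ts + r"
    have T0: "0 \<le> T" using ts r by (simp add: T_def)
    have U_Lp: "weak_deriv (\<Lambda> j) (fst (U t) j) \<in> Lp_space p (leb_seg (\<Lambda> j))" "snd (U t) j \<in> Lp_space p (leb_seg (\<Lambda> j))"
      if "0 \<le> t" "j \<in> {1..N}" for t j
      using UX[OF that(1)] that(2) weak_deriv_in_Lp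
      by (auto simp: X_wave_def W01p_def Lp_net_def arcs_G)
    have low: "nrm \<le> 4 / \<bar>\<theta>\<bar> * X_norm G \<Lambda> p (U T)"
    proof -
      \<comment> \<open>Component \<open>i\<close> is controlled by derivative and velocity
        together; dominating the indicator by these two functions costs 4 = 2^2.\<close>
      have claim: "nrm \<le> 4 / \<bar>\<theta>\<bar> * X_norm G \<Lambda> p (U T)"
        if j: "j \<in> {1..N}" and S: "0 \<le> a" "a + r \<le> \<Lambda> j" "S = {a..<a + r} \<or> S = {a<..a + r}"
          and AE: "AE x in leb_seg (\<Lambda> j). x \<in> S \<longrightarrow>
            \<bar>\<theta>\<bar> \<le> norm (weak_deriv (\<Lambda> j) (fst (U T) j) x) + norm (snd (U T) j x)" for j a S
      proof -
        let ?F = "\<lambda>b. if b then weak_deriv (\<Lambda> j) (fst (U T) j) else snd (U T) j"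
        have X: "X_norm G \<Lambda> p (U T) = X_norm G \<Lambda> p (fst (U T), snd (U T))" by simp
        have jA: "j \<in> arcs G" using j by (simp add: arcs_G)
        have "Lp_norm p (leb_seg (\<Lambda> j)) (\<lambda>x. of_real (indicat_real S x)) \<le>
            1 / \<bar>\<theta>\<bar> * real (card (UNIV :: bool set))^2 * X_norm G \<Lambda> p (U T)"
        proof (rule Lp_dominated(2)[OF p, where \<phi> = ?F])
          show "(\<lambda>x. complex_of_real (indicat_real S x)) \<in> borel_measurable (leb_seg (\<Lambda> j))"
            using Lp_norm_indicator_interval(1)[OF r(1) S, of p] by (simp add: Lp_space_def)
          show "AE x in leb_seg (\<Lambda> j). norm (complex_of_real (indicat_real S x)) \<le> 1 / \<bar>\<theta>\<bar> * (\<Sum>b\<in>UNIV. norm (?F b x))"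
            using AE
          proof eventually_elim
            case (elim x)
            show ?case
            proof (cases "x \<in> S")
              case True
              with elim have "\<bar>\<theta>\<bar> \<le> (\<Sum>b\<in>UNIV. norm (?F b x))" by (simp add: UNIV_bool)
              then show ?thesis using True \<theta> by (simp add: field_simps)
            qed (simp add: sum_nonneg)
          qed
          show "?F b \<in> Lp_space p (leb_seg (\<Lambda> j))" for b using U_Lp[OF T0 j] by simp
          show "Lp_norm p (leb_seg (\<Lambda> j)) (?F b) \<le> X_norm G \<Lambda> p (U T)" for b
            unfolding X using X_norm_ge[OF p fin_arcs(1) jA, where L = \<Lambda> and u = "fst (U T)" and v = "snd (U T)"] by auto
          then show "0 \<le> X_norm G \<Lambda> p (U T)" using Lp_norm_nonneg order_trans by blast
        qed simp_all
        then show ?thesis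
          unfolding Lp_norm_indicator_interval(2)[OF r(1) S] nrm_def by simp
      qed
      have half: "(x + y) / 2 - (x - y) / 2 = y" "(x + y) / 2 + (x - y) / 2 = x" for x y :: complex
        by (simp_all add: field_simps)
      from i show ?thesis
      proof (cases rule: index_cases)
        case (1 j)
        have L: "\<Lambda> j = ?\<tau> i" using 1 by (simp add: L_tr_def)
        show ?thesis
        proof (rule claim[OF 1(1), of 0 "{0<..0 + r}"])
          show "AE x in leb_seg (\<Lambda> j). x \<in> {0<..0 + r} \<longrightarrow>
            \<bar>\<theta>\<bar> \<le> norm (weak_deriv (\<Lambda> j) (fst (U T) j) x) + norm (snd (U T) j x)"
            using U(2)[OF T0 1(1)]
          proof eventually_elim
            case (elim x)
            show ?case
            proof
              assume x: "x \<in> {0<..0 + r}"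
              have "\<bar>\<theta>\<bar> = norm (g i (ts + (r - x)))" using g_val[of "r - x"] x by simp
              also have "g i (ts + (r - x)) = weak_deriv (\<Lambda> j) (fst (U T) j) x - snd (U T) j x"
              proof -
                have "ts + (r - x) = T - x" by (simp add: T_def)
                then show ?thesis using elim 1(2) half(1) by metis
              qed
              finally show "\<bar>\<theta>\<bar> \<le> norm (weak_deriv (\<Lambda> j) (fst (U T) j) x) + norm (snd (U T) j x)"
                using norm_triangle_ineq4 by metis
            qed
          qed
        qed (use r L in auto)
      next
        \<comment> \<open>Odd components start at the head of their edge, so the window lies at the
          far end of the parametrisation.\<close>
        case (2 j)
        have L: "\<Lambda> j = ?\<tau> i" using 2 by (simp add: L_tr_def)
        show ?thesis
        proof (rule claim[OF 2(1), of "\<Lambda> j - r" "{\<Lambda> j - r..<\<Lambda> j - r + r}"])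
          show "AE x in leb_seg (\<Lambda> j). x \<in> {\<Lambda> j - r..<\<Lambda> j - r + r} \<longrightarrow>
            \<bar>\<theta>\<bar> \<le> norm (weak_deriv (\<Lambda> j) (fst (U T) j) x) + norm (snd (U T) j x)"
            using U(2)[OF T0 2(1)]
          proof eventually_elim
            case (elim x)
            show ?case
            proof
              assume x: "x \<in> {\<Lambda> j - r..<\<Lambda> j - r + r}"
              have "\<bar>\<theta>\<bar> = norm (g i (ts + (r - \<Lambda> j + x)))" using g_val[of "r - \<Lambda> j + x"] x by simp
              also have "g i (ts + (r - \<Lambda> j + x)) = weak_deriv (\<Lambda> j) (fst (U T) j) x + snd (U T) j x"
              proof -
                have "ts + (r - \<Lambda> j + x) = T - \<Lambda> j + x" by (simp add: T_def)
                then show ?thesis using elim 2(2) half(2) by metis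
              qed
              finally show "\<bar>\<theta>\<bar> \<le> norm (weak_deriv (\<Lambda> j) (fst (U T) j) x) + norm (snd (U T) j x)"
                using norm_triangle_ineq by metis
            qed
          qed
        qed (use r L in auto)
      qed
    qed
    have up: "X_norm G \<Lambda> p (U 0) \<le> 2 * real N * nrm"
    proof -
      have comp: "Lp_norm p (leb_seg (\<Lambda> j)) f \<le> nrm"
        if j: "j \<in> {1..N}" and f: "f \<in> Lp_space p (leb_seg (\<Lambda> j))"
          and AE: "AE x in leb_seg (\<Lambda> j). norm (f x) \<le> norm (g (2*j-1) (0 - \<Lambda> j + x)) + norm (g (2*j) (0 - x))" for j f
      proof -
        have fm: "f \<in> borel_measurable (leb_seg (\<Lambda> j))" using f by (simp add: Lp_space_def)
        \<comment> \<open>At an endpoint one of the components is evaluated at time 0, where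
          \<open>g\<close> is already the word sum and no longer the datum.\<close>
        have "AE x in lebesgue. x \<noteq> 0 \<and> x \<noteq> \<Lambda> j"
          by (intro AE_conjI; rule AE_completion, rule AE_lborel_singleton)
        then have "AE x in leb_seg (\<Lambda> j). x \<noteq> 0 \<and> x \<noteq> \<Lambda> j"
          unfolding AE_leb_seg by (rule AE_mp) auto
        then have AE': "AE x in leb_seg (\<Lambda> j). norm (f x) \<le> norm (\<phi> (2*j-1) (0 - \<Lambda> j + x)) + norm (\<phi> (2*j) (0 - x))"
          using AE AE_space
        proof eventually_elim
          case (elim x)
          then show ?case by (simp add: g_def char_sol_def)
        qed
        have ind: ?thesis if S: "0 \<le> a" "a + r \<le> \<Lambda> j" "S = {a..<a + r} \<or> S = {a<..a + r}"
          and le: "\<And>x. norm (\<phi> (2*j-1) (0 - \<Lambda> j + x)) + norm (\<phi> (2*j) (0 - x)) \<le> indicat_real S x" for a S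
        proof -
          have "Lp_norm p (leb_seg (\<Lambda> j)) f \<le> 1 * real (card {()})^2 * nrm"
          proof (rule Lp_dominated(2)[OF p fm, where \<phi> = "\<lambda>_ x. of_real (indicat_real S x)"])
            show "AE x in leb_seg (\<Lambda> j). norm (f x) \<le> 1 * (\<Sum>a\<in>{()}. norm (complex_of_real (indicat_real S x)))"
              using AE' by eventually_elim (use le in \<open>auto intro: order_trans\<close>)
            show "Lp_norm p (leb_seg (\<Lambda> j)) (\<lambda>x. of_real (indicat_real S x)) \<le> nrm"
              unfolding Lp_norm_indicator_interval(2)[OF r(1) S] nrm_def by simp
          qed (use Lp_norm_indicator_interval(1)[OF r(1) S] nrm in auto)
          then show ?thesis by simp
        qed
        have j1: "1 \<le> j" using j by simp
        have odd_even: "2 * j \<noteq> 2 * j - 1" using j1 by simp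
        \<comment> \<open>At most one of the two components of an edge carries the bump, so one
          interval of width \<open>r\<close> dominates \<open>f\<close>.\<close>
        show ?thesis
        proof (cases "k = 2 * j")
          case True
          have L: "?\<tau> k = \<Lambda> j" using True by (simp add: L_tr_def)
          show ?thesis
          proof (rule ind[of "- c0 - r" "{- c0 - r<..- c0 - r + r}"])
            show "norm (\<phi> (2*j-1) (0 - \<Lambda> j + x)) + norm (\<phi> (2*j) (0 - x)) \<le> indicat_real {- c0 - r<..- c0 - r + r} x" for x
              using True odd_even by (auto simp: \<phi>_norm indicator_def)
          qed (use r L \<tau>k in \<open>auto simp: c0_def\<close>)
        next
          case F: False
          show ?thesis
          proof (cases "k = 2 * j - 1")
            case True
            have L: "?\<tau> k = \<Lambda> j" using True j1 by (simp add: L_tr_def)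
            show ?thesis
            proof (rule ind[of "c0 + \<Lambda> j" "{c0 + \<Lambda> j..<c0 + \<Lambda> j + r}"])
              show "norm (\<phi> (2*j-1) (0 - \<Lambda> j + x)) + norm (\<phi> (2*j) (0 - x)) \<le> indicat_real {c0 + \<Lambda> j..<c0 + \<Lambda> j + r} x" for x
                using True F by (auto simp: \<phi>_norm indicator_def)
            qed (use r L \<tau>k in \<open>auto simp: c0_def\<close>)
          next
            case F': False
            have "Lp_norm p (leb_seg (\<Lambda> j)) f \<le> 1 * real (card ({} :: unit set))^2 * nrm"
            proof (rule Lp_dominated(2)[OF p fm, where \<phi> = "\<lambda>_ _. 0"])
              show "AE x in leb_seg (\<Lambda> j). norm (f x) \<le> 1 * (\<Sum>a\<in>({} :: unit set). norm (0 :: complex))"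
                using AE' by eventually_elim (use F F' in \<open>auto simp: \<phi>_norm\<close>)
            qed (use nrm in auto)
            then show ?thesis using nrm by simp
          qed
        qed
      qed
      have tri: "norm ((x + y) / 2) \<le> norm x + norm y" "norm ((x - y) / 2) \<le> norm x + norm y" for x y :: complex
        using norm_triangle_ineq[of x y] norm_triangle_ineq4[of x y] norm_ge_zero[of x] norm_ge_zero[of y]
        unfolding norm_divide norm_numeral by linarith+
      have "X_norm G \<Lambda> p (fst (U 0), snd (U 0)) \<le> 2 * real (card (arcs G)) * nrm"
      proof (rule X_norm_le[OF p fin_arcs(1,2)])
        fix j assume "j \<in> arcs G"
        then have j: "j \<in> {1..N}" by (simp add: arcs_G)
        have AE: "AE x in leb_seg (\<Lambda> j).
            norm (weak_deriv (\<Lambda> j) (fst (U 0) j) x) \<le> norm (g (2*j-1) (0 - \<Lambda> j + x)) + norm (g (2*j) (0 - x)) \<and>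
            norm (snd (U 0) j x) \<le> norm (g (2*j-1) (0 - \<Lambda> j + x)) + norm (g (2*j) (0 - x))"
          using U(2)[OF order_refl j] by eventually_elim (simp only: tri)
        show "Lp_norm p (leb_seg (\<Lambda> j)) (weak_deriv (\<Lambda> j) (fst (U 0) j)) \<le> nrm"
          by (rule comp[OF j U_Lp(1)[OF order_refl j]]) (use AE in \<open>auto elim: eventually_mono\<close>)
        show "Lp_norm p (leb_seg (\<Lambda> j)) (snd (U 0) j) \<le> nrm"
          by (rule comp[OF j U_Lp(2)[OF order_refl j]]) (use AE in \<open>auto elim: eventually_mono\<close>)
      qed (use nrm in simp)
      then show ?thesis by (simp add: fin_arcs(3))
    qed
    have "X_norm G \<Lambda> p (U T) \<le> K0 * exp (- \<gamma> * T) * X_norm G \<Lambda> p (U 0)"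
      by (rule K0(2)[OF \<eta> UX[OF order_refl] U(1) T0])
    also have "\<dots> \<le> K0 * exp (- \<gamma> * T) * (2 * real N * nrm)"
      using up K0(1) by (intro mult_left_mono) auto
    finally have "nrm \<le> 4 / \<bar>\<theta>\<bar> * (K0 * exp (- \<gamma> * T) * (2 * real N * nrm))"
      using low \<theta> by (meson divide_nonneg_nonneg abs_ge_zero mult_left_mono order_trans zero_le_numeral)
    then have "\<bar>\<theta>\<bar> * nrm \<le> (8 * real N * K0 * exp (- \<gamma> * T)) * nrm"
      using \<theta> by (simp add: field_simps)
    then have "\<bar>\<theta>\<bar> \<le> 8 * real N * K0 * exp (- \<gamma> * T)" using nrm by simp
    also have "\<dots> \<le> 8 * real N * K0 * exp (\<gamma> * b + - \<gamma> * s)"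
    proof (intro mult_left_mono)
      have "\<gamma> * (s - b) \<le> \<gamma> * T" using \<gamma>(1) ts r by (intro mult_left_mono) (auto simp: T_def)
      then show "exp (- \<gamma> * T) \<le> exp (\<gamma> * b + - \<gamma> * s)" by (simp add: algebra_simps)
    qed (use K0 in simp)
    finally show ?thesis unfolding \<theta>_def K_def by (simp add: exp_add[symmetric] mult.assoc)
  qed
  have "0 \<le> K" using K0 by (simp add: K_def)
  then show ?thesis using \<gamma>(1) main by blast
qed

end

section \<open>Stability from decay\<close>

lemma poly_le_exp:
  fixes b d c :: real
  assumes "0 < d" "0 < c" "0 \<le> b"
  shows "\<exists>C>0. \<forall>T\<ge>0. real (Suc (nat \<lfloor>(T + b) / d\<rfloor>)) ^ q \<le> C * exp (c * T)"
proof (cases "q = 0")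
  case True
  show ?thesis using True assms by (intro exI[of _ 1]) auto
next
  case False
  \<comment> \<open>Chosen so that the \<open>q\<close>-th power of exp(\<delta> y) grows in
    \<open>T\<close> with rate exactly \<open>c\<close>; the polynomial enters through y \<le>
    exp(\<delta> y) / \<delta>.\<close>
  define \<delta> where "\<delta> = c * d / real q"
  have \<delta>: "0 < \<delta>" using assms False by (simp add: \<delta>_def)
  define C where "C = (1 / \<delta>) ^ q * exp (c * (b + d))"
  have "real (Suc (nat \<lfloor>(T + b) / d\<rfloor>)) ^ q \<le> C * exp (c * T)" if T: "0 \<le> T" for T
  proof -
    define y where "y = (T + b) / d + 1"
    have "0 \<le> (T + b) / d" using assms T by simp
    then have "real (nat \<lfloor>(T + b) / d\<rfloor>) \<le> (T + b) / d" by simp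
    then have ny: "real (Suc (nat \<lfloor>(T + b) / d\<rfloor>)) \<le> y" by (simp add: y_def)
    have "\<delta> * y \<le> exp (\<delta> * y)" using exp_ge_add_one_self[of "\<delta> * y"] by linarith
    then have "y \<le> 1 / \<delta> * exp (\<delta> * y)" using \<delta> by (simp add: field_simps)
    then have "real (Suc (nat \<lfloor>(T + b) / d\<rfloor>)) ^ q \<le> (1 / \<delta> * exp (\<delta> * y)) ^ q"
      using ny by (intro power_mono) auto
    also have "\<dots> = (1 / \<delta>) ^ q * exp (real q * (\<delta> * y))"
      by (simp only: power_mult_distrib exp_of_nat_mult)
    also have "real q * (\<delta> * y) = c * (b + d) + c * T"
      using assms False by (simp add: \<delta>_def y_def field_simps)
    finally show ?thesis by (simp add: C_def exp_add mult.assoc)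
  qed
  moreover have "0 < C" using \<delta> by (simp add: C_def)
  ultimately show ?thesis by blast
qed

section \<open>From decaying class weights back to norms of wave states\<close>

context network
begin

text \<open>Odd components run against the parametrisation of their edge and are handled by the
  reflection \<open>L j - x\<close>. Domination by two functions gives the factor 4 = 2^2.\<close>

lemma dAlembert_Lp:
  assumes p: "1 \<le> p" and U: "U \<in> X_wave G L Vu p" and i: "i \<in> {1..2*N}"
  shows "dAlembert L U i \<in> Lp_space p (leb_seg (L_tr L i))"
    and "Lp_norm p (leb_seg (L_tr L i)) (dAlembert L U i) \<le> 4 * X_norm G L p U"
proof -
  obtain u v where uv: "U = (u, v)" by fastforce
  define j where "j = (i + 1) div 2"
  have j: "j \<in> {1..N}" unfolding j_def using i by (rule index_cases) auto
  have jA: "j \<in> arcs G" using j by (simp add: arcs_G)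
  have fin: "finite (arcs G)" by (simp add: arcs_G)
  have \<tau>: "L_tr L i = L j" by (simp add: L_tr_def j_def)
  have a: "weak_deriv (L j) (u j) \<in> Lp_space p (leb_seg (L j))" "v j \<in> Lp_space p (leb_seg (L j))"
    using U jA weak_deriv_in_Lp by (auto simp: uv X_wave_def W01p_def Lp_net_def)
  define c t where "c = (if odd i then - 1 else 1 :: real)" and "t = (if odd i then L j else 0)"
  define \<phi> where "\<phi> = (\<lambda>b x. ext0 (L j) (if b then weak_deriv (L j) (u j) else v j) (t + c * x))"
  have c: "\<bar>c\<bar> = 1" by (simp add: c_def)
  have \<phi>: "\<phi> b \<in> Lp_space p (leb_seg (L j))" "Lp_norm p (leb_seg (L j)) (\<phi> b) \<le> X_norm G L p U" for b
  proof -
    have f: "(if b then weak_deriv (L j) (u j) else v j) \<in> Lp_space p (leb_seg (L j))" using a by simp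
    show "\<phi> b \<in> Lp_space p (leb_seg (L j))" by (rule Lp_ext0_affine(1)[OF f c]) (simp add: \<phi>_def)
    have "Lp_norm p (leb_seg (L j)) (\<phi> b) \<le> Lp_norm p (leb_seg (L j)) (if b then weak_deriv (L j) (u j) else v j)"
      by (rule Lp_ext0_affine(2)[OF f c]) (simp add: \<phi>_def)
    also have "\<dots> \<le> X_norm G L p U"
      unfolding uv using X_norm_ge[OF p fin jA, where L = L and u = u and v = v] by auto
    finally show "Lp_norm p (leb_seg (L j)) (\<phi> b) \<le> X_norm G L p U" .
  qed
  have da: "dAlembert L U i x = (if odd i then weak_deriv (L j) (u j) (L j - x) + v j (L j - x)
      else weak_deriv (L j) (u j) x - v j x)" for x
    unfolding dAlembert_def uv Let_def j_def prod.case ..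
  have eq: "dAlembert L U i x = (if odd i then \<phi> True x + \<phi> False x else \<phi> True x - \<phi> False x)" if "x \<in> {0..L j}" for x
    using that by (auto simp: da \<phi>_def ext0_def c_def t_def)
  have m: "\<phi> b \<in> borel_measurable (leb_seg (L j))" for b using \<phi>(1) by (simp add: Lp_space_def)
  have meas: "dAlembert L U i \<in> borel_measurable (leb_seg (L j))"
  proof (subst measurable_cong)
    show "dAlembert L U i x = (if odd i then \<phi> True x + \<phi> False x else \<phi> True x - \<phi> False x)"
      if "x \<in> space (leb_seg (L j))" for x using eq that by simp
    show "(\<lambda>x. if odd i then \<phi> True x + \<phi> False x else \<phi> True x - \<phi> False x) \<in> borel_measurable (leb_seg (L j))"
      using m by (cases "odd i") simp_all
  qed
  have AE: "AE x in leb_seg (L j). norm (dAlembert L U i x) \<le> 1 * (\<Sum>b\<in>UNIV. norm (\<phi> b x))"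
  proof (rule AE_I2)
    fix x assume "x \<in> space (leb_seg (L j))"
    then show "norm (dAlembert L U i x) \<le> 1 * (\<Sum>b\<in>UNIV. norm (\<phi> b x))"
      using eq[of x] norm_triangle_ineq[of "\<phi> True x" "\<phi> False x"] norm_triangle_ineq4[of "\<phi> True x" "\<phi> False x"]
      by (simp add: UNIV_bool)
  qed
  have X0: "0 \<le> X_norm G L p U" using \<phi>(2)[of True] Lp_norm_nonneg order_trans by blast
  show "dAlembert L U i \<in> Lp_space p (leb_seg (L_tr L i))"
    unfolding \<tau> by (rule Lp_dominated(1)[OF p meas _ _ AE \<phi> X0]) auto
  have "Lp_norm p (leb_seg (L j)) (dAlembert L U i) \<le> 1 * real (card (UNIV :: bool set))^2 * X_norm G L p U"
    by (rule Lp_dominated(2)[OF p meas _ _ AE \<phi> X0]) auto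
  then show "Lp_norm p (leb_seg (L_tr L i)) (dAlembert L U i) \<le> 4 * X_norm G L p U"
    unfolding \<tau> by simp
qed

lemma X_norm_nonneg:
  assumes "1 \<le> p" "U \<in> X_wave G L Vu p"
  shows "0 \<le> X_norm G L p U"
proof -
  have "1 \<in> {1..2*N}" using N_pos by simp
  from dAlembert_Lp(2)[OF assms this]
  show ?thesis using Lp_norm_nonneg[of p "leb_seg (L_tr L 1)" "dAlembert L U 1"] by linarith
qed

text \<open>Sum and difference of the two components of an edge, one of them reflected back, are
  twice the derivative and twice the velocity. The factor is 4 for two dominating functions times 2
  N from the comparison of the state norm with its components.\<close>

lemma X_norm_le_dAlembert:
  assumes p: "1 \<le> p" and U: "U \<in> X_wave G L Vu p" and B: "0 \<le> B"
    and le: "\<And>i. i \<in> {1..2*N} \<Longrightarrow> Lp_norm p (leb_seg (L_tr L i)) (dAlembert L U i) \<le> B"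
  shows "X_norm G L p U \<le> 8 * real N * B"
proof -
  obtain u v where uv: "U = (u, v)" by fastforce
  have comp: "Lp_norm p (leb_seg (L j)) f \<le> 4 * B"
    if j: "j \<in> {1..N}" and f: "f \<in> Lp_space p (leb_seg (L j))"
      and le': "\<And>x. norm (f x) \<le> norm (dAlembert L U (2*j-1) (L j - x)) + norm (dAlembert L U (2*j) x)" for j f
  proof -
    have jI: "2 * j - 1 \<in> {1..2*N}" "2 * j \<in> {1..2*N}" and \<tau>: "L_tr L (2*j-1) = L j" "L_tr L (2*j) = L j"
      using j L_tr_simps[of j L] by auto
    define \<phi> where "\<phi> = (\<lambda>b. if b then (\<lambda>x. ext0 (L j) (dAlembert L U (2*j-1)) (L j + (-1) * x))
        else (\<lambda>x. ext0 (L j) (dAlembert L U (2*j)) (0 + 1 * x)))"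
    have \<phi>: "\<phi> b \<in> Lp_space p (leb_seg (L j))" "Lp_norm p (leb_seg (L j)) (\<phi> b) \<le> B" for b
    proof -
      have f1: "dAlembert L U (2*j-1) \<in> Lp_space p (leb_seg (L j))" "Lp_norm p (leb_seg (L j)) (dAlembert L U (2*j-1)) \<le> B"
        using dAlembert_Lp(1)[OF p U jI(1)] le[OF jI(1)] unfolding \<tau> by auto
      have f2: "dAlembert L U (2*j) \<in> Lp_space p (leb_seg (L j))" "Lp_norm p (leb_seg (L j)) (dAlembert L U (2*j)) \<le> B"
        using dAlembert_Lp(1)[OF p U jI(2)] le[OF jI(2)] unfolding \<tau> by auto
      have 1: "\<phi> True \<in> Lp_space p (leb_seg (L j)) \<and> Lp_norm p (leb_seg (L j)) (\<phi> True) \<le> B"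
      proof -
        have e: "\<phi> True = (\<lambda>x. ext0 (L j) (dAlembert L U (2*j-1)) (L j + (-1) * x))" by (simp add: \<phi>_def)
        have "\<bar>- 1 :: real\<bar> = 1" by simp
        from Lp_ext0_affine[OF f1(1) this e, of "L j"] show ?thesis using f1(2) by auto
      qed
      have 2: "\<phi> False \<in> Lp_space p (leb_seg (L j)) \<and> Lp_norm p (leb_seg (L j)) (\<phi> False) \<le> B"
      proof -
        have e: "\<phi> False = (\<lambda>x. ext0 (L j) (dAlembert L U (2*j)) (0 + 1 * x))" by (simp add: \<phi>_def)
        have "\<bar>1 :: real\<bar> = 1" by simp
        from Lp_ext0_affine[OF f2(1) this e, of "L j"] show ?thesis using f2(2) by auto
      qed
      show "\<phi> b \<in> Lp_space p (leb_seg (L j))" "Lp_norm p (leb_seg (L j)) (\<phi> b) \<le> B"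
        using 1 2 by (cases b; simp)+
    qed
    have "Lp_norm p (leb_seg (L j)) f \<le> 1 * real (card (UNIV :: bool set))^2 * B"
    proof (rule Lp_dominated(2)[OF p _ _ _ _ \<phi> B])
      show "f \<in> borel_measurable (leb_seg (L j))" using f by (simp add: Lp_space_def)
      show "AE x in leb_seg (L j). norm (f x) \<le> 1 * (\<Sum>b\<in>UNIV. norm (\<phi> b x))"
      proof (rule AE_I2)
        fix x assume "x \<in> space (leb_seg (L j))"
        then show "norm (f x) \<le> 1 * (\<Sum>b\<in>UNIV. norm (\<phi> b x))"
          using le'[of x] by (simp add: UNIV_bool \<phi>_def ext0_def)
      qed
    qed auto
    then show ?thesis by simp
  qed
  have "X_norm G L p (u, v) \<le> 2 * real (card (arcs G)) * (4 * B)"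
  proof (rule X_norm_le[OF p])
    fix j assume jA: "j \<in> arcs G"
    then have j: "j \<in> {1..N}" by (simp add: arcs_G)
    have ix: "(2 * j - 1 + 1) div 2 = j" "(2 * j + 1) div 2 = j" "odd (2 * j - 1)" using j by auto
    have d1: "dAlembert L U (2*j-1) (L j - x) = weak_deriv (L j) (u j) x + v j x" for x
      unfolding dAlembert_def uv using ix by (simp add: Let_def)
    have d2: "dAlembert L U (2*j) x = weak_deriv (L j) (u j) x - v j x" for x
      unfolding dAlembert_def uv using ix by (simp add: Let_def)
    have a: "weak_deriv (L j) (u j) \<in> Lp_space p (leb_seg (L j))" "v j \<in> Lp_space p (leb_seg (L j))"
      using U jA weak_deriv_in_Lp by (auto simp: uv X_wave_def W01p_def Lp_net_def)
    have tri: "norm x \<le> norm (x + y) + norm (x - y)" "norm y \<le> norm (x + y) + norm (x - y)" for x y :: complex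
    proof -
      have "2 * norm x \<le> norm (x + y) + norm (x - y)" "2 * norm y \<le> norm (x + y) + norm (x - y)"
        using norm_triangle_ineq[of "x + y" "x - y"] norm_triangle_ineq4[of "x + y" "x - y"]
        by (simp_all add: mult_2[symmetric] norm_mult)
      then show "norm x \<le> norm (x + y) + norm (x - y)" "norm y \<le> norm (x + y) + norm (x - y)"
        using norm_ge_zero[of x] norm_ge_zero[of y] by linarith+
    qed
    show "Lp_norm p (leb_seg (L j)) (weak_deriv (L j) (u j)) \<le> 4 * B"
      by (rule comp[OF j a(1)]) (unfold d1 d2, rule tri)
    show "Lp_norm p (leb_seg (L j)) (v j) \<le> 4 * B"
      by (rule comp[OF j a(2)]) (unfold d1 d2, rule tri)
  qed (use N_pos B in \<open>auto simp: arcs_G\<close>)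
  then show ?thesis by (simp add: uv arcs_G)
qed

text \<open>There are only countably many words, so from almost every time all backward delays stay
  where the recursion and the initial condition hold. The solution is then a combination of
  polynomially many translates of the data, with exponentially small coefficients.\<close>

lemma exp_stable_of_class_wt_decay:
  fixes K \<gamma> :: real
  assumes p: "1 \<le> p" and L: "\<And>j. j \<in> {1..N} \<Longrightarrow> 0 < L j"
    and K: "0 \<le> K" "0 < \<gamma>"
    and decay: "\<And>h t i k s. (\<And>x. h x \<in> \<DD>) \<Longrightarrow> i \<in> {1..2*N} \<Longrightarrow> k \<in> {1..2*N} \<Longrightarrow>
      \<bar>class_wt {1..2*N} (L_tr L) (\<lambda>x. M_tr G Vu (h x)) t i k s\<bar> \<le>
        K * Suc (nat \<lfloor>s / Min (L ` {1..N})\<rfloor>) ^ card {1..2*N} * exp (- \<gamma> * s)"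
  shows "exp_stable G Vu L (Linfty Vd \<DD>) p"
proof -
  let ?I = "{1..2*N}" and ?\<tau> = "L_tr L" and ?d = "Min (L ` {1..N})"
  interpret D: delays ?I ?\<tau> ?d using delays_L_tr[OF L N_pos] by simp
  define b where "b = Max (?\<tau> ` ?I)"
  have b: "?\<tau> i \<le> b" if "i \<in> ?I" for i unfolding b_def using that by (intro Max_ge) auto
  have b_pos: "0 < b" using b[of 1] D.tau_pos[of 1] N_pos by simp
  \<comment> \<open>Bounds both the polynomial factor in the decay hypothesis and the number of
    lengths up to \<open>T + b\<close>.\<close>
  define P where "P T = real (Suc (nat \<lfloor>(T + b) / ?d\<rfloor>) ^ (2*N))" for T
  have P1: "1 \<le> P T" for T unfolding P_def by (metis of_nat_1 of_nat_le_iff one_le_power le_add1 plus_1_eq_Suc)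
  \<comment> \<open>Bounds every coefficient active at a time in \<open>[T - b, T]\<close>, because
    the lengths occurring there exceed \<open>T - b\<close>. The 1 added to \<open>K\<close> makes Q
    T \<ge> 1 when T \<le> b, for the times at which the datum itself is read.\<close>
  define Q where "Q T = (K + 1) * P T * exp (\<gamma> * b - \<gamma> * T)" for T
  have Q0: "0 \<le> Q T" for T using K P1[of T] by (simp add: Q_def)
  \<comment> \<open>The factor 3 in the exponent counts powers of \<open>P\<close>: one sits in
    \<open>Q\<close> and two come from the squared number of dominating functions. Half of the decay
    rate absorbs them.\<close>
  obtain C where C: "0 < C" "\<And>T. 0 \<le> T \<Longrightarrow> real (Suc (nat \<lfloor>(T + b) / ?d\<rfloor>)) ^ (2*N*3) \<le> C * exp (\<gamma> / 2 * T)"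
    using poly_le_exp[of ?d "\<gamma> / 2" b "2*N*3"] D.d_pos K b_pos by auto
  define K1 where "K1 = 32 * real N * real (2*N)^2 * (K + 1) * exp (\<gamma> * b) * C"
  have K1: "0 < K1" using K C N_pos by (simp add: K1_def)
  have bound: "X_norm G L p (U T) \<le> K1 * exp (- \<gamma> / 2 * T) * X_norm G L p U0"
    if \<eta>: "\<eta> \<in> Linfty Vd \<DD>" and U0: "U0 \<in> X_wave G L Vu p" and sol: "wave_solution G Vu L \<eta> p U0 U" and T: "0 \<le> T"
    for \<eta> U0 U T
  proof -
    let ?m = "\<lambda>t. M_tr G Vu (\<eta> t)"
    define f0 where "f0 = dAlembert L U0"
    have \<eta>D: "\<eta> x \<in> \<DD>" for x using \<eta> by (simp add: Linfty_def)
    have cN: "2 * card (arcs G) = 2 * N" by (simp add: arcs_G)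
    obtain g where g': "\<forall>i\<in>?I. (AE s in lebesgue. s \<in> {- ?\<tau> i..<0} \<longrightarrow> g i s = f0 i (- s)) \<and>
      (AE t in lebesgue. 0 \<le> t \<longrightarrow> g i t = (\<Sum>k=1..2*N. of_real (?m t i k) * g k (t - ?\<tau> k))) \<and>
      (\<forall>t\<ge>0. AE x in leb_seg (?\<tau> i). dAlembert L (U t) i x = g i (t - x))"
      using sol unfolding wave_solution_def transport_solution_def cN f0_def by blast
    have g: "AE s in lebesgue. s \<in> {- ?\<tau> i..<0} \<longrightarrow> g i s = f0 i (- s)"
      "AE t in lebesgue. 0 \<le> t \<longrightarrow> g i t = (\<Sum>k=1..2*N. of_real (?m t i k) * g k (t - ?\<tau> k))"
      "0 \<le> t \<Longrightarrow> AE x in leb_seg (?\<tau> i). dAlembert L (U t) i x = g i (t - x)" if "i \<in> ?I" for i t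
      using g' that by blast+
    have UX: "U T \<in> X_wave G L Vu p" using sol T by (simp add: wave_solution_def)
    \<comment> \<open>All backward shifts at once: each translate of a null set is null, and
      countably many words are involved.\<close>
    define good where "good t \<longleftrightarrow> (\<forall>u. \<forall>i\<in>?I.
        (t - wlen ?\<tau> u \<in> {- ?\<tau> i..<0} \<longrightarrow> g i (t - wlen ?\<tau> u) = f0 i (- (t - wlen ?\<tau> u))) \<and>
        (0 \<le> t - wlen ?\<tau> u \<longrightarrow> g i (t - wlen ?\<tau> u) =
          (\<Sum>k=1..2*N. of_real (?m (t - wlen ?\<tau> u) i k) * g k (t - wlen ?\<tau> u - ?\<tau> k))))" for t
    have good_AE: "AE t in lebesgue. good t"
      unfolding good_def
    proof (subst AE_all_countable, intro allI, rule AE_ball_countable[THEN iffD2, rule_format])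
      fix u i assume i: "i \<in> ?I"
      have "AE t in lebesgue. (t \<in> {- ?\<tau> i..<0} \<longrightarrow> g i t = f0 i (- t)) \<and>
         (0 \<le> t \<longrightarrow> g i t = (\<Sum>k=1..2*N. of_real (?m t i k) * g k (t - ?\<tau> k)))"
        using g(1,2)[OF i] by eventually_elim auto
      from AE_lebesgue_affine[OF _ this, of 1 "- wlen ?\<tau> u"]
      show "AE t in lebesgue. (t - wlen ?\<tau> u \<in> {- ?\<tau> i..<0} \<longrightarrow> g i (t - wlen ?\<tau> u) = f0 i (- (t - wlen ?\<tau> u))) \<and>
        (0 \<le> t - wlen ?\<tau> u \<longrightarrow> g i (t - wlen ?\<tau> u) =
          (\<Sum>k=1..2*N. of_real (?m (t - wlen ?\<tau> u) i k) * g k (t - wlen ?\<tau> u - ?\<tau> k)))"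
        by (simp add: algebra_simps)
    qed auto
    define A where "A = grid ?I ?\<tau> (T + b)"
    have finA: "finite A" unfolding A_def by (rule D.finite_grid)
    have cardA: "real (card A) \<le> P T"
      unfolding A_def grid_def P_def using D.card_wlen_image[of ?\<tau> "T + b"] by (simp only: of_nat_le_iff card_atLeastAtMost) simp
    let ?F = "\<lambda>ks x. ext0 (?\<tau> (fst ks)) (f0 (fst ks)) (snd ks - x)"
    have pw: "norm (g i t) \<le> Q T * (\<Sum>ks\<in>?I \<times> A. norm (?F ks t))"
      if gd: "good t" and i: "i \<in> ?I" and t: "- ?\<tau> i \<le> t" "t \<le> T" "T - b \<le> t" for i t
    proof (cases "t < 0")
      case True
      \<comment> \<open>At negative \<open>t\<close> the datum is itself the term of length 0. Here
        \<open>T\<close> is below \<open>b\<close>, so its coefficient 1 is at most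
        \<open>Q T\<close>.\<close>
      have "g i t = f0 i (- t)" using gd i t True unfolding good_def by (auto dest!: spec[of _ "[]"])
      moreover have A0: "0 \<in> A" unfolding A_def grid_def using T b_pos by (intro image_eqI[of _ _ "[]"]) auto
      ultimately have "norm (g i t) = norm (?F (i, 0) t)" using True t by (simp add: ext0_def)
      also have "\<dots> \<le> (\<Sum>ks\<in>?I \<times> A. norm (?F ks t))"
        by (rule member_le_sum) (use i A0 finA in auto)
      also have "\<dots> \<le> Q T * (\<Sum>ks\<in>?I \<times> A. norm (?F ks t))"
      proof -
        have "\<gamma> * T \<le> \<gamma> * b" using t True K by (intro mult_left_mono) auto
        then have "1 \<le> exp (\<gamma> * b - \<gamma> * T)" by simp
        moreover have "1 \<le> (K + 1) * P T" using mult_mono[of 1 "K + 1" 1 "P T"] K P1[of T] by simp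
        ultimately have "1 \<le> Q T" 
          unfolding Q_def using mult_mono[of 1 "(K + 1) * P T" 1 "exp (\<gamma> * b - \<gamma> * T)"] K P1[of T] by simp
        then show ?thesis using mult_right_mono[of 1 "Q T" "\<Sum>ks\<in>?I \<times> A. norm (?F ks t)"] by (simp add: sum_nonneg)
      qed
      finally show ?thesis .
    next
      case False
      \<comment> \<open>The orbit of \<open>t\<close> under all delays; \<open>good t\<close>
        provides the recursion on its nonnegative part.\<close>
      define X where "X = {t - wlen ?\<tau> u | u. set u \<subseteq> ?I}"
      have "g i t = word_sum ?I ?\<tau> ?m g i t"
      proof (rule D.word_sum_unique[where X = X])
        fix x k assume "x \<in> X" "k \<in> ?I"
        then obtain u where u: "set u \<subseteq> ?I" "x = t - wlen ?\<tau> u" by (auto simp: X_def)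
        then have "x - ?\<tau> k = t - wlen ?\<tau> (k # u)" "set (k # u) \<subseteq> ?I" using \<open>k \<in> ?I\<close> by auto
        then show "x - ?\<tau> k \<in> X" unfolding X_def by blast
      next
        fix x i assume "x \<in> X" "0 \<le> x" "i \<in> ?I"
        then show "g i x = (\<Sum>k\<in>?I. of_real (?m x i k) * g k (x - ?\<tau> k))"
          using gd unfolding good_def X_def by blast
      next
        have "t - wlen ?\<tau> [] \<in> X" unfolding X_def by (intro CollectI exI[of _ "[]"]) simp
        then show "t \<in> X" by simp
      qed (use False i in auto)
      also have "\<dots> = (\<Sum>k\<in>?I. \<Sum>s\<in>A. if - ?\<tau> k \<le> t - s \<and> t - s < 0 then
          of_real (class_wt ?I ?\<tau> ?m t i k s) * g k (t - s) else 0)"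
      proof (rule D.word_sum_by_class[OF finA])
        show "wlen ?\<tau> ` exit_words ?I ?\<tau> t \<subseteq> A"
        proof
          fix x assume "x \<in> wlen ?\<tau> ` exit_words ?I ?\<tau> t"
          then obtain w where w: "w \<in> exit_words ?I ?\<tau> t" "x = wlen ?\<tau> w" by blast
          have "wlen ?\<tau> w \<le> t + b" by (rule D.exit_words_wlen[OF w(1) b])
          then show "x \<in> A" using w t by (auto simp: A_def grid_def exit_words_def)
        qed
      qed
      finally have gS: "g i t = (\<Sum>k\<in>?I. \<Sum>s\<in>A. if - ?\<tau> k \<le> t - s \<and> t - s < 0 then
          of_real (class_wt ?I ?\<tau> ?m t i k s) * g k (t - s) else 0)" .
      have "norm (g i t) \<le> (\<Sum>k\<in>?I. \<Sum>s\<in>A. Q T * norm (?F (k, s) t))"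
        unfolding gS
      proof (intro order_trans[OF norm_sum sum_mono] order_trans[OF norm_sum sum_mono])
        fix k s assume k: "k \<in> ?I" and s: "s \<in> A"
        show "norm (if - ?\<tau> k \<le> t - s \<and> t - s < 0 then
          of_real (class_wt ?I ?\<tau> ?m t i k s) * g k (t - s) else 0) \<le> Q T * norm (?F (k, s) t)"
        proof (cases "- ?\<tau> k \<le> t - s \<and> t - s < 0")
          case True
          obtain u where u: "s = wlen ?\<tau> u" "wlen ?\<tau> u \<le> T + b" using s by (auto simp: A_def grid_def)
          have "t - wlen ?\<tau> u \<in> {- ?\<tau> k..<0}" using True u by simp
          then have "g k (t - s) = f0 k (- (t - s))" using gd k unfolding good_def u(1) by blast
          moreover have "?F (k, s) t = f0 k (- (t - s))" using True by (simp add: ext0_def)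
          ultimately have gF: "g k (t - s) = ?F (k, s) t" by simp
          have e1: "real (Suc (nat \<lfloor>s / ?d\<rfloor>) ^ card ?I) \<le> P T"
          proof -
            have "s / ?d \<le> (T + b) / ?d" using u D.d_pos by (intro divide_right_mono) auto
            then have "Suc (nat \<lfloor>s / ?d\<rfloor>) \<le> Suc (nat \<lfloor>(T + b) / ?d\<rfloor>)" by (simp add: floor_mono nat_mono)
            then have "Suc (nat \<lfloor>s / ?d\<rfloor>) ^ card ?I \<le> Suc (nat \<lfloor>(T + b) / ?d\<rfloor>) ^ (2*N)"
              by (simp add: power_mono del: power_Suc)
            then show ?thesis unfolding P_def by (simp only: of_nat_le_iff)
          qed
          have e2: "exp (- \<gamma> * s) \<le> exp (\<gamma> * b - \<gamma> * T)"
          proof -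
            have "\<gamma> * (T - b) \<le> \<gamma> * s" using True t K by (intro mult_left_mono) auto
            then show ?thesis by (simp add: algebra_simps)
          qed
          have "\<bar>class_wt ?I ?\<tau> ?m t i k s\<bar> \<le> K * real (Suc (nat \<lfloor>s / ?d\<rfloor>) ^ card ?I) * exp (- \<gamma> * s)"
            using decay[where h = \<eta> and t = t and s = s, OF \<eta>D i k] by (simp only: of_nat_power)
          also have "\<dots> \<le> (K + 1) * P T * exp (\<gamma> * b - \<gamma> * T)"
            using K P1[of T] by (intro mult_mono e1 e2) auto
          finally have "\<bar>class_wt ?I ?\<tau> ?m t i k s\<bar> \<le> Q T" by (simp add: Q_def)
          then have "\<bar>class_wt ?I ?\<tau> ?m t i k s\<bar> * norm (?F (k, s) t) \<le> Q T * norm (?F (k, s) t)"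
            by (rule mult_right_mono) simp
          then show ?thesis unfolding gF if_P[OF True] norm_mult norm_of_real .
        next
          case F: False
          show ?thesis unfolding if_not_P[OF F] using Q0[of T] by simp
        qed
      qed
      also have "\<dots> = (\<Sum>ks\<in>?I \<times> A. Q T * norm (?F ks t))"
        unfolding sum.cartesian_product
        by (rule sum.cong[OF refl]) (simp only: case_prod_beta prod.collapse)
      finally show ?thesis by (simp only: sum_distrib_left)
    qed
    define X0 where "X0 = X_norm G L p U0"
    have X0: "0 \<le> X0" unfolding X0_def by (rule X_norm_nonneg[OF p U0])
    define B where "B = Q T * real (card (?I \<times> A))^2 * (4 * X0)"
    have B0: "0 \<le> B" using Q0 X0 by (simp add: B_def)
    have f_le: "Lp_norm p (leb_seg (?\<tau> i)) (dAlembert L (U T) i) \<le> B" if i: "i \<in> ?I" for i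
      unfolding B_def
    proof (rule Lp_dominated(2)[OF p, where \<phi> = "\<lambda>ks x. ?F ks (T - x)"])
      show "dAlembert L (U T) i \<in> borel_measurable (leb_seg (?\<tau> i))"
        using dAlembert_Lp(1)[OF p UX i] by (simp add: Lp_space_def)
      have "AE x in lebesgue. good (T + -1 * x)" using good_AE by (intro AE_lebesgue_affine) auto
      then have "AE x in leb_seg (?\<tau> i). good (T - x)" unfolding AE_leb_seg by (rule AE_mp) auto
      then show "AE x in leb_seg (?\<tau> i). norm (dAlembert L (U T) i x) \<le> Q T * (\<Sum>ks\<in>?I \<times> A. norm (?F ks (T - x)))"
        using g(3)[OF i T] AE_space
      proof eventually_elim
        case (elim x)
        have "norm (g i (T - x)) \<le> Q T * (\<Sum>ks\<in>?I \<times> A. norm (?F ks (T - x)))"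
          by (rule pw[OF elim(1) i]) (use elim(3) b[OF i] T in auto)
        then show ?case using elim(2) by simp
      qed
      fix ks assume ks: "ks \<in> ?I \<times> A"
      then have kI: "fst ks \<in> ?I" by auto
      have f0: "f0 (fst ks) \<in> Lp_space p (leb_seg (?\<tau> (fst ks)))" "Lp_norm p (leb_seg (?\<tau> (fst ks))) (f0 (fst ks)) \<le> 4 * X0"
        unfolding f0_def X0_def using dAlembert_Lp[OF p U0 kI] by auto
      have e: "(\<lambda>x. ?F ks (T - x)) = (\<lambda>x. ext0 (?\<tau> (fst ks)) (f0 (fst ks)) (snd ks - T + 1 * x))"
        by (simp add: algebra_simps)
      show "(\<lambda>x. ?F ks (T - x)) \<in> Lp_space p (leb_seg (?\<tau> i))"
        by (rule Lp_ext0_affine(1)[OF f0(1) _ e]) simp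
      have "Lp_norm p (leb_seg (?\<tau> i)) (\<lambda>x. ?F ks (T - x)) \<le> Lp_norm p (leb_seg (?\<tau> (fst ks))) (f0 (fst ks))"
        by (rule Lp_ext0_affine(2)[OF f0(1) _ e]) simp
      then show "Lp_norm p (leb_seg (?\<tau> i)) (\<lambda>x. ?F ks (T - x)) \<le> 4 * X0" using f0(2) by simp
    qed (use finA Q0 X0 in auto)
    have "X_norm G L p (U T) \<le> 8 * real N * B"
      by (rule X_norm_le_dAlembert[OF p UX B0 f_le])
    also have "\<dots> \<le> 8 * real N * (Q T * (real (2*N) * P T)^2 * (4 * X0))"
    proof -
      have "real (card (?I \<times> A)) \<le> real (2*N) * P T"
        unfolding card_cartesian_product of_nat_mult using cardA by (intro mult_mono) auto
      then have "real (card (?I \<times> A))^2 \<le> (real (2*N) * P T)^2" by (intro power_mono) auto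
      then show ?thesis unfolding B_def using Q0[of T] X0 by (intro mult_left_mono mult_right_mono) auto
    qed
    also have "\<dots> = 32 * real N * real (2*N)^2 * (K + 1) * exp (\<gamma> * b) * (P T ^ 3 * exp (- \<gamma> * T)) * X0"
      unfolding Q_def exp_diff by (simp add: exp_minus field_simps power2_eq_square power3_eq_cube)
    also have "\<dots> \<le> 32 * real N * real (2*N)^2 * (K + 1) * exp (\<gamma> * b) * (C * exp (- \<gamma> / 2 * T)) * X0"
    proof (intro mult_right_mono mult_left_mono X0)
      have "P T ^ 3 = real (Suc (nat \<lfloor>(T + b) / ?d\<rfloor>)) ^ (2*N*3)"
        unfolding P_def of_nat_power power_mult ..
      then have "P T ^ 3 * exp (- \<gamma> * T) \<le> C * exp (\<gamma> / 2 * T) * exp (- \<gamma> * T)"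
        using C(2)[OF T] by (intro mult_right_mono) auto
      also have "\<dots> = C * exp (- \<gamma> / 2 * T)" by (simp add: mult.assoc exp_add[symmetric] algebra_simps)
      finally show "P T ^ 3 * exp (- \<gamma> * T) \<le> C * exp (- \<gamma> / 2 * T)" .
    qed (use K in auto)
    also have "\<dots> = K1 * exp (- \<gamma> / 2 * T) * X_norm G L p U0" by (simp add: K1_def X0_def)
    finally show ?thesis .
  qed
  have "exp_type G Vu L (Linfty Vd \<DD>) p (- \<gamma> / 2)"
    unfolding exp_type_def
  proof (intro allI impI exI[of _ K1] conjI K1 ballI)
    fix \<epsilon> :: real and \<eta> U0 U t
    assume e: "0 < \<epsilon>" and *: "\<eta> \<in> Linfty Vd \<DD>" "U0 \<in> X_wave G L Vu p" "wave_solution G Vu L \<eta> p U0 U" and t: "(0::real) \<le> t"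
    have X0: "0 \<le> X_norm G L p U0" by (rule X_norm_nonneg[OF p *(2)])
    have "X_norm G L p (U t) \<le> K1 * exp (- \<gamma> / 2 * t) * X_norm G L p U0" by (rule bound[OF * t])
    also have "\<dots> \<le> K1 * exp ((- \<gamma> / 2 + \<epsilon>) * t) * X_norm G L p U0"
    proof (intro mult_right_mono mult_left_mono X0)
      have "0 \<le> \<epsilon> * t" using e t by simp
      then show "exp (- \<gamma> / 2 * t) \<le> exp ((- \<gamma> / 2 + \<epsilon>) * t)" unfolding exp_le_cancel_iff distrib_right by simp
    qed (use K1 in simp)
    finally show "X_norm G L p (U t) \<le> K1 * exp ((- \<gamma> / 2 + \<epsilon>) * t) * X_norm G L p U0" .
  qed
  then show ?thesis unfolding exp_stable_def using K by (intro exI[of _ "- \<gamma> / 2"]) auto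
qed

end

text \<open>The differences of the numbers of visits to each edge form an integer vector. Equal
  \<Lambda>-lengths put it in \<open>Z_lat N \<Lambda>\<close>, hence in \<open>Z_lat N L\<close>.
  Components \<open>2 * j - 1\<close> and \<open>2 * j\<close> share the length of edge
  \<open>j\<close>, so letters are first projected to edges.\<close>

lemma V_plus_wlen_determined:
  assumes L: "L \<in> V_plus N \<Lambda>" and u: "set u \<subseteq> {1..2*N}" and v: "set v \<subseteq> {1..2*N}"
    and eq: "wlen (L_tr \<Lambda>) u = wlen (L_tr \<Lambda>) v"
  shows "wlen (L_tr L) u = wlen (L_tr L) v"
proof -
  let ?e = "\<lambda>i. (i + 1) div 2 :: nat"
  have e: "?e i \<in> {1..N}" if "i \<in> {1..2*N}" for i using that by (rule index_cases) auto
  have su: "set (map ?e u) \<subseteq> {1..N}" and sv: "set (map ?e v) \<subseteq> {1..N}" using u v e by auto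
  have map: "wlen (L_tr \<sigma>) w = wlen \<sigma> (map ?e w)" for \<sigma> w
    by (simp add: wlen_def L_tr_def[abs_def] comp_def)
  define n where "n = restrict (\<lambda>j. int (count_list (map ?e u) j) - int (count_list (map ?e v) j)) {1..N}"
  have n: "(\<Sum>j=1..N. \<sigma> j * of_int (n j)) = wlen (L_tr \<sigma>) u - wlen (L_tr \<sigma>) v" for \<sigma>
    unfolding map wlen_eq_sum_count[OF finite_atLeastAtMost su] wlen_eq_sum_count[OF finite_atLeastAtMost sv] sum_subtractf[symmetric]
    by (rule sum.cong) (auto simp: n_def algebra_simps)
  have "n \<in> Z_lat N \<Lambda>" unfolding Z_lat_def using n[of \<Lambda>] eq by (auto simp: n_def)
  then have "n \<in> Z_lat N L" using L by (auto simp: V_plus_def)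
  then show ?thesis using n[of L] by (simp add: Z_lat_def)
qed

theorem corollary5p15:
  fixes G :: "('v, nat) pre_digraph" and N :: nat and Vd Vu :: "'v set"
    and \<Lambda> :: "nat \<Rightarrow> real" and \<DD> :: "('v \<Rightarrow> real) set"
  assumes "network_graph N G Vd Vu"
    and "\<Lambda> \<in> {1..N} \<rightarrow>\<^sub>E {0<..}"
    and "\<DD> \<subseteq> Vd \<rightarrow>\<^sub>E {0..}"
  shows "(\<exists>p::ennreal. 1 \<le> p \<and> exp_stable G Vu \<Lambda> (Linfty Vd \<DD>) p) \<longleftrightarrow>
         (\<forall>L\<in>V_plus N \<Lambda>. \<forall>p::ennreal. 1 \<le> p \<longrightarrow> exp_stable G Vu L (Linfty Vd \<DD>) p)"
proof
  interpret network N G Vd Vu by unfold_locales fact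
  have \<Lambda>: "0 < \<Lambda> j" if "j \<in> {1..N}" for j using assms(2) that by auto
  assume "\<exists>p::ennreal. 1 \<le> p \<and> exp_stable G Vu \<Lambda> (Linfty Vd \<DD>) p"
  then obtain p where p: "1 \<le> p" "exp_stable G Vu \<Lambda> (Linfty Vd \<DD>) p" by blast
  have "\<exists>K\<ge>0. \<exists>\<gamma>>0. \<forall>h i k s. (\<forall>x. h x \<in> \<DD>) \<and> i \<in> {1..2*N} \<and> k \<in> {1..2*N} \<longrightarrow>
      \<bar>class_wt {1..2*N} (L_tr \<Lambda>) (\<lambda>x. M_tr G Vu (h x)) 0 i k s\<bar> \<le> K * exp (- \<gamma> * s)"
    by (rule class_wt_decay[OF p(1) \<Lambda> assms(3) p(2)])
  then obtain K \<gamma> where K: "0 \<le> K" "0 < \<gamma>"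
    and all: "\<forall>h i k s. (\<forall>x. h x \<in> \<DD>) \<and> i \<in> {1..2*N} \<and> k \<in> {1..2*N} \<longrightarrow>
      \<bar>class_wt {1..2*N} (L_tr \<Lambda>) (\<lambda>x. M_tr G Vu (h x)) 0 i k s\<bar> \<le> K * exp (- \<gamma> * s)"
    by (elim exE conjE) (rule that)
  have bound: "\<bar>class_wt {1..2*N} (L_tr \<Lambda>) (\<lambda>x. M_tr G Vu (h x)) 0 i k s\<bar> \<le> K * exp (- \<gamma> * s)"
    if "\<And>x. h x \<in> \<DD>" "i \<in> {1..2*N}" "k \<in> {1..2*N}" for h i k s
    using all that by blast
  show "\<forall>L\<in>V_plus N \<Lambda>. \<forall>p::ennreal. 1 \<le> p \<longrightarrow> exp_stable G Vu L (Linfty Vd \<DD>) p"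
  proof (intro ballI allI impI)
    fix L and p :: ennreal assume LV: "L \<in> V_plus N \<Lambda>" and p: "1 \<le> p"
    then have L: "0 < L j" if "j \<in> {1..N}" for j using that by (auto simp: V_plus_def)
    \<comment> \<open>The smallest ratio of lengths: a word of \<open>L\<close>-length
      \<open>s\<close> has \<Lambda>-length at least \<open>c * s\<close>, so the rate \<gamma>
      becomes \<open>\<gamma> * c\<close>.\<close>
    define c where "c = Min ((\<lambda>j. \<Lambda> j / L j) ` {1..N})"
    have ne: "(\<lambda>j. \<Lambda> j / L j) ` {1..N} \<noteq> {}" using N_pos by auto
    have c: "0 < c" unfolding c_def using ne L \<Lambda> by (subst Min_gr_iff) auto
    have c_le: "c * L_tr L i \<le> L_tr \<Lambda> i" if "i \<in> {1..2*N}" for i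
    proof -
      have j: "(i + 1) div 2 \<in> {1..N}" using that by (rule index_cases) auto
      then have "c \<le> \<Lambda> ((i + 1) div 2) / L ((i + 1) div 2)" unfolding c_def by (intro Min_le) auto
      then show ?thesis using L[OF j] by (simp add: L_tr_def field_simps)
    qed
    show "exp_stable G Vu L (Linfty Vd \<DD>) p"
    proof (rule exp_stable_of_class_wt_decay[OF p _ K(1), where \<gamma> = "\<gamma> * c"])
      fix h :: "real \<Rightarrow> 'v \<Rightarrow> real" and t s i k
      assume h: "\<And>x. h x \<in> \<DD>" and ik: "i \<in> {1..2*N}" "k \<in> {1..2*N}"
      have "\<bar>class_wt {1..2*N} (L_tr L) (\<lambda>x. M_tr G Vu (h x)) t i k s\<bar>
          \<le> K * Suc (nat \<lfloor>s / Min (L ` {1..N})\<rfloor>) ^ card {1..2*N} * exp (- \<gamma> * c * s)"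
        by (rule class_wt_transfer[OF delays_L_tr[OF \<Lambda> N_pos] delays_L_tr[OF L N_pos]
              V_plus_wlen_determined[OF LV] c c_le K bound h ik])
      then show "\<bar>class_wt {1..2*N} (L_tr L) (\<lambda>x. M_tr G Vu (h x)) t i k s\<bar>
          \<le> K * Suc (nat \<lfloor>s / Min (L ` {1..N})\<rfloor>) ^ card {1..2*N} * exp (- (\<gamma> * c) * s)" by simp
    qed (use K c L in auto)
  qed
next
  assume "\<forall>L\<in>V_plus N \<Lambda>. \<forall>p::ennreal. 1 \<le> p \<longrightarrow> exp_stable G Vu L (Linfty Vd \<DD>) p"
  \<comment> \<open>The converse is a specialisation, since \<Lambda> satisfies its own lattice
    condition.\<close>
  moreover have "\<Lambda> \<in> V_plus N \<Lambda>" using assms(2) by (simp add: V_plus_def)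
  ultimately show "\<exists>p::ennreal. 1 \<le> p \<and> exp_stable G Vu \<Lambda> (Linfty Vd \<DD>) p" by blast
qed

end
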